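(* Every progressively measurable process $C$ with $C^{1-R}\in\mathbb{SO}_+$ is uniquely proper; that is, there exists exactly one proper solution associated to $C$.
   Context: Work on a filtered probability space $(\Omega,\mathcal F,(\mathcal F_t)_{t\ge0},\mathbb P)$ whose filtration is complete and continuous, with $\mathcal F_0$ trivial; processes are identified up to indistinguishability. $\mathscr P_+$ (resp. $\mathscr P_{++}$) denotes nonnegative (resp. strictly positive) progressively measurable processes. Parameters $R,S\in(0,1)\cup(1,\infty)$ satisfy $\theta:=\frac{1-R}{1-S}>1$; $\rho:=\frac{\theta-1}{\theta}$. The Epstein--Zin aggregator is $f_{EZ}(c,v)=\frac{c^{1-S}}{1-S}((1-R)v)^{\rho}$ for $c\ge0$, $v\in(1-R)[0,\infty)$. Given $C\in\mathscr P_+$, a solution associated to $C$ is a càdlàg progressively measurable process $V$ with values in $(1-R)[0,\infty)$ such that $\mathbb E\int_0^\infty|f_{EZ}(C_s,V_s)|\,ds<\infty$ and $V_t=\mathbb E[\int_t^\infty f_{EZ}(C_s,V_s)\,ds\mid\mathcal F_t]$ for all $t\ge0$. A solution $V$ is proper if for every $t\ge0$, up to null sets, $(1-R)V_t>0$ on $\{\mathbb E[\int_t^\infty C_s^{1-R}ds\mid\mathcal F_t]>0\}$. For $X\in\mathscr P_+$ let $J^X_t=\mathbb E[\int_t^\infty X_s\,ds\mid\mathcal F_t]$. $\mathbb{SO}$ is the set of $X\in\mathscr P_{++}$ with $\mathbb E\int_0^\infty X_t\,dt<\infty$ such that $kJ^X\le X\le KJ^X$ for some constants $0<k\le K<\infty$;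 $\mathbb{SO}_\nu$ ($\nu\ge0$) is the set of $X\in\mathbb{SO}$ with $(e^{\nu t}X_t)_{t\ge0}\in\mathbb{SO}$, and $\mathbb{SO}_+=\bigcup_{\nu>0}\mathbb{SO}_\nu$. *)

theory Defs
  imports "HOL-Probability.Probability"
begin

text \<open>Time is real-valued; only times t \<ge> 0 are relevant. A filtration is a family
  F :: real \<Rightarrow> 'a measure of sub-sigma-algebras of the probability space M.
  Processes are functions X :: real \<Rightarrow> 'a \<Rightarrow> real (time first).\<close>

definition usual_filtration :: "'a measure \<Rightarrow> (real \<Rightarrow> 'a measure) \<Rightarrow> bool" where
  "usual_filtration M F \<longleftrightarrow>
     prob_space M
   \<and> (\<forall>t\<ge>0. subalgebra M (F t))
   \<and> (\<forall>s t. 0 \<le> s \<and> s \<le> t \<longrightarrow> sets (F s) \<subseteq> sets (F t))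
   \<comment> \<open>complete: F 0 contains every subset of an M-null set\<close>
   \<and> (\<forall>A B. B \<in> null_sets M \<and> A \<subseteq> B \<longrightarrow> A \<in> sets (F 0))
   \<comment> \<open>right-continuous\<close>
   \<and> (\<forall>t\<ge>0. sets (F t) = (\<Inter>s\<in>{t<..}. sets (F s)))
   \<comment> \<open>left-continuous\<close>
   \<and> (\<forall>t>0. sets (F t) = sets (sigma (space M) (\<Union>s\<in>{0..<t}. sets (F s))))
   \<comment> \<open>F 0 trivial\<close>
   \<and> (\<forall>A\<in>sets (F 0). emeasure M A = 0 \<or> emeasure M A = 1)"

definition prog_meas :: "(real \<Rightarrow> 'a measure) \<Rightarrow> (real \<Rightarrow> 'a \<Rightarrow> real) \<Rightarrow> bool" where
  "prog_meas F X \<longleftrightarrow>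
     (\<forall>t\<ge>0. (\<lambda>(s, \<omega>). X s \<omega>) \<in> borel_measurable (restrict_space borel {0..t} \<Otimes>\<^sub>M F t))"

definition Jproc :: "'a measure \<Rightarrow> (real \<Rightarrow> 'a measure) \<Rightarrow> (real \<Rightarrow> 'a \<Rightarrow> real) \<Rightarrow> real \<Rightarrow> 'a \<Rightarrow> real" where
  "Jproc M F X t = real_cond_exp M (F t) (\<lambda>\<omega>. LINT s:{t..}|lborel. X s \<omega>)"

definition SO :: "'a measure \<Rightarrow> (real \<Rightarrow> 'a measure) \<Rightarrow> (real \<Rightarrow> 'a \<Rightarrow> real) \<Rightarrow> bool" where
  "SO M F X \<longleftrightarrow>
     prog_meas F X
   \<and> (\<forall>t\<ge>0. \<forall>\<omega>\<in>space M. X t \<omega> > 0)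
   \<and> (\<integral>\<^sup>+ \<omega>. (\<integral>\<^sup>+ s\<in>{0..}. ennreal (X s \<omega>) \<partial>lborel) \<partial>M) < \<infinity>
   \<and> (\<exists>k K. 0 < k \<and> k \<le> K \<and>
        (\<forall>t\<ge>0. AE \<omega> in M. k * Jproc M F X t \<omega> \<le> X t \<omega> \<and> X t \<omega> \<le> K * Jproc M F X t \<omega>))"

definition SO_nu :: "'a measure \<Rightarrow> (real \<Rightarrow> 'a measure) \<Rightarrow> real \<Rightarrow> (real \<Rightarrow> 'a \<Rightarrow> real) \<Rightarrow> bool" where
  "SO_nu M F \<nu> X \<longleftrightarrow> SO M F X \<and> SO M F (\<lambda>t \<omega>. exp (\<nu> * t) * X t \<omega>)"

definition SO_plus :: "'a measure \<Rightarrow> (real \<Rightarrow> 'a measure) \<Rightarrow> (real \<Rightarrow> 'a \<Rightarrow> real) \<Rightarrow> bool" where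
  "SO_plus M F X \<longleftrightarrow> (\<exists>\<nu>>0. SO_nu M F \<nu> X)"

definition f_EZ :: "real \<Rightarrow> real \<Rightarrow> real \<Rightarrow> real \<Rightarrow> real" where
  "f_EZ R S c v =
     (let \<theta> = (1 - R) / (1 - S); \<rho> = (\<theta> - 1) / \<theta>
      in c powr (1 - S) / (1 - S) * ((1 - R) * v) powr \<rho>)"

definition cadlag_path :: "(real \<Rightarrow> real) \<Rightarrow> bool" where
  "cadlag_path g \<longleftrightarrow>
     (\<forall>t\<ge>0. continuous (at_right t) g \<and> (t > 0 \<longrightarrow> (\<exists>l. (g \<longlongrightarrow> l) (at_left t))))"

definition is_solution ::
  "'a measure \<Rightarrow> (real \<Rightarrow> 'a measure) \<Rightarrow> real \<Rightarrow> real \<Rightarrow> (real \<Rightarrow> 'a \<Rightarrow> real) \<Rightarrow> (real \<Rightarrow> 'a \<Rightarrow> real) \<Rightarrow> bool" where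
  "is_solution M F R S C V \<longleftrightarrow>
     prog_meas F V
   \<and> (\<forall>\<omega>\<in>space M. cadlag_path (\<lambda>t. V t \<omega>))
   \<and> (\<forall>t\<ge>0. \<forall>\<omega>\<in>space M. (1 - R) * V t \<omega> \<ge> 0)
   \<and> (\<integral>\<^sup>+ \<omega>. (\<integral>\<^sup>+ s\<in>{0..}. ennreal \<bar>f_EZ R S (C s \<omega>) (V s \<omega>)\<bar> \<partial>lborel) \<partial>M) < \<infinity>
   \<and> (\<forall>t\<ge>0. AE \<omega> in M.
        V t \<omega> = real_cond_exp M (F t) (\<lambda>\<omega>. LINT s:{t..}|lborel. f_EZ R S (C s \<omega>) (V s \<omega>)) \<omega>)"

definition is_proper_solution ::
  "'a measure \<Rightarrow> (real \<Rightarrow> 'a measure) \<Rightarrow> real \<Rightarrow> real \<Rightarrow> (real \<Rightarrow> 'a \<Rightarrow> real) \<Rightarrow> (real \<Rightarrow> 'a \<Rightarrow> real) \<Rightarrow> bool" where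
  "is_proper_solution M F R S C V \<longleftrightarrow>
     is_solution M F R S C V
   \<and> (\<forall>t\<ge>0. AE \<omega> in M.
        Jproc M F (\<lambda>s \<omega>. C s \<omega> powr (1 - R)) t \<omega> > 0 \<longrightarrow> (1 - R) * V t \<omega> > 0)"

end

theory Submission
  imports Defs
begin

text \<open>With \<open>X = C powr (1 - R)\<close>, \<open>W = (1 - R) V\<close> and \<open>a = (1 - S) / (1 - R)\<close>, which lies in \<open>{0<..<1}\<close>, a solution is a fixed
  point of the map sending \<open>W\<close> to \<open>E[\<integral> X powr a * W powr (1 - a) / a over {t..} | F t]\<close>. This map is monotone and
  homogeneous of degree \<open>1 - a < 1\<close>, so two fixed points, each bounded by a multiple of the other, coincide.
  Since the tail of \<open>X\<close> is comparable to \<open>X\<close>, suitable multiples of \<open>X\<close> are a sub- and a supersolution, and monotone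
  iteration between them yields a fixed point. For uniqueness, every solution is at most a multiple of \<open>X\<close>: Young's
  inequality with an exponential weight, which the decay rate \<open>\<nu>\<close> affords. Every positive solution is at least a multiple of \<open>X\<close>:
  \<open>(W / X) powr a\<close> behaves like a supermartingale with drift bounded away from \<open>0\<close> under a measure with density
  proportional to \<open>X\<close>, and on a short time interval it therefore starts above a fixed constant. Conditional
  expectations are handled throughout by testing against nonnegative \<open>F t\<close>-measurable functions.\<close>

section \<open>Progressive processes and potentials\<close>

text \<open>The exponent \<open>a\<close> equals \<open>1 / \<theta>\<close>, so the parameter
  condition is what places it in the unit interval, and the factor \<open>1 - R\<close> removes the
  sign of \<open>V\<close>. The obstacle is the zero process: because \<open>1 - a > 0\<close> the
  driver vanishes together with \<open>W\<close>, so zero is a fixed point as well, and the driver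
  is not Lipschitz in \<open>W\<close> near it. Uniqueness can hold only among positive solutions,
  and a merely positive solution carries no quantitative bound at the outset; the lower bound by a
  multiple of \<open>X\<close> has to be extracted from the fixed point equation itself. It rests on
  the two-sided tail bounds of \<open>X\<close>, over a time step whose length depends on
  \<open>K\<close>. Integrals with values in \<open>ennreal\<close> let time and expectation be
  exchanged without prior integrability; finiteness is asked for where a term has to be cancelled. A
  solution must also have cadlag paths, while a conditional expectation is chosen anew at each time,
  so existence needs a regular version of the potential: a regularised martingale minus a continuous
  increasing integral.\<close>

lemma AE_le_of_nn_integral_le:
  fixes u v :: "'a \<Rightarrow> ennreal"
  assumes sub: "subalgebra M N"
    and u: "u \<in> borel_measurable N" and v: "v \<in> borel_measurable N"
    and fin: "(\<integral>\<^sup>+\<omega>. u \<omega> \<partial>M) < \<infinity>"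
    and le: "\<And>A. A \<in> sets N \<Longrightarrow> (\<integral>\<^sup>+\<omega>. indicator A \<omega> * u \<omega> \<partial>M) \<le> (\<integral>\<^sup>+\<omega>. indicator A \<omega> * v \<omega> \<partial>M)"
  shows "AE \<omega> in M. u \<omega> \<le> v \<omega>"
proof -
  note um [measurable] = measurable_from_subalg[OF sub u] and vm [measurable] = measurable_from_subalg[OF sub v]
  \<comment> \<open>The set where the inequality fails belongs to \<open>N\<close>, so its indicator
    is an admissible test. On it \<open>u\<close> has finite mass, hence so has \<open>v\<close>,
    and the difference \<open>u - v\<close> may be integrated term by term.\<close>
  define A where "A = {\<omega> \<in> space M. v \<omega> < u \<omega>}"
  have sp: "space N = space M" using sub by (simp add: subalgebra_def)
  have "A = {\<omega> \<in> space N. v \<omega> < u \<omega>}" by (simp add: A_def sp)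
  also have "\<dots> \<in> sets N" using u v by measurable
  finally have AN: "A \<in> sets N" .
  have AM [measurable]: "A \<in> sets M" unfolding A_def by measurable
  let ?g = "indicator A :: 'a \<Rightarrow> ennreal"
  have 1: "(\<integral>\<^sup>+\<omega>. ?g \<omega> * u \<omega> \<partial>M) \<le> (\<integral>\<^sup>+\<omega>. ?g \<omega> * v \<omega> \<partial>M)"
    by (rule le[OF AN])
  have vu: "(\<integral>\<^sup>+\<omega>. ?g \<omega> * v \<omega> \<partial>M) \<le> (\<integral>\<^sup>+\<omega>. ?g \<omega> * u \<omega> \<partial>M)"
    by (intro nn_integral_mono) (auto simp: A_def indicator_def)
  also have "\<dots> \<le> (\<integral>\<^sup>+\<omega>. u \<omega> \<partial>M)"
    by (intro nn_integral_mono) (auto simp: indicator_def)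
  finally have finv: "(\<integral>\<^sup>+\<omega>. ?g \<omega> * v \<omega> \<partial>M) < \<infinity>" using fin by (simp add: le_less_trans)
  have "(\<integral>\<^sup>+\<omega>. ?g \<omega> * u \<omega> - ?g \<omega> * v \<omega> \<partial>M) = (\<integral>\<^sup>+\<omega>. ?g \<omega> * u \<omega> \<partial>M) - (\<integral>\<^sup>+\<omega>. ?g \<omega> * v \<omega> \<partial>M)"
    by (rule nn_integral_diff) (use finv in \<open>auto simp: A_def indicator_def\<close>)
  also have "\<dots> = 0" using 1 finv by (simp add: diff_eq_0_iff_ennreal less_top)
  finally have "AE \<omega> in M. ?g \<omega> * u \<omega> - ?g \<omega> * v \<omega> = 0"
    by (subst (asm) nn_integral_0_iff_AE) auto
  then show ?thesis
  proof (rule AE_mp, intro AE_I2 impI)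
    fix \<omega> assume "\<omega> \<in> space M" and z: "?g \<omega> * u \<omega> - ?g \<omega> * v \<omega> = 0"
    show "u \<omega> \<le> v \<omega>"
    proof (rule ccontr)
      assume "\<not> ?thesis"
      then have "\<omega> \<in> A" "v \<omega> < u \<omega>" using \<open>\<omega> \<in> space M\<close> by (auto simp: A_def)
      then show False using z by (auto simp: diff_eq_0_iff_ennreal)
    qed
  qed
qed

text \<open>Kept in \<open>ennreal\<close>, so that tails can be formed and compared before any path
  is known to be integrable.\<close>

definition tail_integral :: "(real \<Rightarrow> 'a \<Rightarrow> real) \<Rightarrow> real \<Rightarrow> 'a \<Rightarrow> ennreal" where
  "tail_integral \<phi> t \<omega> = (\<integral>\<^sup>+s\<in>{t..}. ennreal (\<phi> s \<omega>) \<partial>lborel)"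

locale filtered_space = prob_space M for M :: "'a measure" +
  fixes F :: "real \<Rightarrow> 'a measure"
  assumes subalgebra_F: "0 \<le> t \<Longrightarrow> subalgebra M (F t)"
    and F_mono: "0 \<le> s \<Longrightarrow> s \<le> t \<Longrightarrow> sets (F s) \<subseteq> sets (F t)"
    and null_F: "B \<in> null_sets M \<Longrightarrow> A \<subseteq> B \<Longrightarrow> A \<in> sets (F 0)"
    and F_right: "0 \<le> t \<Longrightarrow> sets (F t) = (\<Inter>s\<in>{t<..}. sets (F s))"
begin

section \<open>Progressive measurability over the filtration\<close>

lemma space_F: "0 \<le> t \<Longrightarrow> space (F t) = space M"
  using subalgebra_F by (auto simp: subalgebra_def)

lemma sigma_finite_F: "0 \<le> t \<Longrightarrow> sigma_finite_subalgebra M (F t)"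
  by (intro finite_measure_subalgebra_is_sigma_finite)
    (simp add: finite_measure_subalgebra_def finite_measure_subalgebra_axioms_def finite_measure_axioms subalgebra_F)

lemma measurable_F_M: "f \<in> measurable (F t) N \<Longrightarrow> 0 \<le> t \<Longrightarrow> f \<in> measurable M N"
  using measurable_from_subalg[OF subalgebra_F] by blast

lemma measurable_F_mono: "f \<in> measurable (F s) N \<Longrightarrow> 0 \<le> s \<Longrightarrow> s \<le> t \<Longrightarrow> f \<in> measurable (F t) N"
  using F_mono[of s t] space_F[of s] space_F[of t] unfolding measurable_def by auto

text \<open>The clamp \<open>max 0 (min s t)\<close> maps the line measurably onto
  \<open>{0..t}\<close> and fixes every point of it. Restricted time spaces thereby disappear from
  later measurability arguments.\<close>

lemma prog_meas_iff:
  "prog_meas F X \<longleftrightarrow> (\<forall>t\<ge>0. (\<lambda>(s, \<omega>). X (max 0 (min s t)) \<omega>) \<in> borel_measurable (borel \<Otimes>\<^sub>M F t))"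
proof -
  have "(\<lambda>(s, \<omega>). X s \<omega>) \<in> borel_measurable (restrict_space borel {0..t} \<Otimes>\<^sub>M F t) \<longleftrightarrow>
        (\<lambda>(s, \<omega>). X (max 0 (min s t)) \<omega>) \<in> borel_measurable (borel \<Otimes>\<^sub>M F t)" (is "?L \<longleftrightarrow> ?R") if t: "0 \<le> t" for t
  proof
    assume L: ?L
    have c: "(\<lambda>s. max 0 (min s t)) \<in> measurable borel (restrict_space borel {0..t})"
      by (rule measurable_restrict_space2) (use t in auto)
    have m: "(\<lambda>(s, \<omega>). (max 0 (min s t), \<omega>)) \<in> measurable (borel \<Otimes>\<^sub>M F t) (restrict_space borel {0..t} \<Otimes>\<^sub>M F t)"
      unfolding split_beta
      by (intro measurable_Pair measurable_compose[OF measurable_fst c] measurable_snd)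
    show ?R using measurable_compose[OF m L] by (simp add: split_beta)
  next
    assume R: ?R
    have c: "(\<lambda>s. s) \<in> measurable (restrict_space borel {0..t}) borel"
      by (rule measurable_restrict_space1) auto
    have m: "(\<lambda>(s, \<omega>). (s, \<omega>)) \<in> measurable (restrict_space borel {0..t} \<Otimes>\<^sub>M F t) (borel \<Otimes>\<^sub>M F t)"
      unfolding split_beta
      by (intro measurable_Pair measurable_compose[OF measurable_fst c] measurable_snd)
    have "(\<lambda>(s, \<omega>). X (max 0 (min s t)) \<omega>) \<in> borel_measurable (restrict_space borel {0..t} \<Otimes>\<^sub>M F t)"
      using measurable_compose[OF m R] by (simp add: split_beta)
    then show ?L
      by (rule measurable_cong[THEN iffD1, rotated]) (auto simp: space_pair_measure space_restrict_space)
  qed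
  then show ?thesis by (auto simp: prog_meas_def)
qed

lemma prog_meas_adapted:
  assumes "prog_meas F X" "0 \<le> t"
  shows "X t \<in> borel_measurable (F t)"
proof -
  have "(\<lambda>(s, \<omega>). X (max 0 (min s t)) \<omega>) \<in> borel_measurable (borel \<Otimes>\<^sub>M F t)"
    using assms by (simp add: prog_meas_iff)
  from measurable_compose[OF measurable_Pair1' this, of t] assms(2) show ?thesis by simp
qed

lemma prog_meas_M: "prog_meas F X \<Longrightarrow> 0 \<le> t \<Longrightarrow> X t \<in> borel_measurable M"
  using prog_meas_adapted measurable_F_M by blast

lemma prog_meas_joint_F:
  assumes "prog_meas F X" "0 \<le> t"
  shows "(\<lambda>(s, \<omega>). X (max 0 (min s t)) \<omega>) \<in> borel_measurable (borel \<Otimes>\<^sub>M F t)"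
  using assms by (simp add: prog_meas_iff)

text \<open>Clamping time at an integer \<open>n\<close> leaves a function measurable for
  \<open>F (real n)\<close>, hence for \<open>M\<close>; at each point the clamped values are
  eventually constant in \<open>n\<close>.\<close>

lemma prog_meas_joint:
  assumes X: "prog_meas F X"
  shows "(\<lambda>(s, \<omega>). X (max 0 s) \<omega>) \<in> borel_measurable (borel \<Otimes>\<^sub>M M)"
proof -
  have "(\<lambda>p. X (max 0 (min (fst p) (real n))) (snd p)) \<in> borel_measurable (borel \<Otimes>\<^sub>M M)" for n :: nat
  proof -
    have id: "(\<lambda>\<omega>. \<omega>) \<in> measurable M (F (real n))"
      using subalgebra_F[of "real n"] by (auto simp: measurable_def subalgebra_def sets.sets_into_space Int_absorb2)
    have m: "(\<lambda>(s, \<omega>). (s, \<omega>)) \<in> measurable (borel \<Otimes>\<^sub>M M) (borel \<Otimes>\<^sub>M F (real n))"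
      unfolding split_beta
      by (intro measurable_Pair measurable_compose[OF measurable_snd id] measurable_fst)
    show ?thesis using measurable_compose[OF m prog_meas_joint_F[OF X, of "real n"]] by (simp add: split_beta)
  qed
  moreover have "(\<lambda>n. X (max 0 (min (fst p) (real n))) (snd p)) \<longlonglongrightarrow> X (max 0 (fst p)) (snd p)" for p :: "real \<times> 'a"
  proof (rule tendsto_eventually)
    show "\<forall>\<^sub>F n in sequentially. X (max 0 (min (fst p) (real n))) (snd p) = X (max 0 (fst p)) (snd p)"
      using eventually_ge_at_top[of "nat \<lceil>fst p\<rceil>"] by eventually_elim (auto simp: min_absorb1 le_nat_iff nat_le_iff ceiling_le_iff)
  qed
  ultimately have "(\<lambda>p. X (max 0 (fst p)) (snd p)) \<in> borel_measurable (borel \<Otimes>\<^sub>M M)"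
    by (rule borel_measurable_LIMSEQ_real[rotated])
  then show ?thesis by (simp add: split_beta)
qed

lemma prog_meas_LIMSEQ:
  assumes "\<And>n. prog_meas F (X n)" and "\<And>t \<omega>. 0 \<le> t \<Longrightarrow> \<omega> \<in> space M \<Longrightarrow> (\<lambda>n::nat. X n t \<omega>) \<longlonglongrightarrow> Y t \<omega>"
  shows "prog_meas F Y"
  unfolding prog_meas_iff
proof (intro allI impI)
  fix t :: real assume t: "0 \<le> t"
  show "(\<lambda>(s, \<omega>). Y (max 0 (min s t)) \<omega>) \<in> borel_measurable (borel \<Otimes>\<^sub>M F t)"
    by (rule borel_measurable_LIMSEQ_real[where u="\<lambda>n (s, \<omega>). X n (max 0 (min s t)) \<omega>"])
      (use prog_meas_joint_F[OF assms(1) t] assms(2) t in \<open>auto simp: space_pair_measure space_F\<close>)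
qed

lemma prog_meas_compose2:
  assumes X: "prog_meas F X" and Y: "prog_meas F Y"
    and [measurable]: "(\<lambda>p. f (fst p) (snd p)) \<in> borel_measurable (borel \<Otimes>\<^sub>M borel)"
  shows "prog_meas F (\<lambda>t \<omega>. f (X t \<omega>) (Y t \<omega>) :: real)"
  unfolding prog_meas_iff
proof (intro allI impI)
  fix t :: real assume t: "0 \<le> t"
  note [measurable] = prog_meas_joint_F[OF X t, unfolded split_beta] prog_meas_joint_F[OF Y t, unfolded split_beta]
  have "(\<lambda>p. (X (max 0 (min (fst p) t)) (snd p), Y (max 0 (min (fst p) t)) (snd p))) \<in> measurable (borel \<Otimes>\<^sub>M F t) (borel \<Otimes>\<^sub>M borel)"
    by measurable
  from measurable_compose[OF this assms(3)]
  show "(\<lambda>(s, \<omega>). f (X (max 0 (min s t)) \<omega>) (Y (max 0 (min s t)) \<omega>)) \<in> borel_measurable (borel \<Otimes>\<^sub>M F t)"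
    by (simp add: split_beta)
qed

text \<open>Time is rounded up to a dyadic grid and cut off at \<open>t\<close>. The rounded process
  is pieced together from countably many variables, each observed no later than \<open>t\<close>,
  and right-continuity brings it back to \<open>X\<close>.\<close>

lemma prog_meas_right_continuous:
  assumes ad: "\<And>t. 0 \<le> t \<Longrightarrow> X t \<in> borel_measurable (F t)"
    and rc: "\<And>t \<omega>. 0 \<le> t \<Longrightarrow> \<omega> \<in> space M \<Longrightarrow> continuous (at_right t) (\<lambda>s. X s \<omega>)"
  shows "prog_meas F X"
  unfolding prog_meas_iff
proof (intro allI impI)
  fix t :: real assume t: "0 \<le> t"
  \<comment> \<open>The added 1 makes the rounding strict: for \<open>s < t\<close> the points
    approach \<open>s\<close> from the right without reaching it. At \<open>s = t\<close> the
    cut-off returns \<open>t\<close> itself.\<close>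
  define q where "q n s = min t (max 0 ((of_int \<lfloor>2 ^ n * s\<rfloor> + 1) / 2 ^ n))" for n :: nat and s :: real
  have qm: "(\<lambda>p. X (q n (max 0 (min (fst p) t))) (snd p)) \<in> borel_measurable (borel \<Otimes>\<^sub>M F t)" for n
  proof -
    have "(\<lambda>p. X (min t (max 0 ((of_int i + 1) / 2 ^ n))) (snd p)) \<in> borel_measurable (borel \<Otimes>\<^sub>M F t)" for i :: int
    proof (rule measurable_compose[OF measurable_snd])
      show "X (min t (max 0 ((of_int i + 1) / 2 ^ n))) \<in> borel_measurable (F t)"
        by (rule measurable_F_mono[OF ad]) (use t in auto)
    qed
    moreover have "(\<lambda>p. \<lfloor>2 ^ n * max 0 (min (fst p) t)\<rfloor>) \<in> measurable (borel \<Otimes>\<^sub>M F t) (count_space UNIV)"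
      by measurable
    ultimately show ?thesis unfolding q_def by (rule measurable_compose_countable)
  qed
  have lim: "(\<lambda>n. X (q n s) \<omega>) \<longlonglongrightarrow> X s \<omega>" if s: "0 \<le> s" "s \<le> t" and w: "\<omega> \<in> space M" for s \<omega>
  proof (cases "s = t")
    case True
    have "q n s = s" for n
    proof -
      have "2 ^ n * t < of_int \<lfloor>2 ^ n * t\<rfloor> + 1" by linarith
      then have "t \<le> (of_int \<lfloor>2 ^ n * t\<rfloor> + 1) / 2 ^ n" by (simp add: field_simps)
      then show ?thesis using True t by (auto simp: q_def)
    qed
    then show ?thesis by simp
  next
    case False
    then have st: "s < t" using s by simp
    have gt: "s < q n s" for n
    proof -
      have "2 ^ n * s < of_int \<lfloor>2 ^ n * s\<rfloor> + 1" by linarith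
      then have "s < (of_int \<lfloor>2 ^ n * s\<rfloor> + 1) / 2 ^ n" by (simp add: field_simps)
      then show ?thesis using st by (auto simp: q_def)
    qed
    have le: "q n s \<le> s + (1/2) ^ n" for n
    proof -
      have "of_int \<lfloor>2 ^ n * s\<rfloor> \<le> 2 ^ n * s" by linarith
      then have "(of_int \<lfloor>2 ^ n * s\<rfloor> + 1) / 2 ^ n \<le> s + (1/2) ^ n" by (simp add: field_simps)
      then show ?thesis using s by (auto simp: q_def min_le_iff_disj)
    qed
    have "(\<lambda>n. s + (1/2::real) ^ n) \<longlonglongrightarrow> s + 0"
      by (intro tendsto_intros LIMSEQ_power_zero) auto
    then have lim_ub: "(\<lambda>n. s + (1/2::real) ^ n) \<longlonglongrightarrow> s" by simp
    have "(\<lambda>n. q n s) \<longlonglongrightarrow> s"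
      by (rule tendsto_sandwich[OF _ _ tendsto_const lim_ub])
        (rule always_eventually, rule allI, use gt le less_imp_le in blast)+
    then have "filterlim (\<lambda>n. q n s) (at_right s) sequentially"
      by (auto simp: filterlim_at less_imp_neq[OF gt, symmetric] gt)
    moreover have "((\<lambda>u. X u \<omega>) \<longlongrightarrow> X s \<omega>) (at_right s)"
      using rc[OF s(1) w] by (simp add: continuous_within)
    ultimately show ?thesis by (rule filterlim_compose[rotated])
  qed
  have "(\<lambda>p. X (max 0 (min (fst p) t)) (snd p)) \<in> borel_measurable (borel \<Otimes>\<^sub>M F t)"
    by (rule borel_measurable_LIMSEQ_real[OF _ qm]) (auto intro!: lim simp: t space_pair_measure space_F)
  then show "(\<lambda>(s, \<omega>). X (max 0 (min s t)) \<omega>) \<in> borel_measurable (borel \<Otimes>\<^sub>M F t)" by (simp add: split_beta)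
qed

section \<open>Tail integrals and potentials in weak form\<close>

lemma tail_integral_measurable:
  assumes "prog_meas F \<phi>" "0 \<le> t"
  shows "tail_integral \<phi> t \<in> borel_measurable M"
proof -
  note [measurable] = prog_meas_joint[OF assms(1)]
  have "(\<lambda>\<omega>. \<integral>\<^sup>+s. ennreal (\<phi> (max 0 s) \<omega>) * indicator {t..} s \<partial>lborel) \<in> borel_measurable M"
    by measurable
  moreover have "(\<integral>\<^sup>+s. ennreal (\<phi> (max 0 s) \<omega>) * indicator {t..} s \<partial>lborel) = tail_integral \<phi> t \<omega>" for \<omega>
    unfolding tail_integral_def using assms(2) by (intro nn_integral_cong) (auto simp: indicator_def)
  ultimately show ?thesis by (metis (no_types, lifting) ext)
qed

text \<open>Tonelli's theorem. Joint measurability concerns nonnegative times only, so the process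
  is evaluated at \<open>max 0 s\<close>, which changes nothing on \<open>A\<close>.\<close>

lemma nn_integral_swap:
  assumes "prog_meas F \<phi>" and A: "A \<subseteq> {0..}" and [measurable]: "A \<in> sets borel" "g \<in> borel_measurable M"
  shows "(\<integral>\<^sup>+\<omega>. g \<omega> * (\<integral>\<^sup>+s\<in>A. ennreal (\<phi> s \<omega>) \<partial>lborel) \<partial>M) = (\<integral>\<^sup>+s\<in>A. (\<integral>\<^sup>+\<omega>. g \<omega> * ennreal (\<phi> s \<omega>) \<partial>M) \<partial>lborel)"
proof -
  note jm [measurable] = prog_meas_joint[OF assms(1)]
  have e: "\<phi> s = \<phi> (max 0 s)" if "s \<in> A" for s using that A by (auto simp: max_def)
  interpret pair_sigma_finite M "lborel :: real measure" ..
  have "(\<integral>\<^sup>+s\<in>A. ennreal (\<phi> s \<omega>) \<partial>lborel) = (\<integral>\<^sup>+s. ennreal (\<phi> (max 0 s) \<omega>) * indicator A s \<partial>lborel)" for \<omega>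
    by (rule nn_integral_cong) (auto simp: indicator_def simp flip: e)
  then have "(\<integral>\<^sup>+\<omega>. g \<omega> * (\<integral>\<^sup>+s\<in>A. ennreal (\<phi> s \<omega>) \<partial>lborel) \<partial>M) =
      (\<integral>\<^sup>+\<omega>. g \<omega> * (\<integral>\<^sup>+s. ennreal (\<phi> (max 0 s) \<omega>) * indicator A s \<partial>lborel) \<partial>M)"
    by simp
  also have "\<dots> = (\<integral>\<^sup>+\<omega>. (\<integral>\<^sup>+s. g \<omega> * (ennreal (\<phi> (max 0 s) \<omega>) * indicator A s) \<partial>lborel) \<partial>M)"
  proof (rule nn_integral_cong)
    fix \<omega> assume [measurable]: "\<omega> \<in> space M"
    show "g \<omega> * (\<integral>\<^sup>+s. ennreal (\<phi> (max 0 s) \<omega>) * indicator A s \<partial>lborel) =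
        (\<integral>\<^sup>+s. g \<omega> * (ennreal (\<phi> (max 0 s) \<omega>) * indicator A s) \<partial>lborel)"
      by (rule nn_integral_cmult[symmetric]) measurable
  qed
  also have "\<dots> = (\<integral>\<^sup>+s. (\<integral>\<^sup>+\<omega>. g \<omega> * (ennreal (\<phi> (max 0 s) \<omega>) * indicator A s) \<partial>M) \<partial>lborel)"
    by (rule Fubini'[symmetric]) measurable
  also have "\<dots> = (\<integral>\<^sup>+s\<in>A. (\<integral>\<^sup>+\<omega>. g \<omega> * ennreal (\<phi> (max 0 s) \<omega>) \<partial>M) \<partial>lborel)"
    by (intro nn_integral_cong) (auto simp: indicator_def)
  also have "\<dots> = (\<integral>\<^sup>+s\<in>A. (\<integral>\<^sup>+\<omega>. g \<omega> * ennreal (\<phi> s \<omega>) \<partial>M) \<partial>lborel)"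
    by (rule nn_integral_cong) (auto simp: indicator_def simp flip: e)
  finally show ?thesis .
qed

lemma tail_integral_swap:
  assumes "prog_meas F \<phi>" "0 \<le> t" "g \<in> borel_measurable M"
  shows "(\<integral>\<^sup>+\<omega>. g \<omega> * tail_integral \<phi> t \<omega> \<partial>M) = (\<integral>\<^sup>+s\<in>{t..}. (\<integral>\<^sup>+\<omega>. g \<omega> * ennreal (\<phi> s \<omega>) \<partial>M) \<partial>lborel)"
  unfolding tail_integral_def using assms by (intro nn_integral_swap) auto

text \<open>The weak form of \<open>W t\<close> being the conditional expectation of the tail of
  \<open>\<phi>\<close> given \<open>F t\<close>. Since \<open>ennreal\<close> sends negative
  numbers to 0, it characterises \<open>W\<close> only together with
  \<open>nonneg_proc W\<close>.\<close>

definition potential :: "(real \<Rightarrow> 'a \<Rightarrow> real) \<Rightarrow> (real \<Rightarrow> 'a \<Rightarrow> real) \<Rightarrow> bool" where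
  "potential \<phi> W \<longleftrightarrow> (\<forall>t\<ge>0. \<forall>g\<in>borel_measurable (F t).
     (\<integral>\<^sup>+\<omega>. g \<omega> * ennreal (W t \<omega>) \<partial>M) = (\<integral>\<^sup>+\<omega>. g \<omega> * tail_integral \<phi> t \<omega> \<partial>M))"

definition integrable_proc :: "(real \<Rightarrow> 'a \<Rightarrow> real) \<Rightarrow> bool" where
  "integrable_proc \<phi> \<longleftrightarrow> (\<integral>\<^sup>+\<omega>. tail_integral \<phi> 0 \<omega> \<partial>M) < \<infinity>"

definition nonneg_proc :: "(real \<Rightarrow> 'a \<Rightarrow> real) \<Rightarrow> bool" where
  "nonneg_proc X \<longleftrightarrow> prog_meas F X \<and> (\<forall>t\<ge>0. \<forall>\<omega>\<in>space M. 0 \<le> X t \<omega>)"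

lemma potentialD:
  "potential \<phi> W \<Longrightarrow> 0 \<le> t \<Longrightarrow> g \<in> borel_measurable (F t) \<Longrightarrow>
     (\<integral>\<^sup>+\<omega>. g \<omega> * ennreal (W t \<omega>) \<partial>M) = (\<integral>\<^sup>+\<omega>. g \<omega> * tail_integral \<phi> t \<omega> \<partial>M)"
  by (auto simp: potential_def)

lemma tail_integral_antimono: "s \<le> t \<Longrightarrow> tail_integral \<phi> t \<omega> \<le> tail_integral \<phi> s \<omega>"
  unfolding tail_integral_def by (intro nn_integral_mono) (auto simp: indicator_def)

lemma potential_finite:
  assumes "potential \<phi> W" "integrable_proc \<phi>" "0 \<le> t"
  shows "(\<integral>\<^sup>+\<omega>. ennreal (W t \<omega>) \<partial>M) < \<infinity>"
proof -
  have "(\<integral>\<^sup>+\<omega>. ennreal (W t \<omega>) \<partial>M) = (\<integral>\<^sup>+\<omega>. tail_integral \<phi> t \<omega> \<partial>M)"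
    using potentialD[OF assms(1,3), of "\<lambda>_. 1"] by simp
  also have "\<dots> \<le> (\<integral>\<^sup>+\<omega>. tail_integral \<phi> 0 \<omega> \<partial>M)"
    by (intro nn_integral_mono tail_integral_antimono assms)
  finally show ?thesis using assms(2) by (simp add: integrable_proc_def le_less_trans)
qed

text \<open>The tail decreases in time, and a test at time \<open>s\<close> is also one at time
  \<open>t\<close>: this is the supermartingale property in weak form.\<close>

lemma potential_antimono:
  assumes "potential \<phi> W" "0 \<le> s" "s \<le> t" "g \<in> borel_measurable (F s)"
  shows "(\<integral>\<^sup>+\<omega>. g \<omega> * ennreal (W t \<omega>) \<partial>M) \<le> (\<integral>\<^sup>+\<omega>. g \<omega> * ennreal (W s \<omega>) \<partial>M)"
proof -
  have "(\<integral>\<^sup>+\<omega>. g \<omega> * ennreal (W t \<omega>) \<partial>M) = (\<integral>\<^sup>+\<omega>. g \<omega> * tail_integral \<phi> t \<omega> \<partial>M)"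
    using assms by (intro potentialD) (auto intro: measurable_F_mono)
  also have "\<dots> \<le> (\<integral>\<^sup>+\<omega>. g \<omega> * tail_integral \<phi> s \<omega> \<partial>M)"
    by (intro nn_integral_mono mult_left_mono tail_integral_antimono assms) auto
  also have "\<dots> = (\<integral>\<^sup>+\<omega>. g \<omega> * ennreal (W s \<omega>) \<partial>M)"
    using assms by (intro potentialD[symmetric]) auto
  finally show ?thesis .
qed

text \<open>The processes are compared almost surely at each time, with a null set that may depend
  on the time. After the exchange of integrals the inner integral runs over \<open>\<omega>\<close>,
  where these null sets do no harm.\<close>

lemma tail_integral_test_mono:
  assumes "prog_meas F \<phi>" "prog_meas F \<psi>" and t: "0 \<le> t" and c: "0 \<le> c"
    and le: "\<And>s. t \<le> s \<Longrightarrow> AE \<omega> in M. \<phi> s \<omega> \<le> c * \<psi> s \<omega>"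
    and g: "g \<in> borel_measurable M"
  shows "(\<integral>\<^sup>+\<omega>. g \<omega> * tail_integral \<phi> t \<omega> \<partial>M) \<le> ennreal c * (\<integral>\<^sup>+\<omega>. g \<omega> * tail_integral \<psi> t \<omega> \<partial>M)"
proof -
  have "(\<integral>\<^sup>+\<omega>. g \<omega> * tail_integral \<phi> t \<omega> \<partial>M) = (\<integral>\<^sup>+s\<in>{t..}. (\<integral>\<^sup>+\<omega>. g \<omega> * ennreal (\<phi> s \<omega>) \<partial>M) \<partial>lborel)"
    using assms by (intro tail_integral_swap)
  also have "\<dots> \<le> (\<integral>\<^sup>+s\<in>{t..}. (\<integral>\<^sup>+\<omega>. g \<omega> * ennreal (c * \<psi> s \<omega>) \<partial>M) \<partial>lborel)"
  proof (intro nn_integral_mono)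
    fix s :: real
    have "(\<integral>\<^sup>+\<omega>. g \<omega> * ennreal (\<phi> s \<omega>) \<partial>M) \<le> (\<integral>\<^sup>+\<omega>. g \<omega> * ennreal (c * \<psi> s \<omega>) \<partial>M)" if "t \<le> s"
      using le[OF that] by (intro nn_integral_mono_AE) (auto intro!: mult_left_mono ennreal_leI)
    then show "(\<integral>\<^sup>+\<omega>. g \<omega> * ennreal (\<phi> s \<omega>) \<partial>M) * indicator {t..} s
        \<le> (\<integral>\<^sup>+\<omega>. g \<omega> * ennreal (c * \<psi> s \<omega>) \<partial>M) * indicator {t..} s"
      by (auto simp: indicator_def)
  qed
  also have "\<dots> = (\<integral>\<^sup>+s\<in>{t..}. (\<integral>\<^sup>+\<omega>. (ennreal c * g \<omega>) * ennreal (\<psi> s \<omega>) \<partial>M) \<partial>lborel)"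
    using c by (intro nn_integral_cong) (simp add: ennreal_mult' ac_simps)
  also have "\<dots> = (\<integral>\<^sup>+\<omega>. (ennreal c * g \<omega>) * tail_integral \<psi> t \<omega> \<partial>M)"
    by (rule tail_integral_swap[symmetric]) (use assms in auto)
  also have "\<dots> = ennreal c * (\<integral>\<^sup>+\<omega>. g \<omega> * tail_integral \<psi> t \<omega> \<partial>M)"
    using g tail_integral_measurable[OF assms(2) t] by (simp add: mult.assoc nn_integral_cmult)
  finally show ?thesis .
qed

lemma potential_mono:
  assumes "prog_meas F \<phi>" "prog_meas F \<psi>" "potential \<phi> W" "potential \<psi> Z" "prog_meas F W" "nonneg_proc Z"
    and "integrable_proc \<phi>" and t: "0 \<le> t" and c: "0 \<le> c"
    and le: "\<And>s. t \<le> s \<Longrightarrow> AE \<omega> in M. \<phi> s \<omega> \<le> c * \<psi> s \<omega>"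
  shows "AE \<omega> in M. W t \<omega> \<le> c * Z t \<omega>"
proof -
  have Z: "prog_meas F Z" "\<And>\<omega>. \<omega> \<in> space M \<Longrightarrow> 0 \<le> Z t \<omega>" using assms by (auto simp: nonneg_proc_def)
  note [measurable] = prog_meas_adapted[OF assms(5) t] prog_meas_adapted[OF Z(1) t]
  note [measurable] = prog_meas_M[OF Z(1) t]
  have "AE \<omega> in M. ennreal (W t \<omega>) \<le> ennreal (c * Z t \<omega>)"
  proof (rule AE_le_of_nn_integral_le[OF subalgebra_F[OF t]])
    fix A assume A: "A \<in> sets (F t)"
    let ?g = "indicator A :: 'a \<Rightarrow> ennreal"
    have g: "?g \<in> borel_measurable (F t)" using A by simp
    note gM [measurable] = measurable_F_M[OF g t]
    have "(\<integral>\<^sup>+\<omega>. ?g \<omega> * ennreal (W t \<omega>) \<partial>M) = (\<integral>\<^sup>+\<omega>. ?g \<omega> * tail_integral \<phi> t \<omega> \<partial>M)"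
      using assms g by (intro potentialD)
    also have "\<dots> \<le> ennreal c * (\<integral>\<^sup>+\<omega>. ?g \<omega> * tail_integral \<psi> t \<omega> \<partial>M)"
      using assms gM by (intro tail_integral_test_mono)
    also have "\<dots> = ennreal c * (\<integral>\<^sup>+\<omega>. ?g \<omega> * ennreal (Z t \<omega>) \<partial>M)"
      using assms g by (simp add: potentialD)
    also have "\<dots> = (\<integral>\<^sup>+\<omega>. ennreal c * (?g \<omega> * ennreal (Z t \<omega>)) \<partial>M)"
      by (rule nn_integral_cmult[symmetric]) measurable
    also have "\<dots> = (\<integral>\<^sup>+\<omega>. ?g \<omega> * ennreal (c * Z t \<omega>) \<partial>M)"
      using c by (intro nn_integral_cong) (simp add: ennreal_mult' ac_simps)
    finally show "(\<integral>\<^sup>+\<omega>. ?g \<omega> * ennreal (W t \<omega>) \<partial>M) \<le> (\<integral>\<^sup>+\<omega>. ?g \<omega> * ennreal (c * Z t \<omega>) \<partial>M)" .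
  qed (use potential_finite[OF assms(3,7) t] in simp_all)
  then show ?thesis
    by (rule AE_mp) (use Z(2) c in \<open>auto simp: ennreal_le_iff intro!: AE_I2\<close>)
qed

end

section \<open>Tangent inequalities and substitution\<close>

text \<open>The right side is the tangent at \<open>y\<close> of the concave power, obtained from
  Young's inequality for \<open>x\<close> and \<open>y\<close> after division by
  \<open>y powr (1 - a)\<close>.\<close>

lemma powr_le_tangent:
  fixes a x y :: real
  assumes a: "0 < a" "a < 1" and x: "0 \<le> x" and y: "0 < y"
  shows "x powr a \<le> a * y powr (a - 1) * x + (1 - a) * y powr a"
proof (cases "x = 0")
  case True then show ?thesis using a by simp
next
  case False
  then have "x powr a * y powr (1 - a) \<le> a * x + (1 - a) * y"
    using Youngs_inequality_0[of a "1 - a" x y] a x y by simp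
  then have "(x powr a * y powr (1 - a)) * y powr (a - 1) \<le> (a * x + (1 - a) * y) * y powr (a - 1)"
    by (rule mult_right_mono) simp
  moreover have "(x powr a * y powr (1 - a)) * y powr (a - 1) = x powr a"
    using y by (simp add: mult.assoc flip: powr_add)
  moreover have "y * y powr (a - 1) = y powr a" using y by (simp add: powr_mult_base)
  then have "(a * x + (1 - a) * y) * y powr (a - 1) = a * y powr (a - 1) * x + (1 - a) * y powr a"
    by (simp add: distrib_right mult.assoc mult.left_commute)
  ultimately show ?thesis by simp
qed

text \<open>The tangent at \<open>y\<close> of the convex power, its negative term moved across so
  that only nonnegative terms remain and the inequality survives the passage to
  \<open>ennreal\<close>. For \<open>z = x / y\<close> it follows from
  \<open>ln z \<le> z - 1\<close> and \<open>1 + u \<le> exp u\<close>.\<close>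

lemma powr_ge_tangent:
  fixes a x y :: real
  assumes a: "0 < a" "a < 1" and x: "0 < x" and y: "0 < y"
  shows "(2 - a) * y powr (a - 1) \<le> x powr (a - 1) + (1 - a) * y powr (a - 2) * x"
proof -
  define z where "z = x / y"
  have z: "0 < z" using x y by (simp add: z_def)
  have "1 + (a - 1) * (z - 1) \<le> 1 + (a - 1) * ln z"
    using ln_le_minus_one[OF z] a by (intro add_left_mono mult_left_mono_neg) auto
  also have "\<dots> \<le> exp ((a - 1) * ln z)" by (rule exp_ge_add_one_self)
  also have "\<dots> = z powr (a - 1)" using z by (simp add: powr_def)
  finally have "(1 + (a - 1) * (z - 1)) * y powr (a - 1) \<le> z powr (a - 1) * y powr (a - 1)"
    by (rule mult_right_mono) simp
  moreover have "z powr (a - 1) * y powr (a - 1) = x powr (a - 1)"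
    using x y by (simp add: z_def powr_divide)
  moreover have "z * y powr (a - 1) = y powr (a - 2) * x"
    using y powr_mult_base[of y "a - 2"] by (simp add: z_def field_simps)
  then have "(1 + (a - 1) * (z - 1)) * y powr (a - 1) = (2 - a) * y powr (a - 1) - (1 - a) * (y powr (a - 2) * x)"
    by (simp add: algebra_simps)
  ultimately show ?thesis by (simp add: algebra_simps)
qed

text \<open>Young's inequality for \<open>c * x\<close> and
  \<open>c powr (- (a / (1 - a))) * w\<close>: the powers of \<open>c\<close> cancel in the product,
  so the weight can be chosen freely.\<close>

lemma weighted_young:
  fixes a c x w :: real
  assumes a: "0 < a" "a < 1" and "0 \<le> x" "0 \<le> w" and c: "0 < c"
  shows "x powr a * w powr (1 - a) \<le> a * c * x + (1 - a) * c powr (- (a / (1 - a))) * w"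
proof (cases "x = 0 \<or> w = 0")
  case True then show ?thesis using assms by auto
next
  case False
  then have p: "0 < x" "0 < w" using assms by auto
  have "(c * x) powr a * (c powr (- (a / (1 - a))) * w) powr (1 - a)
      \<le> a * (c * x) + (1 - a) * (c powr (- (a / (1 - a))) * w)"
    using Youngs_inequality_0[of a "1 - a" "c * x" "c powr (- (a / (1 - a))) * w"] a p c by simp
  moreover have "(c * x) powr a * (c powr (- (a / (1 - a))) * w) powr (1 - a) = x powr a * w powr (1 - a)"
  proof -
    have "c powr a * (c powr (- (a / (1 - a)))) powr (1 - a) = 1"
      using c a by (simp add: powr_powr flip: powr_add)
    then show ?thesis using p c by (simp add: powr_mult)
  qed
  ultimately show ?thesis by (simp add: mult.assoc)
qed

text \<open>The substitution rule \<open>\<integral> \<psi> \<Psi>\<^sup>a\<^sup>-\<^sup>1 = [-\<Psi>\<^sup>a / a]\<close> for \<open>\<Psi>' = - \<psi>\<close>, where \<open>\<psi>\<close> is only measurable: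
  the inequality is summed over a grid, on which it follows from concavity, and
  passes to the limit by Fatou's lemma.\<close>

lemma nn_integral_powr_substitution:
  fixes \<psi> :: "real \<Rightarrow> real" and a c t T :: real
  assumes a: "0 < a" "a < 1" and c: "0 < c" and tT: "t < T"
    and [measurable]: "\<psi> \<in> borel_measurable borel"
    and fin: "(\<integral>\<^sup>+s\<in>{t..T}. ennreal (\<psi> s) \<partial>lborel) < \<infinity>"
  defines "\<Psi> \<equiv> (\<lambda>s. c + enn2real (\<integral>\<^sup>+u\<in>{s..T}. ennreal (\<psi> u) \<partial>lborel))"
  shows "(\<integral>\<^sup>+s\<in>{t..T}. ennreal (\<psi> s) * ennreal (\<Psi> s powr (a - 1)) \<partial>lborel) \<le> ennreal (\<Psi> t powr a / a)"
proof -
  define P where "P s = (\<integral>\<^sup>+u\<in>{s..T}. ennreal (\<psi> u) \<partial>lborel)" for s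
  have P_anti: "P s' \<le> P s" if "s \<le> s'" for s s'
    unfolding P_def by (intro nn_integral_mono) (use that in \<open>auto simp: indicator_def\<close>)
  have P_fin: "P s < \<infinity>" if "t \<le> s" for s
    using P_anti[OF that] fin by (simp add: P_def le_less_trans)
  have P_split: "P s = (\<integral>\<^sup>+u\<in>{s..<s'}. ennreal (\<psi> u) \<partial>lborel) + P s'" if "s \<le> s'" "s' \<le> T" for s s'
  proof -
    have "P s = (\<integral>\<^sup>+u. ennreal (\<psi> u) * indicator {s..<s'} u + ennreal (\<psi> u) * indicator {s'..T} u \<partial>lborel)"
      unfolding P_def by (intro nn_integral_cong) (use that in \<open>auto simp: indicator_def\<close>)
    also have "\<dots> = (\<integral>\<^sup>+u\<in>{s..<s'}. ennreal (\<psi> u) \<partial>lborel) + P s'"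
      unfolding P_def by (intro nn_integral_add) auto
    finally show ?thesis .
  qed
  have Psi: "\<Psi> s = c + enn2real (P s)" for s by (simp add: \<Psi>_def P_def)
  have Psi_pos: "0 < \<Psi> s" for s using c by (simp add: Psi add_pos_nonneg)
  \<comment> \<open>On one cell the integrand is frozen at the left end, where \<open>\<Psi>\<close>
    is largest and its negative power smallest. The tangent of the concave power at
    \<open>\<Psi> s\<close> then bounds the increment.\<close>
  have step: "(\<integral>\<^sup>+u\<in>{s..<s'}. ennreal (\<psi> u) \<partial>lborel) * ennreal (\<Psi> s powr (a - 1)) + ennreal (\<Psi> s' powr a / a)
      \<le> ennreal (\<Psi> s powr a / a)" if s: "t \<le> s" "s \<le> s'" "s' \<le> T" for s s'
  proof -
    let ?I = "\<integral>\<^sup>+u\<in>{s..<s'}. ennreal (\<psi> u) \<partial>lborel"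
    have If: "?I < \<infinity>" using P_split[OF s(2,3)] P_fin[OF s(1)] by (metis ennreal_add_eq_top infinity_ennreal_def less_top)
    then obtain i where i: "?I = ennreal i" "0 \<le> i" by (metis ennreal_cases infinity_ennreal_def less_irrefl)
    have "enn2real (P s) = i + enn2real (P s')"
      using P_split[OF s(2,3)] P_fin[of s'] s i by (simp add: enn2real_plus less_top)
    then have di: "\<Psi> s = i + \<Psi> s'" by (simp add: Psi)
    have "\<Psi> s' powr a \<le> a * \<Psi> s powr (a - 1) * \<Psi> s' + (1 - a) * \<Psi> s powr a"
      using a Psi_pos[of s] Psi_pos[of s'] by (intro powr_le_tangent) auto
    also have "(1 - a) * \<Psi> s powr a = (1 - a) * (\<Psi> s powr (a - 1) * \<Psi> s)"
      using Psi_pos[of s] powr_mult_base[of "\<Psi> s" "a - 1"] by (simp add: mult.commute)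
    also have "\<Psi> s' = \<Psi> s - i" using di by simp
    also have "a * \<Psi> s powr (a - 1) * (\<Psi> s - i) + (1 - a) * (\<Psi> s powr (a - 1) * \<Psi> s)
        = \<Psi> s powr (a - 1) * \<Psi> s - a * (i * \<Psi> s powr (a - 1))" by (simp add: algebra_simps)
    also have "\<Psi> s powr (a - 1) * \<Psi> s = \<Psi> s powr a"
      using Psi_pos[of s] powr_mult_base[of "\<Psi> s" "a - 1"] by (simp add: mult.commute)
    finally have "(a * (i * \<Psi> s powr (a - 1)) + \<Psi> s' powr a) / a \<le> \<Psi> s powr a / a"
      using a di by (intro divide_right_mono) auto
    then have "i * \<Psi> s powr (a - 1) + \<Psi> s' powr a / a \<le> \<Psi> s powr a / a"
      using a by (simp add: add_divide_distrib)
    then show ?thesis using i a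
      by (simp flip: ennreal_mult' ennreal_plus add: ennreal_leI)
  qed
  define h where "h n = (T - t) / real (Suc n)" for n
  have hp: "0 < h n" for n using tT by (simp add: h_def)
  \<comment> \<open>\<open>gr n s\<close> is the left end of the cell that contains
    \<open>s\<close>, in the grid of \<open>Suc n\<close> equal cells starting at \<open>t\<close>
    and ending in \<open>T\<close>.\<close>
  define gr where "gr n s = t + h n * of_int \<lfloor>(s - t) / h n\<rfloor>" for n s
  have gr_le: "gr n s \<le> s" for n s
  proof -
    have "h n * of_int \<lfloor>(s - t) / h n\<rfloor> \<le> h n * ((s - t) / h n)"
      using hp[of n] by (intro mult_left_mono) auto
    then show ?thesis using hp[of n] by (simp add: gr_def)
  qed
  have gr_gt: "s - h n < gr n s" for n s
  proof -
    have "h n * ((s - t) / h n - 1) < h n * of_int \<lfloor>(s - t) / h n\<rfloor>"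
      using hp[of n] by (intro mult_strict_left_mono) linarith+
    moreover have "h n * ((s - t) / h n - 1) = s - t - h n"
      using hp[of n] by (simp add: field_simps)
    ultimately show ?thesis by (simp add: gr_def)
  qed
  have gr_ge: "t \<le> gr n s" if "t \<le> s" for n s
    using that hp[of n] by (simp add: gr_def)
  \<comment> \<open>Summing the cell estimates telescopes; the second summand on the left is the
    part not yet spent.\<close>
  have grid: "(\<integral>\<^sup>+s\<in>{t..<t + h n * real m}. ennreal (\<psi> s) * ennreal (\<Psi> (gr n s) powr (a - 1)) \<partial>lborel)
      + ennreal (\<Psi> (t + h n * real m) powr a / a) \<le> ennreal (\<Psi> t powr a / a)" if "m \<le> Suc n" for n m
    using that
  proof (induction m)
    case 0 then show ?case by simp
  next
    case (Suc m)
    let ?x = "t + h n * real m" and ?x' = "t + h n * real (Suc m)"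
    let ?f = "\<lambda>s. ennreal (\<psi> s) * ennreal (\<Psi> (gr n s) powr (a - 1))"
    have x: "t \<le> ?x" "?x \<le> ?x'" using hp[of n] by (auto simp: algebra_simps)
    have "h n * real (Suc m) \<le> h n * real (Suc n)" using Suc.prems hp[of n] by (intro mult_left_mono) auto
    then have x': "?x' \<le> T" by (simp add: h_def)
    have eq: "gr n s = ?x" if "s \<in> {?x..<?x'}" for s
    proof -
      have "\<lfloor>(s - t) / h n\<rfloor> = int m"
        using that hp[of n] by (intro floor_unique) (auto simp: field_simps)
      then show ?thesis by (simp add: gr_def)
    qed
    have "(\<integral>\<^sup>+s\<in>{t..<?x'}. ?f s \<partial>lborel)
        = (\<integral>\<^sup>+s. ?f s * indicator {t..<?x} s + (ennreal (\<psi> s) * indicator {?x..<?x'} s) * ennreal (\<Psi> ?x powr (a - 1)) \<partial>lborel)"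
    proof (rule nn_integral_cong)
      fix s
      show "?f s * indicator {t..<?x'} s = ?f s * indicator {t..<?x} s + (ennreal (\<psi> s) * indicator {?x..<?x'} s) * ennreal (\<Psi> ?x powr (a - 1))"
        using eq[of s] x by (cases "s < ?x") (auto simp: indicator_def)
    qed
    also have "\<dots> = (\<integral>\<^sup>+s\<in>{t..<?x}. ?f s \<partial>lborel) + (\<integral>\<^sup>+s\<in>{?x..<?x'}. ennreal (\<psi> s) \<partial>lborel) * ennreal (\<Psi> ?x powr (a - 1))"
    proof (subst nn_integral_add)
      show "(\<lambda>s. ?f s * indicator {t..<?x} s) \<in> borel_measurable lborel"
        unfolding \<Psi>_def gr_def by measurable
    qed (auto simp: nn_integral_multc)
    finally have "(\<integral>\<^sup>+s\<in>{t..<?x'}. ?f s \<partial>lborel) + ennreal (\<Psi> ?x' powr a / a) =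
      (\<integral>\<^sup>+s\<in>{t..<?x}. ?f s \<partial>lborel) + ((\<integral>\<^sup>+s\<in>{?x..<?x'}. ennreal (\<psi> s) \<partial>lborel) * ennreal (\<Psi> ?x powr (a - 1))
        + ennreal (\<Psi> ?x' powr a / a))" by (simp add: add.assoc)
    also have "\<dots> \<le> (\<integral>\<^sup>+s\<in>{t..<?x}. ?f s \<partial>lborel) + ennreal (\<Psi> ?x powr a / a)"
      by (intro add_left_mono step x x')
    also have "\<dots> \<le> ennreal (\<Psi> t powr a / a)" using Suc by simp
    finally show ?case .
  qed
  have h0: "h \<longlonglongrightarrow> 0" unfolding h_def by real_asymp
  have grlim: "(\<lambda>n. gr n s) \<longlonglongrightarrow> s" for s
  proof (rule tendsto_sandwich[of "\<lambda>n. s - h n" _ _ "\<lambda>_. s"])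
    have "(\<lambda>n. s - h n) \<longlonglongrightarrow> s - 0" by (intro tendsto_intros h0)
    then show "(\<lambda>n. s - h n) \<longlonglongrightarrow> s" by simp
  qed (use gr_le gr_gt in \<open>auto intro!: always_eventually less_imp_le\<close>)
  \<comment> \<open>Dominated convergence, with the finite integral over the whole interval as
    bound.\<close>
  have Plim: "(\<lambda>n. P (gr n s)) \<longlonglongrightarrow> P s" if s: "t \<le> s" for s
    unfolding P_def
  proof (rule nn_integral_dominated_convergence[where w="\<lambda>u. ennreal (\<psi> u) * indicator {t..T} u"])
    show "AE u in lborel. (\<lambda>n. ennreal (\<psi> u) * indicator {gr n s..T} u) \<longlonglongrightarrow> ennreal (\<psi> u) * indicator {s..T} u"
    proof (rule AE_I2)
      fix u
      have "\<forall>\<^sub>F n in sequentially. indicator {gr n s..T} u = (indicator {s..T} u :: ennreal)"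
      proof (cases "u < s")
        case True
        then have "\<forall>\<^sub>F n in sequentially. u < gr n s" using order_tendstoD(1)[OF grlim[of s]] by blast
        then show ?thesis by eventually_elim (use True in \<open>auto simp: indicator_def\<close>)
      next
        case False
        have "indicator {gr n s..T} u = (indicator {s..T} u :: ennreal)" for n
          using False gr_le[of n s] by (auto simp: indicator_def)
        then show ?thesis by simp
      qed
      then show "(\<lambda>n. ennreal (\<psi> u) * indicator {gr n s..T} u) \<longlonglongrightarrow> ennreal (\<psi> u) * indicator {s..T} u"
        by (intro tendsto_eventually) (auto elim: eventually_mono)
    qed
    show "AE u in lborel. ennreal (\<psi> u) * indicator {gr n s..T} u \<le> ennreal (\<psi> u) * indicator {t..T} u" for n
      using gr_ge[OF s] by (intro AE_I2) (auto simp: indicator_def intro: order_trans)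
  qed (use fin in auto)
  have Psilim: "(\<lambda>n. ennreal (\<Psi> (gr n s) powr (a - 1))) \<longlonglongrightarrow> ennreal (\<Psi> s powr (a - 1))" if s: "t \<le> s" for s
  proof -
    have "(\<lambda>n. enn2real (P (gr n s))) \<longlonglongrightarrow> enn2real (P s)"
    proof (rule tendsto_enn2real)
      show "(\<lambda>n. P (gr n s)) \<longlonglongrightarrow> ennreal (enn2real (P s))"
        using Plim[OF s] P_fin[OF s] by (simp add: ennreal_enn2real)
    qed simp
    then have lim: "(\<lambda>n. \<Psi> (gr n s)) \<longlonglongrightarrow> \<Psi> s" unfolding Psi by (intro tendsto_add tendsto_const)
    show ?thesis
      using tendsto_powr[OF lim tendsto_const, of "a - 1"] Psi_pos[of s] by (intro tendsto_ennrealI) auto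
  qed
  \<comment> \<open>Half-open, because the grid cells are; the endpoint \<open>T\<close> is a null
    set.\<close>
  let ?f = "\<lambda>n s. ennreal (\<psi> s) * ennreal (\<Psi> (gr n s) powr (a - 1)) * indicator {t..<T} s"
  have "(\<integral>\<^sup>+s\<in>{t..T}. ennreal (\<psi> s) * ennreal (\<Psi> s powr (a - 1)) \<partial>lborel)
      = (\<integral>\<^sup>+s. liminf (\<lambda>n. ?f n s) \<partial>lborel)"
  proof (rule nn_integral_cong_AE)
    have "AE s in lborel. s \<noteq> T" by (rule AE_lborel_singleton)
    then show "AE s in lborel. ennreal (\<psi> s) * ennreal (\<Psi> s powr (a - 1)) * indicator {t..T} s = liminf (\<lambda>n. ?f n s)"
    proof eventually_elim
      case (elim s)
      show ?case
      proof (cases "t \<le> s \<and> s < T")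
        case True
        have "(\<lambda>n. ?f n s) \<longlonglongrightarrow> ennreal (\<psi> s) * ennreal (\<Psi> s powr (a - 1)) * indicator {t..<T} s"
          using ennreal_tendsto_cmult[OF _ Psilim[of s], of "ennreal (\<psi> s)"] True by simp
        then have "liminf (\<lambda>n. ?f n s) = ennreal (\<psi> s) * ennreal (\<Psi> s powr (a - 1)) * indicator {t..<T} s"
          by (intro lim_imp_Liminf) auto
        then show ?thesis using True by (simp add: indicator_def)
      next
        case False
        then show ?thesis using elim by (auto simp: indicator_def Liminf_const)
      qed
    qed
  qed
  also have "\<dots> \<le> liminf (\<lambda>n. \<integral>\<^sup>+s. ?f n s \<partial>lborel)"
    by (rule nn_integral_liminf) (unfold \<Psi>_def gr_def, measurable)
  also have "\<dots> \<le> ennreal (\<Psi> t powr a / a)"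
  proof (rule Liminf_le)
    have e: "t + h n * real (Suc n) = T" for n by (simp add: h_def)
    have "(\<integral>\<^sup>+s. ?f n s \<partial>lborel) \<le> ennreal (\<Psi> t powr a / a)" for n
      using grid[of "Suc n" n] unfolding e by (auto intro: order_trans[rotated])
    then show "\<forall>\<^sub>F n in sequentially. (\<integral>\<^sup>+s. ?f n s \<partial>lborel) \<le> ennreal (\<Psi> t powr a / a)" by simp
  qed simp
  finally show ?thesis .
qed

section \<open>Upper bound for solutions\<close>

text \<open>The aggregator multiplied by \<open>1 - R\<close>: for \<open>a = 1 / \<theta>\<close>
  the exponent \<open>\<rho>\<close> is \<open>1 - a\<close>, the power \<open>X powr a\<close> is
  \<open>C powr (1 - S)\<close>, and \<open>1 / a\<close> is
  \<open>(1 - R) / (1 - S)\<close>.\<close>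

definition EZ_driver :: "real \<Rightarrow> (real \<Rightarrow> 'a \<Rightarrow> real) \<Rightarrow> (real \<Rightarrow> 'a \<Rightarrow> real) \<Rightarrow> real \<Rightarrow> 'a \<Rightarrow> real" where
  "EZ_driver a X W t \<omega> = X t \<omega> powr a * W t \<omega> powr (1 - a) / a"

context filtered_space
begin

text \<open>The inequalities \<open>k J \<le> X \<le> K J\<close> that define the class
  \<open>SO\<close>, in weak form: tested at time \<open>t\<close>, the process \<open>J\<close> may
  be replaced by the tail integral of \<open>X\<close>.\<close>

definition tail_bounds :: "real \<Rightarrow> real \<Rightarrow> (real \<Rightarrow> 'a \<Rightarrow> real) \<Rightarrow> bool" where
  "tail_bounds k K X \<longleftrightarrow> (\<forall>t\<ge>0. \<forall>g\<in>borel_measurable (F t).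
     ennreal k * (\<integral>\<^sup>+\<omega>. g \<omega> * tail_integral X t \<omega> \<partial>M) \<le> (\<integral>\<^sup>+\<omega>. g \<omega> * ennreal (X t \<omega>) \<partial>M) \<and>
     (\<integral>\<^sup>+\<omega>. g \<omega> * ennreal (X t \<omega>) \<partial>M) \<le> ennreal K * (\<integral>\<^sup>+\<omega>. g \<omega> * tail_integral X t \<omega> \<partial>M))"

lemma tail_boundsD:
  assumes "tail_bounds k K X" "0 \<le> t" "g \<in> borel_measurable (F t)"
  shows "ennreal k * (\<integral>\<^sup>+\<omega>. g \<omega> * tail_integral X t \<omega> \<partial>M) \<le> (\<integral>\<^sup>+\<omega>. g \<omega> * ennreal (X t \<omega>) \<partial>M)"
    and "(\<integral>\<^sup>+\<omega>. g \<omega> * ennreal (X t \<omega>) \<partial>M) \<le> ennreal K * (\<integral>\<^sup>+\<omega>. g \<omega> * tail_integral X t \<omega> \<partial>M)"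
  using assms by (auto simp: tail_bounds_def)

lemma prog_meas_EZ_driver:
  assumes "prog_meas F X" "prog_meas F W"
  shows "prog_meas F (EZ_driver a X W)"
proof -
  have "prog_meas F (\<lambda>t \<omega>. (\<lambda>x w. x powr a * w powr (1 - a) / a) (X t \<omega>) (W t \<omega>))"
    by (rule prog_meas_compose2[OF assms]) measurable
  then show ?thesis by (simp add: EZ_driver_def[abs_def])
qed

lemma nn_integral_exp_decay:
  fixes b \<gamma> t :: real
  assumes "0 < \<gamma>" "0 \<le> b"
  shows "(\<integral>\<^sup>+s\<in>{t..}. ennreal (b * exp (- \<gamma> * (s - t))) \<partial>lborel) = ennreal (b / \<gamma>)"
proof -
  have "(\<integral>\<^sup>+s\<in>{t..}. ennreal (b * exp (- \<gamma> * (s - t))) \<partial>lborel) = ennreal (0 - (- b / \<gamma> * exp (- \<gamma> * (t - t))))"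
  proof (rule nn_integral_FTC_atLeast[where F = "\<lambda>s. - b / \<gamma> * exp (- \<gamma> * (s - t))"])
    show "((\<lambda>s. - b / \<gamma> * exp (- \<gamma> * (s - t))) \<longlongrightarrow> 0) at_top"
      using assms by real_asymp
  qed (use assms in \<open>auto intro!: derivative_eq_intros\<close>)
  then show ?thesis by simp
qed

text \<open>Young's inequality with the exponentially growing weight \<open>c0 exp (\<nu> (s - t))\<close> on \<open>X\<close> makes the
  coefficient of \<open>W\<close> integrable in time; since the expectation of \<open>W\<close> decreases in time,
  its contribution is absorbed on the left.\<close>

lemma potential_upper_bound:
  assumes a: "0 < a" "a < 1" and X: "nonneg_proc X" and W: "nonneg_proc W"
    and pot: "potential (EZ_driver a X W) W" and int: "integrable_proc (EZ_driver a X W)"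
    and \<nu>: "0 < \<nu>" and k: "0 < k"
    and tb: "tail_bounds k K (\<lambda>t \<omega>. exp (\<nu> * t) * X t \<omega>)"
  shows "\<exists>c>0. \<forall>t\<ge>0. AE \<omega> in M. W t \<omega> \<le> c * X t \<omega>"
proof -
  have Xp: "prog_meas F X" and X0: "\<And>t \<omega>. 0 \<le> t \<Longrightarrow> \<omega> \<in> space M \<Longrightarrow> 0 \<le> X t \<omega>"
    and Wp: "prog_meas F W" and W0: "\<And>t \<omega>. 0 \<le> t \<Longrightarrow> \<omega> \<in> space M \<Longrightarrow> 0 \<le> W t \<omega>"
    using X W by (auto simp: nonneg_proc_def)
  have Dp: "prog_meas F (EZ_driver a X W)" by (rule prog_meas_EZ_driver[OF Xp Wp])
  let ?Y = "\<lambda>t \<omega>. exp (\<nu> * t) * X t \<omega>"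
  have Yp: "prog_meas F ?Y"
    unfolding prog_meas_iff
  proof (intro allI impI)
    fix t :: real assume "0 \<le> t"
    note [measurable] = prog_meas_joint_F[OF Xp this]
    show "(\<lambda>(s, \<omega>). exp (\<nu> * max 0 (min s t)) * X (max 0 (min s t)) \<omega>) \<in> borel_measurable (borel \<Otimes>\<^sub>M F t)"
      by measurable
  qed
  \<comment> \<open>Young's inequality with weight \<open>c\<close> on the first factor puts
    \<open>c powr (- m)\<close> on the second, so a weight growing at rate \<open>\<nu>\<close>
    becomes one decaying at rate \<open>m * \<nu>\<close>.\<close>
  define m where "m = a / (1 - a)"
  have m: "0 < m" using a by (simp add: m_def)
  \<comment> \<open>Solves \<open>(1 - a) / a * c0 powr (- m) / (m * \<nu>) = 1 / 2\<close>: the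
    coefficient of \<open>W\<close> then has total time integral one half.\<close>
  define c0 where "c0 = (2 * (1 - a) / (a * (m * \<nu>))) powr (1 / m)"
  have c0: "0 < c0" using a m \<nu> by (simp add: c0_def)
  have "c0 powr (- m) = inverse (2 * (1 - a) / (a * (m * \<nu>)))"
    using a m \<nu> by (simp add: c0_def powr_powr powr_minus)
  then have c0m: "(1 - a) / a * c0 powr (- m) / (m * \<nu>) = 1 / 2"
    using a m \<nu> by (simp add: field_simps)
  have main: "AE \<omega> in M. ennreal (W t \<omega>) \<le> ennreal (2 * c0 / k * X t \<omega>)" if t: "0 \<le> t" for t
  proof (rule AE_le_of_nn_integral_le[OF subalgebra_F[OF t]])
    show "(\<lambda>\<omega>. ennreal (W t \<omega>)) \<in> borel_measurable (F t)"
      using prog_meas_adapted[OF Wp t] by measurable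
    show "(\<lambda>\<omega>. ennreal (2 * c0 / k * X t \<omega>)) \<in> borel_measurable (F t)"
      using prog_meas_adapted[OF Xp t] by measurable
    show "(\<integral>\<^sup>+\<omega>. ennreal (W t \<omega>) \<partial>M) < \<infinity>" by (rule potential_finite[OF pot int t])
    fix A assume A: "A \<in> sets (F t)"
    let ?g = "indicator A :: 'a \<Rightarrow> ennreal"
    have g: "?g \<in> borel_measurable (F t)" using A by simp
    have gM [measurable]: "?g \<in> borel_measurable M" by (rule measurable_F_M[OF g t])
    note [measurable] = prog_meas_M[OF Xp t] prog_meas_M[OF Wp t]
    define w where "w = (\<integral>\<^sup>+\<omega>. ?g \<omega> * ennreal (W t \<omega>) \<partial>M)"
    have "w \<le> (\<integral>\<^sup>+\<omega>. ennreal (W t \<omega>) \<partial>M)"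
      unfolding w_def by (intro nn_integral_mono) (auto simp: indicator_def)
    then have wf: "w < \<infinity>" using potential_finite[OF pot int t] by simp
    define \<alpha> where "\<alpha> s = c0 * exp (\<nu> * (s - t))" for s
    define \<beta> where "\<beta> s = (1 - a) / a * c0 powr (- m) * exp (- (m * \<nu>) * (s - t))" for s
    have young: "x powr a * y powr (1 - a) / a \<le> \<alpha> s * x + \<beta> s * y" if "0 \<le> x" "0 \<le> y" for s x y
    proof -
      have "x powr a * y powr (1 - a) \<le> a * \<alpha> s * x + (1 - a) * \<alpha> s powr (- m) * y"
        using weighted_young[of a x y "\<alpha> s"] a that c0 by (simp add: \<alpha>_def m_def)
      also have "\<alpha> s powr (- m) = c0 powr (- m) * exp (- (m * \<nu>) * (s - t))"
        using c0 by (simp add: \<alpha>_def powr_mult) (simp add: powr_def)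
      finally have "x powr a * y powr (1 - a) / a \<le> (a * \<alpha> s * x + (1 - a) * (c0 powr (- m) * exp (- (m * \<nu>) * (s - t))) * y) / a"
        using a by (intro divide_right_mono) auto
      also have "\<dots> = \<alpha> s * x + \<beta> s * y" using a by (simp add: \<beta>_def add_divide_distrib)
      finally show ?thesis .
    qed
    have ab0: "0 \<le> \<alpha> s" "0 \<le> \<beta> s" for s using c0 a by (auto simp: \<alpha>_def \<beta>_def)
    have bound: "(\<integral>\<^sup>+\<omega>. ?g \<omega> * ennreal (EZ_driver a X W s \<omega>) \<partial>M)
        \<le> ennreal (c0 * exp (- \<nu> * t)) * (\<integral>\<^sup>+\<omega>. ?g \<omega> * ennreal (?Y s \<omega>) \<partial>M) + ennreal (\<beta> s) * w"
      if s: "t \<le> s" for s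
    proof -
      have s0: "0 \<le> s" using s t by simp
      note [measurable] = prog_meas_M[OF Xp s0] prog_meas_M[OF Wp s0]
      have "(\<integral>\<^sup>+\<omega>. ?g \<omega> * ennreal (EZ_driver a X W s \<omega>) \<partial>M)
          \<le> (\<integral>\<^sup>+\<omega>. ennreal (c0 * exp (- \<nu> * t)) * (?g \<omega> * ennreal (?Y s \<omega>)) + ennreal (\<beta> s) * (?g \<omega> * ennreal (W s \<omega>)) \<partial>M)"
      proof (rule nn_integral_mono)
        fix \<omega> assume w: "\<omega> \<in> space M"
        have "EZ_driver a X W s \<omega> \<le> \<alpha> s * X s \<omega> + \<beta> s * W s \<omega>"
          unfolding EZ_driver_def by (intro young X0 W0 s0 w)
        \<comment> \<open>The weight is exactly the one that turns \<open>X\<close> into a multiple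
          of \<open>?Y\<close>, whose tail bound is available.\<close>
        also have "\<alpha> s * X s \<omega> = c0 * exp (- \<nu> * t) * ?Y s \<omega>"
          by (simp add: \<alpha>_def algebra_simps flip: exp_add)
        finally have "ennreal (EZ_driver a X W s \<omega>) \<le> ennreal (c0 * exp (- \<nu> * t) * ?Y s \<omega> + \<beta> s * W s \<omega>)"
          by (rule ennreal_leI)
        also have "\<dots> = ennreal (c0 * exp (- \<nu> * t)) * ennreal (?Y s \<omega>) + ennreal (\<beta> s) * ennreal (W s \<omega>)"
          using c0 ab0[of s] X0[OF s0 w] W0[OF s0 w] by (simp add: ennreal_mult ennreal_plus)
        finally show "?g \<omega> * ennreal (EZ_driver a X W s \<omega>) \<le>
            ennreal (c0 * exp (- \<nu> * t)) * (?g \<omega> * ennreal (?Y s \<omega>)) + ennreal (\<beta> s) * (?g \<omega> * ennreal (W s \<omega>))"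
          by (auto simp: indicator_def)
      qed
      also have "\<dots> = ennreal (c0 * exp (- \<nu> * t)) * (\<integral>\<^sup>+\<omega>. ?g \<omega> * ennreal (?Y s \<omega>) \<partial>M)
          + ennreal (\<beta> s) * (\<integral>\<^sup>+\<omega>. ?g \<omega> * ennreal (W s \<omega>) \<partial>M)"
        by (simp add: nn_integral_add nn_integral_cmult)
      also have "\<dots> \<le> ennreal (c0 * exp (- \<nu> * t)) * (\<integral>\<^sup>+\<omega>. ?g \<omega> * ennreal (?Y s \<omega>) \<partial>M) + ennreal (\<beta> s) * w"
        unfolding w_def by (intro add_left_mono mult_left_mono potential_antimono[OF pot t s g]) auto
      finally show ?thesis .
    qed
    have "w = (\<integral>\<^sup>+\<omega>. ?g \<omega> * tail_integral (EZ_driver a X W) t \<omega> \<partial>M)"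
      unfolding w_def by (rule potentialD[OF pot t g])
    also have "\<dots> = (\<integral>\<^sup>+s\<in>{t..}. (\<integral>\<^sup>+\<omega>. ?g \<omega> * ennreal (EZ_driver a X W s \<omega>) \<partial>M) \<partial>lborel)"
      by (rule tail_integral_swap[OF Dp t gM])
    also have "\<dots> \<le> (\<integral>\<^sup>+s. ennreal (c0 * exp (- \<nu> * t)) * ((\<integral>\<^sup>+\<omega>. ?g \<omega> * ennreal (?Y (max 0 s) \<omega>) \<partial>M) * indicator {t..} s)
        + (ennreal (\<beta> s) * indicator {t..} s) * w \<partial>lborel)"
      by (rule nn_integral_mono) (use bound t in \<open>auto simp: indicator_def max_def\<close>)
    also have "\<dots> = ennreal (c0 * exp (- \<nu> * t)) * (\<integral>\<^sup>+s\<in>{t..}. (\<integral>\<^sup>+\<omega>. ?g \<omega> * ennreal (?Y (max 0 s) \<omega>) \<partial>M) \<partial>lborel)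
        + (\<integral>\<^sup>+s\<in>{t..}. ennreal (\<beta> s) \<partial>lborel) * w"
    proof -
      note [measurable] = prog_meas_joint[OF Xp]
      have [measurable]: "(\<lambda>s. \<integral>\<^sup>+\<omega>. ?g \<omega> * ennreal (?Y (max 0 s) \<omega>) \<partial>M) \<in> borel_measurable lborel"
        by measurable
      have [measurable]: "(\<lambda>s. ennreal (\<beta> s) * indicator {t..} s) \<in> borel_measurable lborel"
        unfolding \<beta>_def by measurable
      show ?thesis by (subst nn_integral_add) (auto simp: nn_integral_cmult nn_integral_multc)
    qed
    also have "(\<integral>\<^sup>+s\<in>{t..}. ennreal (\<beta> s) \<partial>lborel) = ennreal (1 / 2)"
      unfolding \<beta>_def using nn_integral_exp_decay[of "m * \<nu>" "(1 - a) / a * c0 powr (- m)" t] m \<nu> a c0 c0m by simp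
    also have "(\<integral>\<^sup>+s\<in>{t..}. (\<integral>\<^sup>+\<omega>. ?g \<omega> * ennreal (?Y (max 0 s) \<omega>) \<partial>M) \<partial>lborel)
        = (\<integral>\<^sup>+s\<in>{t..}. (\<integral>\<^sup>+\<omega>. ?g \<omega> * ennreal (?Y s \<omega>) \<partial>M) \<partial>lborel)"
      by (rule nn_integral_cong) (use t in \<open>auto simp: indicator_def max_def\<close>)
    also have "\<dots> = (\<integral>\<^sup>+\<omega>. ?g \<omega> * tail_integral ?Y t \<omega> \<partial>M)"
      by (rule tail_integral_swap[symmetric, OF Yp t gM])
    finally have le: "w \<le> ennreal (c0 * exp (- \<nu> * t)) * (\<integral>\<^sup>+\<omega>. ?g \<omega> * tail_integral ?Y t \<omega> \<partial>M) + ennreal (1 / 2) * w" .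
    obtain w' where w': "w = ennreal w'" "0 \<le> w'" using wf by (metis ennreal_cases infinity_ennreal_def less_irrefl)
    \<comment> \<open>Half of \<open>w\<close> moves to the left side; this is where its finiteness
      is used. An infinite right side is trivial.\<close>
    have half: "ennreal (1 / 2) * w \<le> ennreal (c0 * exp (- \<nu> * t)) * (\<integral>\<^sup>+\<omega>. ?g \<omega> * tail_integral ?Y t \<omega> \<partial>M)"
    proof -
      let ?R = "ennreal (c0 * exp (- \<nu> * t)) * (\<integral>\<^sup>+\<omega>. ?g \<omega> * tail_integral ?Y t \<omega> \<partial>M)"
      have w2: "ennreal (1 / 2) * w = ennreal (w' / 2)"
        unfolding w'(1) by (subst ennreal_mult'[symmetric]) auto
      show ?thesis
      proof (cases ?R)
        case (real r)
        then have "ennreal w' \<le> ennreal (r + w' / 2)"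
          using le w' unfolding w2 by (simp add: ennreal_plus)
        then have "w' \<le> r + w' / 2" by (subst (asm) ennreal_le_iff) (use real w' in auto)
        then have "w' / 2 \<le> r" by simp
        then show ?thesis unfolding w2 real(2) by (rule ennreal_leI)
      qed (simp add: top_unique)
    qed
    have two: "ennreal 2 * ennreal (1 / 2) = 1" by (subst ennreal_mult'[symmetric]) auto
    \<comment> \<open>The factor 2 undoes the halving, \<open>1 / k\<close> comes from the tail
      bound of \<open>?Y\<close>, and \<open>exp (- \<nu> * t)\<close> cancels the weight that
      \<open>?Y\<close> carries at time \<open>t\<close>.\<close>
    define d where "d = 2 * (c0 * exp (- \<nu> * t)) * (1 / k)"
    have d0: "0 \<le> d" using c0 k by (simp add: d_def)
    have "2 * (c0 * exp (- \<nu> * t)) = d * k" using k by (simp add: d_def)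
    then have dk: "ennreal 2 * ennreal (c0 * exp (- \<nu> * t)) = ennreal d * ennreal k"
      using c0 d0 k by (subst (1 2) ennreal_mult'[symmetric]) auto
    have "w = ennreal 2 * (ennreal (1 / 2) * w)" unfolding mult.assoc[symmetric] two by simp
    also have "\<dots> \<le> ennreal 2 * (ennreal (c0 * exp (- \<nu> * t)) * (\<integral>\<^sup>+\<omega>. ?g \<omega> * tail_integral ?Y t \<omega> \<partial>M))"
      by (intro mult_left_mono half) auto
    also have "\<dots> = ennreal d * (ennreal k * (\<integral>\<^sup>+\<omega>. ?g \<omega> * tail_integral ?Y t \<omega> \<partial>M))"
      unfolding mult.assoc[symmetric] dk ..
    also have "\<dots> \<le> ennreal d * (\<integral>\<^sup>+\<omega>. ?g \<omega> * ennreal (?Y t \<omega>) \<partial>M)"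
      by (intro mult_left_mono tail_boundsD[OF tb t g]) auto
    also have "\<dots> = (\<integral>\<^sup>+\<omega>. ?g \<omega> * (ennreal d * ennreal (?Y t \<omega>)) \<partial>M)"
      by (subst nn_integral_cmult[symmetric]) (auto simp: ac_simps)
    also have "\<dots> = (\<integral>\<^sup>+\<omega>. ?g \<omega> * ennreal (2 * c0 / k * X t \<omega>) \<partial>M)"
    proof (rule nn_integral_cong)
      fix \<omega> assume w: "\<omega> \<in> space M"
      have "d * ?Y t \<omega> = 2 * c0 / k * X t \<omega>"
        by (simp add: d_def exp_minus field_simps)
      then show "?g \<omega> * (ennreal d * ennreal (?Y t \<omega>)) = ?g \<omega> * ennreal (2 * c0 / k * X t \<omega>)"
        using d0 X0[OF t w] by (subst ennreal_mult[symmetric]) auto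
    qed
    finally show "(\<integral>\<^sup>+\<omega>. ?g \<omega> * ennreal (W t \<omega>) \<partial>M) \<le> (\<integral>\<^sup>+\<omega>. ?g \<omega> * ennreal (2 * c0 / k * X t \<omega>) \<partial>M)"
      by (simp add: w_def)
  qed
  have "\<forall>t\<ge>0. AE \<omega> in M. W t \<omega> \<le> 2 * c0 / k * X t \<omega>"
  proof (intro allI impI)
    fix t :: real assume t: "0 \<le> t"
    show "AE \<omega> in M. W t \<omega> \<le> 2 * c0 / k * X t \<omega>"
      by (rule AE_mp[OF main[OF t]], rule AE_I2, rule impI, subst (asm) ennreal_le_iff) (use X0[OF t] c0 k in auto)
  qed
  then show ?thesis using c0 k by (intro exI[of _ "2 * c0 / k"]) auto
qed

end

section \<open>Lower bound for positive solutions\<close>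

context filtered_space
begin

section \<open>Comparison of the mass of \<open>X\<close> at nearby times\<close>

lemma tail_integral_split:
  assumes "prog_meas F \<phi>" "0 \<le> s" "s \<le> r" "\<omega> \<in> space M"
  shows "tail_integral \<phi> s \<omega> = (\<integral>\<^sup>+u\<in>{s..r}. ennreal (\<phi> u \<omega>) \<partial>lborel) + tail_integral \<phi> r \<omega>"
proof -
  note [measurable] = prog_meas_joint[OF assms(1)] assms(4)
  have "(\<integral>\<^sup>+u. ennreal (\<phi> (max 0 u) \<omega>) * indicator {s..} u \<partial>lborel) =
     (\<integral>\<^sup>+u. ennreal (\<phi> (max 0 u) \<omega>) * indicator {s..r} u + ennreal (\<phi> (max 0 u) \<omega>) * indicator {r..} u \<partial>lborel)"
  proof (rule nn_integral_cong_AE)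
    have "AE u in lborel. u \<noteq> r" by (rule AE_lborel_singleton)
    then show "AE u in lborel. ennreal (\<phi> (max 0 u) \<omega>) * indicator {s..} u =
       ennreal (\<phi> (max 0 u) \<omega>) * indicator {s..r} u + ennreal (\<phi> (max 0 u) \<omega>) * indicator {r..} u"
      by eventually_elim (use assms(3) in \<open>auto simp: indicator_def\<close>)
  qed
  also have "\<dots> = (\<integral>\<^sup>+u. ennreal (\<phi> (max 0 u) \<omega>) * indicator {s..r} u \<partial>lborel) + (\<integral>\<^sup>+u. ennreal (\<phi> (max 0 u) \<omega>) * indicator {r..} u \<partial>lborel)"
    by (rule nn_integral_add) measurable
  also have "(\<integral>\<^sup>+u. ennreal (\<phi> (max 0 u) \<omega>) * indicator {s..} u \<partial>lborel) = tail_integral \<phi> s \<omega>"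
    unfolding tail_integral_def using assms by (intro nn_integral_cong) (auto simp: indicator_def max_def)
  also have "(\<integral>\<^sup>+u. ennreal (\<phi> (max 0 u) \<omega>) * indicator {r..} u \<partial>lborel) = tail_integral \<phi> r \<omega>"
    unfolding tail_integral_def using assms by (intro nn_integral_cong) (auto simp: indicator_def max_def)
  also have "(\<integral>\<^sup>+u. ennreal (\<phi> (max 0 u) \<omega>) * indicator {s..r} u \<partial>lborel) = (\<integral>\<^sup>+u\<in>{s..r}. ennreal (\<phi> u \<omega>) \<partial>lborel)"
    using assms by (intro nn_integral_cong) (auto simp: indicator_def max_def)
  finally show ?thesis .
qed

lemma segment_measurable:
  assumes "prog_meas F \<phi>" "0 \<le> s"
  shows "(\<lambda>\<omega>. \<integral>\<^sup>+u\<in>{s..r}. ennreal (\<phi> u \<omega>) \<partial>lborel) \<in> borel_measurable M"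
proof -
  note [measurable] = prog_meas_joint[OF assms(1)]
  have "(\<lambda>\<omega>. \<integral>\<^sup>+u. ennreal (\<phi> (max 0 u) \<omega>) * indicator {s..r} u \<partial>lborel) \<in> borel_measurable M"
    by measurable
  moreover have "(\<integral>\<^sup>+u. ennreal (\<phi> (max 0 u) \<omega>) * indicator {s..r} u \<partial>lborel) = (\<integral>\<^sup>+u\<in>{s..r}. ennreal (\<phi> u \<omega>) \<partial>lborel)" for \<omega>
    using assms(2) by (intro nn_integral_cong) (auto simp: indicator_def)
  ultimately show ?thesis by (metis (no_types, lifting) ext)
qed

text \<open>After conditioning, \<open>X\<close> is comparable to its tail, and the tail decreases
  in time. The chain yields \<open>K / k\<close>; the constant is doubled so that both directions of
  time share it.\<close>

lemma tail_bounds_forward: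
  assumes tb: "tail_bounds k K X" and k: "0 < k" "k \<le> K"
    and sr: "0 \<le> s" "s \<le> r" and g: "g \<in> borel_measurable (F s)"
  shows "(\<integral>\<^sup>+\<omega>. g \<omega> * ennreal (X r \<omega>) \<partial>M) \<le> ennreal (2 * K / k) * (\<integral>\<^sup>+\<omega>. g \<omega> * ennreal (X s \<omega>) \<partial>M)"
proof -
  have g': "g \<in> borel_measurable (F r)" using g sr by (rule measurable_F_mono)
  have "(\<integral>\<^sup>+\<omega>. g \<omega> * ennreal (X r \<omega>) \<partial>M) \<le> ennreal K * (\<integral>\<^sup>+\<omega>. g \<omega> * tail_integral X r \<omega> \<partial>M)"
    using tail_boundsD(2)[OF tb _ g'] sr by simp
  also have "\<dots> \<le> ennreal K * (\<integral>\<^sup>+\<omega>. g \<omega> * tail_integral X s \<omega> \<partial>M)"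
    by (intro mult_left_mono nn_integral_mono tail_integral_antimono sr) auto
  also have "\<dots> = ennreal (K / k) * (ennreal k * (\<integral>\<^sup>+\<omega>. g \<omega> * tail_integral X s \<omega> \<partial>M))"
    using k by (simp flip: mult.assoc ennreal_mult')
  also have "\<dots> \<le> ennreal (2 * K / k) * (\<integral>\<^sup>+\<omega>. g \<omega> * ennreal (X s \<omega>) \<partial>M)"
    using k by (intro mult_mono tail_boundsD(1)[OF tb sr(1) g] ennreal_leI divide_right_mono) auto
  finally show ?thesis .
qed

text \<open>On a time interval of length \<open>1 / (2 K)\<close> the tail of \<open>X\<close> loses at most half of its conditional mass.\<close>

lemma tail_bounds_backward:
  assumes tb: "tail_bounds k K X" and Xp: "prog_meas F X" and k: "0 < k" "k \<le> K"
    and sr: "0 \<le> s" "s \<le> r" "r \<le> s + 1 / (2 * K)" and g: "g \<in> borel_measurable (F s)"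
    and fin: "(\<integral>\<^sup>+\<omega>. g \<omega> * ennreal (X s \<omega>) \<partial>M) < \<infinity>"
  shows "(\<integral>\<^sup>+\<omega>. g \<omega> * ennreal (X s \<omega>) \<partial>M) \<le> ennreal (2 * K / k) * (\<integral>\<^sup>+\<omega>. g \<omega> * ennreal (X r \<omega>) \<partial>M)"
proof -
  have gM [measurable]: "g \<in> borel_measurable M" by (rule measurable_F_M[OF g sr(1)])
  have g': "g \<in> borel_measurable (F u)" if "s \<le> u" for u using measurable_F_mono[OF g sr(1) that] .
  define j where "j u = (\<integral>\<^sup>+\<omega>. g \<omega> * tail_integral X u \<omega> \<partial>M)" for u
  have j_anti: "j v \<le> j u" if "u \<le> v" for u v
    unfolding j_def by (intro nn_integral_mono mult_left_mono tail_integral_antimono that) auto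
  have "ennreal k * j s < \<infinity>"
    using tail_boundsD(1)[OF tb sr(1) g] fin unfolding j_def by (rule le_less_trans)
  then have js: "j s < \<infinity>" using k by (auto simp: ennreal_mult_less_top)
  have "j s = (\<integral>\<^sup>+\<omega>. g \<omega> * (\<integral>\<^sup>+u\<in>{s..r}. ennreal (X u \<omega>) \<partial>lborel) + g \<omega> * tail_integral X r \<omega> \<partial>M)"
    unfolding j_def by (intro nn_integral_cong) (simp add: tail_integral_split[OF Xp sr(1,2)] distrib_left)
  also have "\<dots> = (\<integral>\<^sup>+\<omega>. g \<omega> * (\<integral>\<^sup>+u\<in>{s..r}. ennreal (X u \<omega>) \<partial>lborel) \<partial>M) + j r"
    unfolding j_def using segment_measurable[OF Xp sr(1)] tail_integral_measurable[OF Xp, of r] sr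
    by (intro nn_integral_add) auto
  also have "(\<integral>\<^sup>+\<omega>. g \<omega> * (\<integral>\<^sup>+u\<in>{s..r}. ennreal (X u \<omega>) \<partial>lborel) \<partial>M) = (\<integral>\<^sup>+u\<in>{s..r}. (\<integral>\<^sup>+\<omega>. g \<omega> * ennreal (X u \<omega>) \<partial>M) \<partial>lborel)"
    using sr by (intro nn_integral_swap[OF Xp]) auto
  also have "\<dots> \<le> (\<integral>\<^sup>+u. (ennreal K * j s) * indicator {s..r} u \<partial>lborel)"
  proof (rule nn_integral_mono)
    fix u
    have "(\<integral>\<^sup>+\<omega>. g \<omega> * ennreal (X u \<omega>) \<partial>M) \<le> ennreal K * j s" if u: "s \<le> u"
    proof -
      have "(\<integral>\<^sup>+\<omega>. g \<omega> * ennreal (X u \<omega>) \<partial>M) \<le> ennreal K * j u"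
        unfolding j_def using tail_boundsD(2)[OF tb _ g'[OF u]] sr u by simp
      also have "\<dots> \<le> ennreal K * j s" by (intro mult_left_mono j_anti u) auto
      finally show ?thesis .
    qed
    then show "(\<integral>\<^sup>+\<omega>. g \<omega> * ennreal (X u \<omega>) \<partial>M) * indicator {s..r} u \<le> (ennreal K * j s) * indicator {s..r} u"
      by (auto simp: indicator_def)
  qed
  also have "\<dots> = ennreal K * j s * ennreal (r - s)"
    using sr by (simp add: nn_integral_cmult_indicator)
  \<comment> \<open>The step length \<open>1 / (2 * K)\<close> is chosen for this: at a rate of at
    most \<open>K * j s\<close> the segment collects no more than half of
    \<open>j s\<close>.\<close>
  also have "\<dots> \<le> ennreal (1 / 2) * j s"
  proof -
    have "K * (r - s) \<le> K * (1 / (2 * K))" using sr k by (intro mult_left_mono) auto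
    also have "\<dots> = 1 / 2" using k by simp
    finally have "ennreal (K * (r - s)) * j s \<le> ennreal (1 / 2) * j s" by (intro mult_right_mono ennreal_leI) auto
    then show ?thesis using k sr by (simp add: ennreal_mult ac_simps)
  qed
  finally have le: "j s \<le> ennreal (1 / 2) * j s + j r" by (simp add: add_right_mono)
  obtain x where x: "j s = ennreal x" "0 \<le> x" using js by (metis ennreal_cases infinity_ennreal_def less_irrefl)
  have "j r < \<infinity>" using j_anti[OF sr(2)] js by (simp add: le_less_trans)
  then obtain y where y: "j r = ennreal y" "0 \<le> y" by (metis ennreal_cases infinity_ennreal_def less_irrefl)
  have "ennreal (1 / 2) * j s + j r = ennreal (1 / 2 * x + y)"
    unfolding x(1) y(1) using x y by (subst ennreal_mult[symmetric], simp, simp, subst ennreal_plus) auto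
  with le x have "ennreal x \<le> ennreal (1 / 2 * x + y)" by simp
  then have "x \<le> 1 / 2 * x + y" by (subst (asm) ennreal_le_iff) (use x y in auto)
  then have "ennreal x \<le> ennreal (2 * y)" by (intro ennreal_leI) simp
  then have j2: "j s \<le> ennreal 2 * j r" using x y by (simp add: ennreal_mult)
  have "(\<integral>\<^sup>+\<omega>. g \<omega> * ennreal (X s \<omega>) \<partial>M) \<le> ennreal K * j s"
    unfolding j_def by (rule tail_boundsD(2)[OF tb sr(1) g])
  also have "\<dots> \<le> ennreal K * (ennreal 2 * j r)" by (intro mult_left_mono j2) auto
  also have "\<dots> = ennreal (2 * K / k) * (ennreal k * j r)"
  proof -
    have "ennreal K * ennreal 2 = ennreal (2 * K / k) * ennreal k"
      using k by (subst (1 2) ennreal_mult'[symmetric]) (auto simp: mult.commute)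
    then show ?thesis by (simp only: mult.assoc[symmetric])
  qed
  also have "\<dots> \<le> ennreal (2 * K / k) * (\<integral>\<^sup>+\<omega>. g \<omega> * ennreal (X r \<omega>) \<partial>M)"
    unfolding j_def using tail_boundsD(1)[OF tb _ g'[OF sr(2)]] sr by (intro mult_left_mono) auto
  finally show ?thesis .
qed

end

context filtered_space
begin

text \<open>The lower limit of integration is itself a variable, so the indicator of the interval is
  written as a condition measurable in both times together.\<close>

lemma segment_joint_measurable:
  fixes \<phi> :: "real \<Rightarrow> 'a \<Rightarrow> real"
  assumes [measurable]: "(\<lambda>(u, \<omega>). \<phi> u \<omega>) \<in> borel_measurable (borel \<Otimes>\<^sub>M M)"
  shows "(\<lambda>(s, \<omega>). \<integral>\<^sup>+u\<in>{s..r}. ennreal (\<phi> u \<omega>) \<partial>lborel) \<in> borel_measurable (borel \<Otimes>\<^sub>M M)"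
proof -
  have "(\<lambda>p. \<integral>\<^sup>+u. (if fst p \<le> u \<and> u \<le> r then ennreal (\<phi> u (snd p)) else 0) \<partial>lborel) \<in> borel_measurable (borel \<Otimes>\<^sub>M M)"
    by measurable
  moreover have "(\<integral>\<^sup>+u. (if s \<le> u \<and> u \<le> r then ennreal (\<phi> u \<omega>) else 0) \<partial>lborel) = (\<integral>\<^sup>+u\<in>{s..r}. ennreal (\<phi> u \<omega>) \<partial>lborel)" for s \<omega>
    by (intro nn_integral_cong) (auto simp: indicator_def)
  ultimately show ?thesis by (simp add: split_beta)
qed

text \<open>A substitute for Ito's formula applied to \<open>r\<^sup>a\<close>, \<open>r = W / X\<close>, under the measure with density \<open>X T\<close>, where \<open>T = t + \<delta>\<close>.
  The pathwise variable \<open>\<Psi> s = r T + \<integral> \<psi> over {s..T}\<close> with \<open>\<psi> = r powr (1 - a) / a\<close> has conditional mean comparable to \<open>r s\<close>.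
  By convexity of \<open>x powr (a - 1)\<close>, the mean of \<open>\<psi> s * \<Psi> s powr (a - 1)\<close> is bounded below by that of
  \<open>\<psi> s * r s powr (a - 1) = 1 / a\<close>, while its time integral is at most \<open>\<Psi> t powr a / a\<close>, whose mean is, by concavity,
  of the order of \<open>r t powr a\<close>. Conditional Jensen is replaced by tangent lines at \<open>l * r s\<close> and \<open>r t\<close>;
  the choice \<open>l = \<kappa>\<^sup>2\<close> absorbs the constants lost in the change of measure.\<close>

lemma potential_lower_bound:
  assumes a: "0 < a" "a < 1" and Xp: "prog_meas F X" and Xpos: "\<And>t \<omega>. 0 \<le> t \<Longrightarrow> \<omega> \<in> space M \<Longrightarrow> 0 < X t \<omega>"
    and Wp: "prog_meas F W" and Wpos: "\<And>t \<omega>. 0 \<le> t \<Longrightarrow> \<omega> \<in> space M \<Longrightarrow> 0 < W t \<omega>"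
    and tb: "tail_bounds k K X" and k: "0 < k" "k \<le> K" and Xint: "integrable_proc X"
    and pot: "potential (EZ_driver a X W) W" and int: "integrable_proc (EZ_driver a X W)"
  shows "\<exists>c>0. \<forall>t\<ge>0. AE \<omega> in M. c * X t \<omega> \<le> W t \<omega>"
proof -
  define \<kappa> where "\<kappa> = 2 * K / k"
  have \<kappa>: "0 < \<kappa>" using k by (simp add: \<kappa>_def)
  have \<kappa>1: "1 \<le> \<kappa>" using k by (simp add: \<kappa>_def)
  define \<delta> where "\<delta> = 1 / (2 * K)"
  have \<delta>: "0 < \<delta>" using k by (simp add: \<delta>_def)
  define l where "l = \<kappa> ^ 2"
  have l: "0 < l" using \<kappa> by (simp add: l_def)
  \<comment> \<open>The value of \<open>d2 / \<kappa> - d1 * \<kappa>\<close> further down: for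
    \<open>l = \<kappa> ^ 2\<close> the two terms are \<open>2 - a\<close> and \<open>1 - a\<close>
    times \<open>l powr (a - 1) / (a * \<kappa>)\<close>.\<close>
  define c1 where "c1 = l powr (a - 1) / (a * \<kappa>)"
  have c1: "0 < c1" using l a \<kappa> by (simp add: c1_def)
  \<comment> \<open>Here \<open>\<delta>\<close> is the length of the time interval,
    \<open>c1 / \<kappa>\<close> the lower bound per unit of time, and \<open>a / \<kappa>\<close>
    inverts the factor of the upper bound.\<close>
  define c2 where "c2 = \<delta> * c1 * a / \<kappa>\<^sup>2"
  have c2: "0 < c2" using \<delta> c1 a \<kappa> by (simp add: c2_def)
  \<comment> \<open>Evaluated at \<open>max 0 s\<close>, so that it is jointly measurable on the
    whole line.\<close>
  define rat where "rat s \<omega> = W (max 0 s) \<omega> / X (max 0 s) \<omega>" for s \<omega>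
  define \<psi> where "\<psi> s \<omega> = rat s \<omega> powr (1 - a) / a" for s \<omega>
  have rat: "rat s \<omega> = W s \<omega> / X s \<omega>" "0 < rat s \<omega>" if "0 \<le> s" "\<omega> \<in> space M" for s \<omega>
    using that Xpos[OF that] Wpos[OF that] by (auto simp: rat_def max_def)
  have \<psi>0: "0 \<le> \<psi> s \<omega>" for s \<omega> using a by (simp add: \<psi>_def)
  \<comment> \<open>Homogeneity of degree one in the pair of \<open>X\<close> and \<open>W\<close>
    leaves a function of the ratio times \<open>X\<close>.\<close>
  have drv: "EZ_driver a X W s \<omega> = \<psi> s \<omega> * X s \<omega>" if "0 \<le> s" "\<omega> \<in> space M" for s \<omega>
  proof -
    have "X s \<omega> powr a = X s \<omega> * X s \<omega> powr (a - 1)" using powr_mult_base[of "X s \<omega>" "a - 1"] Xpos[OF that] by simp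
    moreover have "X s \<omega> powr (a - 1) = inverse (X s \<omega> powr (1 - a))" by (simp flip: powr_minus)
    ultimately show ?thesis using that Xpos[OF that] Wpos[OF that]
      by (simp add: EZ_driver_def \<psi>_def rat powr_divide) (simp add: divide_inverse)
  qed
  have Dp: "prog_meas F (EZ_driver a X W)" by (rule prog_meas_EZ_driver[OF Xp Wp])
  have ratp: "prog_meas F rat"
  proof -
    have "prog_meas F (\<lambda>t \<omega>. (\<lambda>w x. w / x) (W t \<omega>) (X t \<omega>))"
      by (rule prog_meas_compose2[OF Wp Xp]) measurable
    then show ?thesis by (simp add: prog_meas_iff rat_def)
  qed
  have \<psi>p: "prog_meas F \<psi>"
  proof -
    have "prog_meas F (\<lambda>t \<omega>. (\<lambda>w x. w powr (1 - a) / a) (rat t \<omega>) (X t \<omega>))"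
      by (rule prog_meas_compose2[OF ratp Xp]) measurable
    then show ?thesis by (simp add: \<psi>_def[abs_def])
  qed
  have ratj [measurable]: "(\<lambda>(s, \<omega>). rat s \<omega>) \<in> borel_measurable (borel \<Otimes>\<^sub>M M)"
    using prog_meas_joint[OF ratp] by (simp add: rat_def)
  have \<psi>j [measurable]: "(\<lambda>(s, \<omega>). \<psi> s \<omega>) \<in> borel_measurable (borel \<Otimes>\<^sub>M M)"
    using prog_meas_joint[OF \<psi>p] by (simp add: \<psi>_def rat_def)
  have Xfin: "(\<integral>\<^sup>+\<omega>. ennreal (X s \<omega>) \<partial>M) < \<infinity>" if "0 \<le> s" for s
  proof -
    have "(\<integral>\<^sup>+\<omega>. ennreal (X s \<omega>) \<partial>M) \<le> ennreal K * (\<integral>\<^sup>+\<omega>. tail_integral X s \<omega> \<partial>M)"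
      using tail_boundsD(2)[OF tb that, of "\<lambda>_. 1"] by simp
    also have "\<dots> \<le> ennreal K * (\<integral>\<^sup>+\<omega>. tail_integral X 0 \<omega> \<partial>M)"
      by (intro mult_left_mono nn_integral_mono tail_integral_antimono that) auto
    also have "\<dots> < \<infinity>" using Xint by (simp add: integrable_proc_def ennreal_mult_less_top)
    finally show ?thesis .
  qed
  have fwd: "(\<integral>\<^sup>+\<omega>. g \<omega> * ennreal (X r \<omega>) \<partial>M) \<le> ennreal \<kappa> * (\<integral>\<^sup>+\<omega>. g \<omega> * ennreal (X s \<omega>) \<partial>M)"
    if "0 \<le> s" "s \<le> r" "g \<in> borel_measurable (F s)" for g s r
    unfolding \<kappa>_def by (rule tail_bounds_forward[OF tb k that])
  \<comment> \<open>Restricted to indicators: the backward estimate absorbs a term on the left, so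
    the tested mass has to be finite.\<close>
  have bwd: "(\<integral>\<^sup>+\<omega>. indicator A \<omega> * ennreal (X s \<omega>) \<partial>M) \<le> ennreal \<kappa> * (\<integral>\<^sup>+\<omega>. indicator A \<omega> * ennreal (X r \<omega>) \<partial>M)"
    if "0 \<le> s" "s \<le> r" "r \<le> s + \<delta>" "A \<in> sets (F s)" for A s r
  proof -
    have "(\<integral>\<^sup>+\<omega>. indicator A \<omega> * ennreal (X s \<omega>) \<partial>M) \<le> (\<integral>\<^sup>+\<omega>. ennreal (X s \<omega>) \<partial>M)"
      by (intro nn_integral_mono) (auto simp: indicator_def)
    also have "\<dots> < \<infinity>" by (rule Xfin[OF that(1)])
    finally show ?thesis
      unfolding \<kappa>_def using that by (intro tail_bounds_backward[OF tb Xp k]) (auto simp: \<delta>_def)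
  qed
  have main: "AE \<omega> in M. ennreal (c2 * X t \<omega>) \<le> ennreal (rat t \<omega> powr a * X t \<omega>)" if t: "0 \<le> t" for t
  proof (rule AE_le_of_nn_integral_le[OF subalgebra_F[OF t]])
    note [measurable] = prog_meas_adapted[OF Xp t] prog_meas_adapted[OF ratp t]
    show "(\<lambda>\<omega>. ennreal (c2 * X t \<omega>)) \<in> borel_measurable (F t)"
      "(\<lambda>\<omega>. ennreal (rat t \<omega> powr a * X t \<omega>)) \<in> borel_measurable (F t)" by measurable
    have "(\<integral>\<^sup>+\<omega>. ennreal (c2 * X t \<omega>) \<partial>M) = ennreal c2 * (\<integral>\<^sup>+\<omega>. ennreal (X t \<omega>) \<partial>M)"
      using prog_meas_M[OF Xp t] c2 by (simp add: ennreal_mult' nn_integral_cmult)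
    then show "(\<integral>\<^sup>+\<omega>. ennreal (c2 * X t \<omega>) \<partial>M) < \<infinity>" using Xfin[OF t] by (simp add: ennreal_mult_less_top)
  next
    fix A assume A: "A \<in> sets (F t)"
    define T where "T = t + \<delta>"
    have T0: "0 \<le> T" "t < T" using t \<delta> by (auto simp: T_def)
    have AM [measurable]: "A \<in> sets M" using A subalgebra_F[OF t] by (auto simp: subalgebra_def)
    note Xm = prog_meas_M[OF Xp] and Wm = prog_meas_M[OF Wp] and ratm = prog_meas_M[OF ratp] and \<psi>m = prog_meas_M[OF \<psi>p]
    note [measurable] = Xm[OF t] Xm[OF T0(1)] Wm[OF t] Wm[OF T0(1)] ratm[OF t] ratm[OF T0(1)]
    define L where "L s \<omega> = (\<integral>\<^sup>+u\<in>{s..T}. ennreal (\<psi> u \<omega>) \<partial>lborel)" for s \<omega>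
    have Lj [measurable]: "(\<lambda>(s, \<omega>). L s \<omega>) \<in> borel_measurable (borel \<Otimes>\<^sub>M M)"
      unfolding L_def by (rule segment_joint_measurable[OF \<psi>j])
    have [measurable]: "L s \<in> borel_measurable M" for s using Lj by measurable
    define \<Psi> where "\<Psi> s \<omega> = rat T \<omega> + enn2real (L s \<omega>)" for s \<omega>
    have \<Psi>j [measurable]: "(\<lambda>(s, \<omega>). \<Psi> s \<omega>) \<in> borel_measurable (borel \<Otimes>\<^sub>M M)"
      unfolding \<Psi>_def by measurable
    have [measurable]: "\<Psi> s \<in> borel_measurable M" for s using \<Psi>j by measurable
    have \<Psi>pos: "0 < \<Psi> s \<omega>" if "\<omega> \<in> space M" for s \<omega>
      using rat(2)[OF T0(1) that] by (simp add: \<Psi>_def add_pos_nonneg)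
    \<comment> \<open>As \<open>\<psi> u\<close> is known at time \<open>u\<close>, the forward
      bound replaces \<open>\<psi> u * X T\<close> by \<open>\<psi> u * X u\<close>, which is the
      driver. The terminal term \<open>X T * rat T\<close> is \<open>W T\<close>, so both parts add
      up to the tail of the driver from \<open>s\<close>, which tests like
      \<open>W s\<close>.\<close>
    have weighted0: "(\<integral>\<^sup>+\<omega>. g \<omega> * (ennreal (X T \<omega>) * (L s \<omega> + ennreal (rat T \<omega>))) \<partial>M) \<le> ennreal \<kappa> * (\<integral>\<^sup>+\<omega>. g \<omega> * ennreal (W s \<omega>) \<partial>M)"
      if s: "t \<le> s" "s \<le> T" and g: "g \<in> borel_measurable (F s)" for s g
    proof -
      have s0: "0 \<le> s" using s t by simp
      have gM [measurable]: "g \<in> borel_measurable M" by (rule measurable_F_M[OF g s0])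
      have g': "g \<in> borel_measurable (F u)" if "s \<le> u" for u using measurable_F_mono[OF g s0 that] .
      note tailm = tail_integral_measurable[OF Dp T0(1)] and segm = segment_measurable[OF Dp s0, of T]
      have 1: "(\<integral>\<^sup>+\<omega>. (g \<omega> * ennreal (X T \<omega>)) * L s \<omega> \<partial>M) \<le> ennreal \<kappa> * (\<integral>\<^sup>+\<omega>. g \<omega> * (\<integral>\<^sup>+u\<in>{s..T}. ennreal (EZ_driver a X W u \<omega>) \<partial>lborel) \<partial>M)"
      proof -
        have "(\<integral>\<^sup>+\<omega>. (g \<omega> * ennreal (X T \<omega>)) * L s \<omega> \<partial>M) = (\<integral>\<^sup>+u\<in>{s..T}. (\<integral>\<^sup>+\<omega>. (g \<omega> * ennreal (X T \<omega>)) * ennreal (\<psi> u \<omega>) \<partial>M) \<partial>lborel)"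
          unfolding L_def using s0 by (intro nn_integral_swap[OF \<psi>p]) auto
        also have "\<dots> \<le> (\<integral>\<^sup>+u\<in>{s..T}. (\<integral>\<^sup>+\<omega>. (ennreal \<kappa> * g \<omega>) * ennreal (EZ_driver a X W u \<omega>) \<partial>M) \<partial>lborel)"
        proof (rule nn_integral_mono)
          fix u
          have "(\<integral>\<^sup>+\<omega>. (g \<omega> * ennreal (X T \<omega>)) * ennreal (\<psi> u \<omega>) \<partial>M) \<le> (\<integral>\<^sup>+\<omega>. (ennreal \<kappa> * g \<omega>) * ennreal (EZ_driver a X W u \<omega>) \<partial>M)"
            if u: "s \<le> u" "u \<le> T"
          proof -
            have u0: "0 \<le> u" using s0 u by simp
            note [measurable] = g'[OF u(1)] prog_meas_adapted[OF \<psi>p u0] 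
            note mm [measurable] = \<psi>m[OF u0] Xm[OF u0]
            have "(\<integral>\<^sup>+\<omega>. (g \<omega> * ennreal (X T \<omega>)) * ennreal (\<psi> u \<omega>) \<partial>M) = (\<integral>\<^sup>+\<omega>. (g \<omega> * ennreal (\<psi> u \<omega>)) * ennreal (X T \<omega>) \<partial>M)"
              by (intro nn_integral_cong) (simp add: ac_simps)
            also have "\<dots> \<le> ennreal \<kappa> * (\<integral>\<^sup>+\<omega>. (g \<omega> * ennreal (\<psi> u \<omega>)) * ennreal (X u \<omega>) \<partial>M)"
              by (rule fwd[OF u0 u(2)]) measurable
            also have "\<dots> = (\<integral>\<^sup>+\<omega>. ennreal \<kappa> * ((g \<omega> * ennreal (\<psi> u \<omega>)) * ennreal (X u \<omega>)) \<partial>M)"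
              using gM mm by (intro nn_integral_cmult[symmetric]) measurable
            also have "\<dots> = (\<integral>\<^sup>+\<omega>. (ennreal \<kappa> * g \<omega>) * ennreal (EZ_driver a X W u \<omega>) \<partial>M)"
              by (intro nn_integral_cong) (simp add: drv[OF u0] ennreal_mult' \<psi>0 mult.assoc)
            finally show ?thesis .
          qed
          then show "(\<integral>\<^sup>+\<omega>. (g \<omega> * ennreal (X T \<omega>)) * ennreal (\<psi> u \<omega>) \<partial>M) * indicator {s..T} u
            \<le> (\<integral>\<^sup>+\<omega>. (ennreal \<kappa> * g \<omega>) * ennreal (EZ_driver a X W u \<omega>) \<partial>M) * indicator {s..T} u"
            by (auto simp: indicator_def)
        qed
        also have "\<dots> = (\<integral>\<^sup>+\<omega>. (ennreal \<kappa> * g \<omega>) * (\<integral>\<^sup>+u\<in>{s..T}. ennreal (EZ_driver a X W u \<omega>) \<partial>lborel) \<partial>M)"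
          using s0 by (intro nn_integral_swap[OF Dp, symmetric]) auto
        also have "\<dots> = ennreal \<kappa> * (\<integral>\<^sup>+\<omega>. g \<omega> * (\<integral>\<^sup>+u\<in>{s..T}. ennreal (EZ_driver a X W u \<omega>) \<partial>lborel) \<partial>M)"
          using segm by (simp add: mult.assoc nn_integral_cmult)
        finally show ?thesis .
      qed
      have 2: "(\<integral>\<^sup>+\<omega>. (g \<omega> * ennreal (X T \<omega>)) * ennreal (rat T \<omega>) \<partial>M) \<le> ennreal \<kappa> * (\<integral>\<^sup>+\<omega>. g \<omega> * ennreal (W T \<omega>) \<partial>M)"
      proof -
        have "(\<integral>\<^sup>+\<omega>. (g \<omega> * ennreal (X T \<omega>)) * ennreal (rat T \<omega>) \<partial>M) = ennreal 1 * (\<integral>\<^sup>+\<omega>. g \<omega> * ennreal (W T \<omega>) \<partial>M)"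
        proof -
          have "ennreal (X T \<omega>) * ennreal (rat T \<omega>) = ennreal (W T \<omega>)" if "\<omega> \<in> space M" for \<omega>
            using rat[OF T0(1) that] Xpos[OF T0(1) that] by (subst ennreal_mult[symmetric]) auto
          then show ?thesis by (simp add: mult.assoc cong: nn_integral_cong)
        qed
        also have "\<dots> \<le> ennreal \<kappa> * (\<integral>\<^sup>+\<omega>. g \<omega> * ennreal (W T \<omega>) \<partial>M)"
          using \<kappa>1 by (intro mult_right_mono ennreal_leI) auto
        finally show ?thesis .
      qed
      have "(\<integral>\<^sup>+\<omega>. g \<omega> * (ennreal (X T \<omega>) * (L s \<omega> + ennreal (rat T \<omega>))) \<partial>M)
          = (\<integral>\<^sup>+\<omega>. (g \<omega> * ennreal (X T \<omega>)) * L s \<omega> + (g \<omega> * ennreal (X T \<omega>)) * ennreal (rat T \<omega>) \<partial>M)"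
        by (intro nn_integral_cong) (simp add: distrib_left mult.assoc)
      also have "\<dots> = (\<integral>\<^sup>+\<omega>. (g \<omega> * ennreal (X T \<omega>)) * L s \<omega> \<partial>M) + (\<integral>\<^sup>+\<omega>. (g \<omega> * ennreal (X T \<omega>)) * ennreal (rat T \<omega>) \<partial>M)"
        by (rule nn_integral_add) measurable
      also have "\<dots> \<le> ennreal \<kappa> * (\<integral>\<^sup>+\<omega>. g \<omega> * (\<integral>\<^sup>+u\<in>{s..T}. ennreal (EZ_driver a X W u \<omega>) \<partial>lborel) \<partial>M) + ennreal \<kappa> * (\<integral>\<^sup>+\<omega>. g \<omega> * ennreal (W T \<omega>) \<partial>M)"
        by (rule add_mono[OF 1 2])
      also have "\<dots> = ennreal \<kappa> * ((\<integral>\<^sup>+\<omega>. g \<omega> * (\<integral>\<^sup>+u\<in>{s..T}. ennreal (EZ_driver a X W u \<omega>) \<partial>lborel) \<partial>M) + (\<integral>\<^sup>+\<omega>. g \<omega> * tail_integral (EZ_driver a X W) T \<omega> \<partial>M))"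
        using potentialD[OF pot T0(1) g'[OF s(2)]] by (simp add: distrib_left)
      also have "(\<integral>\<^sup>+\<omega>. g \<omega> * (\<integral>\<^sup>+u\<in>{s..T}. ennreal (EZ_driver a X W u \<omega>) \<partial>lborel) \<partial>M) + (\<integral>\<^sup>+\<omega>. g \<omega> * tail_integral (EZ_driver a X W) T \<omega> \<partial>M)
          = (\<integral>\<^sup>+\<omega>. g \<omega> * (\<integral>\<^sup>+u\<in>{s..T}. ennreal (EZ_driver a X W u \<omega>) \<partial>lborel) + g \<omega> * tail_integral (EZ_driver a X W) T \<omega> \<partial>M)"
        using segm tailm by (intro nn_integral_add[symmetric]) auto
      also have "\<dots> = (\<integral>\<^sup>+\<omega>. g \<omega> * tail_integral (EZ_driver a X W) s \<omega> \<partial>M)"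
        using tail_integral_split[OF Dp s0 s(2)] by (intro nn_integral_cong) (simp add: distrib_left)
      also have "\<dots> = (\<integral>\<^sup>+\<omega>. g \<omega> * ennreal (W s \<omega>) \<partial>M)"
        by (rule potentialD[OF pot s0 g, symmetric])
      finally show ?thesis .
    qed
    \<comment> \<open>A finite weighted mean and \<open>X T > 0\<close> force the pathwise integral
      to be finite, so \<open>enn2real\<close> in \<open>\<Psi>\<close> loses nothing.\<close>
    have L_fin: "AE \<omega> in M. L t \<omega> < \<infinity>"
    proof -
      have "(\<integral>\<^sup>+\<omega>. ennreal (X T \<omega>) * (L t \<omega> + ennreal (rat T \<omega>)) \<partial>M) \<le> ennreal \<kappa> * (\<integral>\<^sup>+\<omega>. ennreal (W t \<omega>) \<partial>M)"
        using weighted0[of t "\<lambda>_. 1"] T0 by simp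
      also have "\<dots> < \<infinity>" using potential_finite[OF pot int t] by (simp add: ennreal_mult_less_top)
      finally have "AE \<omega> in M. ennreal (X T \<omega>) * (L t \<omega> + ennreal (rat T \<omega>)) \<noteq> \<infinity>"
        by (intro nn_integral_PInf_AE) auto
      then show ?thesis
        by (rule AE_mp) (use Xpos[OF T0(1)] in \<open>force intro!: AE_I2 simp: ennreal_mult_eq_top_iff less_top\<close>)
    qed
    \<comment> \<open>The integral from \<open>t\<close> dominates those from later
      \<open>s\<close>, so one null set serves all \<open>s\<close>.\<close>
    have \<Psi>_eq: "AE \<omega> in M. \<forall>s\<ge>t. ennreal (\<Psi> s \<omega>) = L s \<omega> + ennreal (rat T \<omega>)"
      using L_fin AE_space
    proof eventually_elim
      case (elim \<omega>)
      show ?case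
      proof (intro allI impI)
        fix s assume "t \<le> s"
        then have "L s \<omega> \<le> L t \<omega>" unfolding L_def by (intro nn_integral_mono) (auto simp: indicator_def)
        then have "L s \<omega> < \<infinity>" using elim by (simp add: le_less_trans)
        then show "ennreal (\<Psi> s \<omega>) = L s \<omega> + ennreal (rat T \<omega>)"
          unfolding \<Psi>_def using rat(2)[OF T0(1) elim(2)] by (simp add: ennreal_plus add.commute less_top)
      qed
    qed
    have weighted: "(\<integral>\<^sup>+\<omega>. g \<omega> * (ennreal (X T \<omega>) * ennreal (\<Psi> s \<omega>)) \<partial>M) \<le> ennreal \<kappa> * (\<integral>\<^sup>+\<omega>. g \<omega> * ennreal (W s \<omega>) \<partial>M)"
      if s: "t \<le> s" "s \<le> T" and g: "g \<in> borel_measurable (F s)" for s g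
    proof -
      have "(\<integral>\<^sup>+\<omega>. g \<omega> * (ennreal (X T \<omega>) * ennreal (\<Psi> s \<omega>)) \<partial>M) = (\<integral>\<^sup>+\<omega>. g \<omega> * (ennreal (X T \<omega>) * (L s \<omega> + ennreal (rat T \<omega>))) \<partial>M)"
        by (rule nn_integral_cong_AE, rule AE_mp[OF \<Psi>_eq]) (use s in auto)
      then show ?thesis using weighted0[OF s g] by simp
    qed
    define B where "B = (\<integral>\<^sup>+\<omega>. indicator A \<omega> * ennreal (X t \<omega>) \<partial>M)"
    \<comment> \<open>Bounded below for each \<open>s\<close> and above after integration over
      \<open>s\<close>; the estimate comes from comparing the two.\<close>
    define P where "P s = (\<integral>\<^sup>+\<omega>. indicator A \<omega> * ennreal (X T \<omega>) * (ennreal (\<psi> s \<omega>) * ennreal (\<Psi> s \<omega> powr (a - 1))) \<partial>M)" for s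
    have P_lower: "ennreal (c1 / \<kappa>) * B \<le> P s" if s: "t \<le> s" "s \<le> T" for s
    proof -
      have s0: "0 \<le> s" using s t by simp
      note [measurable] = Xm[OF s0] Wm[OF s0] ratm[OF s0] \<psi>m[OF s0]
      have As: "A \<in> sets (F s)" using A F_mono[OF t s(1)] by blast
      define Bs D where "Bs = (\<integral>\<^sup>+\<omega>. indicator A \<omega> * ennreal (X s \<omega>) \<partial>M)"
        and "D = (\<integral>\<^sup>+\<omega>. indicator A \<omega> * ennreal (X T \<omega>) \<partial>M)"
      define d1 d2 where "d1 = (1 - a) * l powr (a - 2) / a" and "d2 = (2 - a) * l powr (a - 1) / a"
      have d: "0 \<le> d1" "0 \<le> d2" using a l by (auto simp: d1_def d2_def)
      \<comment> \<open>The tangent at \<open>l * rat s\<close> is multiplied by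
        \<open>\<psi> s\<close>, which cancels the powers of the ratio: the constant term becomes
        the number \<open>d2\<close>, the linear one \<open>d1 / rat s\<close> times
        \<open>\<Psi> s\<close>.\<close>
      have tangent: "ennreal d2 * (indicator A \<omega> * ennreal (X T \<omega>))
          \<le> indicator A \<omega> * ennreal (X T \<omega>) * (ennreal (\<psi> s \<omega>) * ennreal (\<Psi> s \<omega> powr (a - 1)))
            + ennreal d1 * ((indicator A \<omega> * ennreal (1 / rat s \<omega>)) * (ennreal (X T \<omega>) * ennreal (\<Psi> s \<omega>)))"
        if w: "\<omega> \<in> space M" for \<omega>
      proof -
        let ?r = "rat s \<omega>"
        note r = rat(2)[OF s0 w]
        have q: "\<psi> s \<omega> * ?r powr (a - 1) = 1 / a" 
          using r by (simp add: \<psi>_def flip: powr_add)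
        have q1: "\<psi> s \<omega> * (l * ?r) powr (a - 1) = l powr (a - 1) / a"
          using q r l by (simp add: powr_mult mult.left_commute[of "\<psi> s \<omega>"])
        have q2: "\<psi> s \<omega> * (l * ?r) powr (a - 2) = l powr (a - 2) / a * (1 / ?r)"
        proof -
          have "?r powr (a - 2) = ?r powr (a - 1) / ?r"
            using powr_mult_base[of ?r "a - 2"] r by (simp add: field_simps)
          then have "\<psi> s \<omega> * (l * ?r) powr (a - 2) = l powr (a - 2) * (\<psi> s \<omega> * ?r powr (a - 1)) * (1 / ?r)"
            using r l by (simp add: powr_mult ac_simps)
          then show ?thesis unfolding q by simp
        qed
        have "\<psi> s \<omega> * ((2 - a) * (l * ?r) powr (a - 1)) \<le> \<psi> s \<omega> * (\<Psi> s \<omega> powr (a - 1) + (1 - a) * (l * ?r) powr (a - 2) * \<Psi> s \<omega>)"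
          using powr_ge_tangent[OF a \<Psi>pos[OF w, of s], of "l * ?r"] l r by (intro mult_left_mono \<psi>0) auto
        also have "\<psi> s \<omega> * ((2 - a) * (l * ?r) powr (a - 1)) = (2 - a) * (\<psi> s \<omega> * (l * ?r) powr (a - 1))" by simp
        also have "\<dots> = d2" unfolding q1 by (simp add: d2_def)
        also have "\<psi> s \<omega> * (\<Psi> s \<omega> powr (a - 1) + (1 - a) * (l * ?r) powr (a - 2) * \<Psi> s \<omega>)
            = \<psi> s \<omega> * \<Psi> s \<omega> powr (a - 1) + (1 - a) * (\<psi> s \<omega> * (l * ?r) powr (a - 2)) * \<Psi> s \<omega>"
          by (simp add: distrib_left ac_simps)
        also have "\<dots> = \<psi> s \<omega> * \<Psi> s \<omega> powr (a - 1) + d1 * (1 / ?r * \<Psi> s \<omega>)"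
          unfolding q2 by (simp add: d1_def)
        finally have "ennreal d2 \<le> ennreal (\<psi> s \<omega> * \<Psi> s \<omega> powr (a - 1) + d1 * (1 / ?r * \<Psi> s \<omega>))"
          by (rule ennreal_leI)
        also have "\<dots> = ennreal (\<psi> s \<omega>) * ennreal (\<Psi> s \<omega> powr (a - 1)) + ennreal d1 * (ennreal (1 / ?r) * ennreal (\<Psi> s \<omega>))"
        proof -
          have "ennreal (d1 * (1 / ?r * \<Psi> s \<omega>)) = ennreal d1 * (ennreal (1 / ?r) * ennreal (\<Psi> s \<omega>))"
            using d r \<Psi>pos[OF w, of s] by (subst ennreal_mult, simp, simp, subst ennreal_mult) auto
          then show ?thesis using \<psi>0[of s \<omega>] d r \<Psi>pos[OF w, of s] by (subst ennreal_plus) (auto simp: ennreal_mult' simp del: times_divide_eq_left times_divide_eq_right)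
        qed
        finally have "(indicator A \<omega> * ennreal (X T \<omega>)) * ennreal d2 \<le> (indicator A \<omega> * ennreal (X T \<omega>)) *
          (ennreal (\<psi> s \<omega>) * ennreal (\<Psi> s \<omega> powr (a - 1)) + ennreal d1 * (ennreal (1 / ?r) * ennreal (\<Psi> s \<omega>)))"
          by (rule mult_left_mono) simp
        then show ?thesis by (simp only: distrib_left ac_simps)
      qed
      have "ennreal d2 * D = (\<integral>\<^sup>+\<omega>. ennreal d2 * (indicator A \<omega> * ennreal (X T \<omega>)) \<partial>M)"
        unfolding D_def by (rule nn_integral_cmult[symmetric]) measurable
      also have "\<dots> \<le> (\<integral>\<^sup>+\<omega>. indicator A \<omega> * ennreal (X T \<omega>) * (ennreal (\<psi> s \<omega>) * ennreal (\<Psi> s \<omega> powr (a - 1)))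
            + ennreal d1 * ((indicator A \<omega> * ennreal (1 / rat s \<omega>)) * (ennreal (X T \<omega>) * ennreal (\<Psi> s \<omega>))) \<partial>M)"
        by (rule nn_integral_mono[OF tangent])
      also have "\<dots> = P s + ennreal d1 * (\<integral>\<^sup>+\<omega>. (indicator A \<omega> * ennreal (1 / rat s \<omega>)) * (ennreal (X T \<omega>) * ennreal (\<Psi> s \<omega>)) \<partial>M)"
        unfolding P_def by (subst nn_integral_cmult[symmetric], measurable, rule nn_integral_add) measurable
      \<comment> \<open>With the test \<open>1 / rat s\<close> the bound on the mean of
        \<open>\<Psi> s\<close> produces \<open>W s / rat s\<close>, that is
        \<open>X s\<close>.\<close>
      also have "\<dots> \<le> P s + ennreal d1 * (ennreal \<kappa> * (\<integral>\<^sup>+\<omega>. (indicator A \<omega> * ennreal (1 / rat s \<omega>)) * ennreal (W s \<omega>) \<partial>M))"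
      proof (intro add_left_mono mult_left_mono weighted s)
        note [measurable] = prog_meas_adapted[OF ratp s0] As
        show "(\<lambda>\<omega>. indicator A \<omega> * ennreal (1 / rat s \<omega>)) \<in> borel_measurable (F s)" by measurable
      qed auto
      also have "(\<integral>\<^sup>+\<omega>. (indicator A \<omega> * ennreal (1 / rat s \<omega>)) * ennreal (W s \<omega>) \<partial>M) = Bs"
        unfolding Bs_def
      proof (rule nn_integral_cong)
        fix \<omega> assume w: "\<omega> \<in> space M"
        have "ennreal (1 / rat s \<omega>) * ennreal (W s \<omega>) = ennreal (X s \<omega>)"
          using rat[OF s0 w] Xpos[OF s0 w] Wpos[OF s0 w] by (subst ennreal_mult[symmetric]) auto
        then show "indicator A \<omega> * ennreal (1 / rat s \<omega>) * ennreal (W s \<omega>) = indicator A \<omega> * ennreal (X s \<omega>)"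
          by (simp add: mult.assoc)
      qed
      finally have ineq: "ennreal d2 * D \<le> P s + ennreal d1 * (ennreal \<kappa> * Bs)" .
      \<comment> \<open>Both uses of the backward estimate stay within the step
        \<open>\<delta>\<close>: one compares \<open>X s\<close> with \<open>X T\<close>, the other
        \<open>X t\<close> with \<open>X s\<close>, with the same constant for all
        \<open>s\<close>.\<close>
      have BsD: "Bs \<le> ennreal \<kappa> * D"
        unfolding Bs_def D_def by (rule bwd[OF s0 s(2) _ As]) (use s in \<open>simp add: T_def\<close>)
      have BBs: "B \<le> ennreal \<kappa> * Bs"
        unfolding B_def Bs_def by (rule bwd[OF t s(1) _ A]) (use s in \<open>simp add: T_def\<close>)
      have fin: "(\<integral>\<^sup>+\<omega>. indicator A \<omega> * ennreal (X u \<omega>) \<partial>M) < \<infinity>" if "0 \<le> u" for u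
        by (rule le_less_trans[OF nn_integral_mono Xfin[OF that]]) (auto simp: indicator_def)
      obtain b where b: "B = ennreal b" "0 \<le> b" using fin[OF t] by (metis B_def ennreal_cases infinity_ennreal_def less_irrefl)
      obtain bs where bs: "Bs = ennreal bs" "0 \<le> bs" using fin[OF s0] by (metis Bs_def ennreal_cases infinity_ennreal_def less_irrefl)
      obtain x where x: "D = ennreal x" "0 \<le> x" using fin[OF T0(1)] by (metis D_def ennreal_cases infinity_ennreal_def less_irrefl)
      show ?thesis
      proof (cases "P s")
        case (real p)
        have "ennreal (d2 * x) \<le> ennreal (p + d1 * (\<kappa> * bs))"
          using ineq unfolding x(1) bs(1) real(2) using d \<kappa> bs x real(1) by (simp add: ennreal_mult)
        then have 1: "d2 * x \<le> p + d1 * (\<kappa> * bs)"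
          by (subst (asm) ennreal_le_iff) (use d \<kappa> bs real(1) in auto)
        have "ennreal bs \<le> ennreal (\<kappa> * x)" using BsD unfolding x(1) bs(1) using \<kappa> by (simp add: ennreal_mult')
        then have 2: "bs \<le> \<kappa> * x" by (subst (asm) ennreal_le_iff) (use \<kappa> x in auto)
        have "ennreal b \<le> ennreal (\<kappa> * bs)" using BBs unfolding b(1) bs(1) using \<kappa> by (simp add: ennreal_mult')
        then have 3: "b \<le> \<kappa> * bs" by (subst (asm) ennreal_le_iff) (use \<kappa> bs in auto)
        have "c1 / \<kappa> * b \<le> c1 / \<kappa> * (\<kappa> * bs)" using c1 \<kappa> 3 by (intro mult_left_mono) auto
        also have "\<dots> = (d2 / \<kappa> - d1 * \<kappa>) * bs"
        proof -
          have "l powr (a - 2) * \<kappa> = l powr (a - 1) / \<kappa>"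
            using powr_mult_base[of l "a - 2"] l \<kappa> by (simp add: l_def power2_eq_square field_simps)
          then have "d1 * \<kappa> = (1 - a) * (l powr (a - 1) / \<kappa>) / a" by (simp add: d1_def mult.assoc)
          then have "d2 / \<kappa> - d1 * \<kappa> = c1" using a \<kappa> by (simp add: d2_def c1_def field_simps)
          then show ?thesis using \<kappa> by simp
        qed
        also have "\<dots> = d2 * (bs / \<kappa>) - d1 * (\<kappa> * bs)" by (simp add: left_diff_distrib)
        also have "\<dots> \<le> d2 * x - d1 * (\<kappa> * bs)"
          using 2 \<kappa> d by (intro diff_right_mono mult_left_mono) (auto simp: field_simps)
        also have "\<dots> \<le> p" using 1 by simp
        finally have "ennreal (c1 / \<kappa> * b) \<le> ennreal p" by (rule ennreal_leI)
        then show ?thesis unfolding b(1) real(2) using c1 \<kappa> b by (subst ennreal_mult[symmetric]) auto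
      qed simp
    qed
    \<comment> \<open>The lower bound is integrated over \<open>{t..T}\<close>; after the exchange
      of integrals the same quantity is bounded above on each path by the substitution
      inequality.\<close>
    have "ennreal \<delta> * (ennreal (c1 / \<kappa>) * B) = (\<integral>\<^sup>+s\<in>{t..T}. ennreal (c1 / \<kappa>) * B \<partial>lborel)"
      using \<delta> by (simp add: nn_integral_cmult_indicator T_def mult.commute)
    also have "\<dots> \<le> (\<integral>\<^sup>+s\<in>{t..T}. P s \<partial>lborel)"
      using P_lower by (intro nn_integral_mono) (auto simp: indicator_def)
    also have "\<dots> = (\<integral>\<^sup>+s. (\<integral>\<^sup>+\<omega>. (indicator A \<omega> * ennreal (X T \<omega>)) * ((ennreal (\<psi> s \<omega>) * ennreal (\<Psi> s \<omega> powr (a - 1))) * indicator {t..T} s) \<partial>M) \<partial>lborel)"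
      unfolding P_def by (intro nn_integral_cong) (auto simp: indicator_def)
    also have "\<dots> = (\<integral>\<^sup>+\<omega>. (\<integral>\<^sup>+s. (indicator A \<omega> * ennreal (X T \<omega>)) * ((ennreal (\<psi> s \<omega>) * ennreal (\<Psi> s \<omega> powr (a - 1))) * indicator {t..T} s) \<partial>lborel) \<partial>M)"
    proof -
      interpret pair_sigma_finite M "lborel :: real measure" ..
      show ?thesis by (rule Fubini') measurable
    qed
    also have "\<dots> \<le> (\<integral>\<^sup>+\<omega>. (indicator A \<omega> * ennreal (X T \<omega>)) * ennreal (\<Psi> t \<omega> powr a / a) \<partial>M)"
    proof (rule nn_integral_mono_AE)
      show "AE \<omega> in M. (\<integral>\<^sup>+s. (indicator A \<omega> * ennreal (X T \<omega>)) * ((ennreal (\<psi> s \<omega>) * ennreal (\<Psi> s \<omega> powr (a - 1))) * indicator {t..T} s) \<partial>lborel)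
         \<le> (indicator A \<omega> * ennreal (X T \<omega>)) * ennreal (\<Psi> t \<omega> powr a / a)"
        using L_fin AE_space
      proof eventually_elim
        case (elim \<omega>)
        note [measurable] = elim(2)
        have [measurable]: "(\<lambda>s. \<psi> s \<omega>) \<in> borel_measurable borel" by measurable
        have "(\<integral>\<^sup>+s. (indicator A \<omega> * ennreal (X T \<omega>)) * ((ennreal (\<psi> s \<omega>) * ennreal (\<Psi> s \<omega> powr (a - 1))) * indicator {t..T} s) \<partial>lborel)
          = (indicator A \<omega> * ennreal (X T \<omega>)) * (\<integral>\<^sup>+s\<in>{t..T}. ennreal (\<psi> s \<omega>) * ennreal (\<Psi> s \<omega> powr (a - 1)) \<partial>lborel)"
          by (rule nn_integral_cmult) measurable
        also have "\<dots> \<le> (indicator A \<omega> * ennreal (X T \<omega>)) * ennreal (\<Psi> t \<omega> powr a / a)"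
          unfolding \<Psi>_def L_def
          by (intro mult_left_mono nn_integral_powr_substitution a rat(2) T0 elim)
            (use elim(1) in \<open>auto simp: L_def\<close>)
        finally show ?case .
      qed
    qed
    \<comment> \<open>The tangent point \<open>rat t\<close> is known at time \<open>t\<close>, so
      both resulting terms carry tests that are measurable for \<open>F t\<close>.\<close>
    also have "\<dots> \<le> (\<integral>\<^sup>+\<omega>. (indicator A \<omega> * ennreal (rat t \<omega> powr (a - 1))) * (ennreal (X T \<omega>) * ennreal (\<Psi> t \<omega>))
        + (indicator A \<omega> * ennreal ((1 - a) / a * rat t \<omega> powr a)) * ennreal (X T \<omega>) \<partial>M)"
    proof (rule nn_integral_mono)
      fix \<omega> assume w: "\<omega> \<in> space M"
      have "\<Psi> t \<omega> powr a / a \<le> (a * rat t \<omega> powr (a - 1) * \<Psi> t \<omega> + (1 - a) * rat t \<omega> powr a) / a"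
        using powr_le_tangent[OF a, of "\<Psi> t \<omega>" "rat t \<omega>"] \<Psi>pos[OF w, of t] rat(2)[OF t w] a by (intro divide_right_mono) auto
      also have "\<dots> = rat t \<omega> powr (a - 1) * \<Psi> t \<omega> + (1 - a) / a * rat t \<omega> powr a"
        using a by (simp add: add_divide_distrib)
      finally have "ennreal (\<Psi> t \<omega> powr a / a) \<le> ennreal (rat t \<omega> powr (a - 1) * \<Psi> t \<omega> + (1 - a) / a * rat t \<omega> powr a)"
        by (rule ennreal_leI)
      also have "\<dots> = ennreal (rat t \<omega> powr (a - 1)) * ennreal (\<Psi> t \<omega>) + ennreal ((1 - a) / a * rat t \<omega> powr a)"
        using \<Psi>pos[OF w, of t] a by (simp add: ennreal_plus ennreal_mult')
      finally have "(indicator A \<omega> * ennreal (X T \<omega>)) * ennreal (\<Psi> t \<omega> powr a / a) \<le>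
        (indicator A \<omega> * ennreal (X T \<omega>)) * (ennreal (rat t \<omega> powr (a - 1)) * ennreal (\<Psi> t \<omega>) + ennreal ((1 - a) / a * rat t \<omega> powr a))"
        by (intro mult_left_mono) auto
      then show "(indicator A \<omega> * ennreal (X T \<omega>)) * ennreal (\<Psi> t \<omega> powr a / a) \<le>
          (indicator A \<omega> * ennreal (rat t \<omega> powr (a - 1))) * (ennreal (X T \<omega>) * ennreal (\<Psi> t \<omega>))
        + (indicator A \<omega> * ennreal ((1 - a) / a * rat t \<omega> powr a)) * ennreal (X T \<omega>)"
        by (simp add: distrib_left ac_simps)
    qed
    also have "\<dots> = (\<integral>\<^sup>+\<omega>. (indicator A \<omega> * ennreal (rat t \<omega> powr (a - 1))) * (ennreal (X T \<omega>) * ennreal (\<Psi> t \<omega>)) \<partial>M)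
        + (\<integral>\<^sup>+\<omega>. (indicator A \<omega> * ennreal ((1 - a) / a * rat t \<omega> powr a)) * ennreal (X T \<omega>) \<partial>M)"
      by (rule nn_integral_add) measurable
    also have "\<dots> \<le> ennreal \<kappa> * (\<integral>\<^sup>+\<omega>. (indicator A \<omega> * ennreal (rat t \<omega> powr (a - 1))) * ennreal (W t \<omega>) \<partial>M)
        + ennreal \<kappa> * (\<integral>\<^sup>+\<omega>. (indicator A \<omega> * ennreal ((1 - a) / a * rat t \<omega> powr a)) * ennreal (X t \<omega>) \<partial>M)"
    proof (rule add_mono)
      note [measurable] = prog_meas_adapted[OF ratp t] A
      show "(\<integral>\<^sup>+\<omega>. (indicator A \<omega> * ennreal (rat t \<omega> powr (a - 1))) * (ennreal (X T \<omega>) * ennreal (\<Psi> t \<omega>)) \<partial>M)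
        \<le> ennreal \<kappa> * (\<integral>\<^sup>+\<omega>. (indicator A \<omega> * ennreal (rat t \<omega> powr (a - 1))) * ennreal (W t \<omega>) \<partial>M)"
        using T0 by (intro weighted) auto
      show "(\<integral>\<^sup>+\<omega>. (indicator A \<omega> * ennreal ((1 - a) / a * rat t \<omega> powr a)) * ennreal (X T \<omega>) \<partial>M)
        \<le> ennreal \<kappa> * (\<integral>\<^sup>+\<omega>. (indicator A \<omega> * ennreal ((1 - a) / a * rat t \<omega> powr a)) * ennreal (X t \<omega>) \<partial>M)"
        using T0 t by (intro fwd) auto
    qed
    also have "\<dots> = ennreal \<kappa> * (\<integral>\<^sup>+\<omega>. (indicator A \<omega> * ennreal (rat t \<omega> powr (a - 1))) * ennreal (W t \<omega>)
        + (indicator A \<omega> * ennreal ((1 - a) / a * rat t \<omega> powr a)) * ennreal (X t \<omega>) \<partial>M)"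
      unfolding distrib_left[symmetric] by (subst nn_integral_add) auto
    \<comment> \<open>Since \<open>W t = rat t * X t\<close>, both terms are multiples of
      \<open>rat t powr a * X t\<close>, and the coefficients add up to
      \<open>1 + (1 - a) / a = 1 / a\<close>.\<close>
    also have "\<dots> = ennreal \<kappa> * (\<integral>\<^sup>+\<omega>. ennreal (1 / a) * (indicator A \<omega> * ennreal (rat t \<omega> powr a * X t \<omega>)) \<partial>M)"
    proof (intro arg_cong2[where f="(*)"] refl nn_integral_cong)
      fix \<omega> assume w: "\<omega> \<in> space M"
      have "rat t \<omega> powr (a - 1) * W t \<omega> = rat t \<omega> powr a * X t \<omega>"
      proof -
        have "W t \<omega> = rat t \<omega> * X t \<omega>" using rat(1)[OF t w] Xpos[OF t w] by simp
        then show ?thesis using powr_mult_base[of "rat t \<omega>" "a - 1"] rat(2)[OF t w] by (simp add: ac_simps)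
      qed
      then have "rat t \<omega> powr (a - 1) * W t \<omega> + (1 - a) / a * rat t \<omega> powr a * X t \<omega> = 1 / a * (rat t \<omega> powr a * X t \<omega>)"
        using a by (simp add: field_simps)
      then have "ennreal (rat t \<omega> powr (a - 1)) * ennreal (W t \<omega>) + ennreal ((1 - a) / a * rat t \<omega> powr a) * ennreal (X t \<omega>)
         = ennreal (1 / a) * ennreal (rat t \<omega> powr a * X t \<omega>)"
        using a Wpos[OF t w] Xpos[OF t w]
        by (subst (1 2 3) ennreal_mult[symmetric], simp_all add: ennreal_plus[symmetric] del: ennreal_plus)
      then show "indicator A \<omega> * ennreal (rat t \<omega> powr (a - 1)) * ennreal (W t \<omega>)
        + indicator A \<omega> * ennreal ((1 - a) / a * rat t \<omega> powr a) * ennreal (X t \<omega>)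
         = ennreal (1 / a) * (indicator A \<omega> * ennreal (rat t \<omega> powr a * X t \<omega>))"
        by (auto simp: indicator_def)
    qed
    also have "\<dots> = ennreal \<kappa> * (ennreal (1 / a) * (\<integral>\<^sup>+\<omega>. indicator A \<omega> * ennreal (rat t \<omega> powr a * X t \<omega>) \<partial>M))"
      by (subst nn_integral_cmult) auto
    finally have fin: "ennreal \<delta> * (ennreal (c1 / \<kappa>) * B) \<le> ennreal \<kappa> * (ennreal (1 / a) * (\<integral>\<^sup>+\<omega>. indicator A \<omega> * ennreal (rat t \<omega> powr a * X t \<omega>) \<partial>M))" .
    have e1: "ennreal (a / \<kappa>) * (ennreal \<delta> * ennreal (c1 / \<kappa>)) = ennreal c2"
      using a \<kappa> \<delta> c1 by (subst ennreal_mult[symmetric], simp, simp, subst ennreal_mult[symmetric]) (auto simp: c2_def power2_eq_square)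
    have e2: "ennreal (a / \<kappa>) * (ennreal \<kappa> * ennreal (1 / a)) = 1"
      using a \<kappa> by (subst ennreal_mult[symmetric], simp, simp, subst ennreal_mult[symmetric]) auto
    have "(\<integral>\<^sup>+\<omega>. indicator A \<omega> * ennreal (c2 * X t \<omega>) \<partial>M) = ennreal c2 * B"
      unfolding B_def using c2 by (subst nn_integral_cmult[symmetric]) (auto simp: ennreal_mult' ac_simps)
    also have "\<dots> = ennreal (a / \<kappa>) * (ennreal \<delta> * (ennreal (c1 / \<kappa>) * B))"
      unfolding e1[symmetric] by (simp only: mult.assoc)
    also have "\<dots> \<le> ennreal (a / \<kappa>) * (ennreal \<kappa> * (ennreal (1 / a) * (\<integral>\<^sup>+\<omega>. indicator A \<omega> * ennreal (rat t \<omega> powr a * X t \<omega>) \<partial>M)))"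
      by (intro mult_left_mono fin) auto
    also have "\<dots> = (ennreal (a / \<kappa>) * (ennreal \<kappa> * ennreal (1 / a))) * (\<integral>\<^sup>+\<omega>. indicator A \<omega> * ennreal (rat t \<omega> powr a * X t \<omega>) \<partial>M)"
      by (simp only: mult.assoc)
    finally show "(\<integral>\<^sup>+\<omega>. indicator A \<omega> * ennreal (c2 * X t \<omega>) \<partial>M) \<le> (\<integral>\<^sup>+\<omega>. indicator A \<omega> * ennreal (rat t \<omega> powr a * X t \<omega>) \<partial>M)"
      unfolding e2 by simp
  qed
  have "\<forall>t\<ge>0. AE \<omega> in M. c2 powr (1 / a) * X t \<omega> \<le> W t \<omega>"
  proof (intro allI impI)
    fix t :: real assume t: "0 \<le> t"
    show "AE \<omega> in M. c2 powr (1 / a) * X t \<omega> \<le> W t \<omega>"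
      using main[OF t] AE_space
    proof eventually_elim
      case (elim \<omega>)
      note w = elim(2)
      have "c2 * X t \<omega> \<le> rat t \<omega> powr a * X t \<omega>"
        using elim(1) by (subst (asm) ennreal_le_iff) (use Xpos[OF t w] in auto)
      then have "c2 \<le> rat t \<omega> powr a" using Xpos[OF t w] by simp
      then have "c2 powr (1 / a) \<le> (rat t \<omega> powr a) powr (1 / a)" using c2 a by (intro powr_mono2) auto
      also have "\<dots> = rat t \<omega>" using a rat(2)[OF t w] by (simp add: powr_powr)
      finally show ?case using rat(1)[OF t w] Xpos[OF t w] by (simp add: field_simps)
    qed
  qed
  moreover have "0 < c2 powr (1 / a)" using c2 by simp
  ultimately show ?thesis by blast
qed

end

section \<open>Upcrossings and regularisation of paths\<close>

text \<open>The position carried from time \<open>n\<close> to time \<open>n + 1\<close>. It depends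
  on \<open>f 0, ..., f n\<close> only, so the gains form a martingale transform when
  \<open>f\<close> is a martingale.\<close>

fun holding :: "real \<Rightarrow> real \<Rightarrow> (nat \<Rightarrow> real) \<Rightarrow> nat \<Rightarrow> bool" where
  "holding a b f 0 \<longleftrightarrow> f 0 \<le> a"
| "holding a b f (Suc n) \<longleftrightarrow> (if holding a b f n then f (Suc n) < b else f (Suc n) \<le> a)"

fun upcrossings :: "real \<Rightarrow> real \<Rightarrow> (nat \<Rightarrow> real) \<Rightarrow> nat \<Rightarrow> nat" where
  "upcrossings a b f 0 = 0"
| "upcrossings a b f (Suc n) = upcrossings a b f n + (if holding a b f n \<and> b \<le> f (Suc n) then 1 else 0)"

text \<open>Doob's trading strategy: hold one unit from a visit below \<open>a\<close> until the next visit above \<open>b\<close>.\<close>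

lemma upcrossings_gain:
  assumes "a < b"
  shows "(b - a) * real (upcrossings a b f n) + (if holding a b f n then f n - a else 0)
    \<le> (\<Sum>k<n. if holding a b f k then f (Suc k) - f k else 0)"
  using assms by (induction n) (auto simp: algebra_simps split: if_splits)

lemma upcrossings_mono: "m \<le> n \<Longrightarrow> upcrossings a b f m \<le> upcrossings a b f n"
  by (induction rule: dec_induct) auto

lemma holding_below: "a < b \<Longrightarrow> holding a b f n \<Longrightarrow> f n < b"
  by (cases n) (auto split: if_splits)

lemma holding_if_le: "a < b \<Longrightarrow> f n \<le> a \<Longrightarrow> holding a b f n"
  by (cases n) auto

lemma upcrossings_step:
  assumes ab: "a < b" and m: "m < n" "f m \<le> a" "b \<le> f n"
  shows "Suc (upcrossings a b f m) \<le> upcrossings a b f n"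
proof -
  \<comment> \<open>Invariant after the visit below \<open>a\<close>: either the count has already
    risen, or the unit is still held and a value of at least \<open>b\<close> would sell it.\<close>
  have "Suc (upcrossings a b f m) \<le> upcrossings a b f n \<or> (upcrossings a b f m \<le> upcrossings a b f n \<and> holding a b f n)"
    if "m \<le> n" for n using that
  proof (induction rule: dec_induct)
    case base
    then show ?case using holding_if_le[of a b f m] ab m(2) by simp
  next
    case (step n)
    then show ?case by auto
  qed
  from this[of n] holding_below[OF ab, of f n] m show ?thesis by auto
qed

text \<open>Built backwards in time: the last pair \<open>p < s\<close> comes first, and the
  remaining \<open>j\<close> crossings end by \<open>p\<close>. Unlike a count along a sequence,
  this makes sense for an infinite set \<open>D\<close> and is monotone in it.\<close>

fun upcross :: "real set \<Rightarrow> real \<Rightarrow> real \<Rightarrow> (real \<Rightarrow> real) \<Rightarrow> nat \<Rightarrow> real \<Rightarrow> bool" where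
  "upcross D a b f 0 t \<longleftrightarrow> True"
| "upcross D a b f (Suc j) t \<longleftrightarrow> (\<exists>s\<in>D. \<exists>p\<in>D. p < s \<and> s \<le> t \<and> f p \<le> a \<and> b \<le> f s \<and> upcross D a b f j p)"

lemma upcross_mono: "upcross D a b f j t \<Longrightarrow> t \<le> t' \<Longrightarrow> upcross D a b f j t'"
  by (cases j) (auto, meson order_trans)

lemma upcross_mono_set: "upcross D a b f j t \<Longrightarrow> D \<subseteq> E \<Longrightarrow> upcross E a b f j t"
proof (induction j arbitrary: t)
  case (Suc j)
  then obtain s p where "s \<in> D" "p \<in> D" "p < s" "s \<le> t" "f p \<le> a" "b \<le> f s" "upcross D a b f j p" by auto
  with Suc show ?case by auto
qed simp

text \<open>A chain of crossings uses finitely many times, and these lie together in one set of the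
  increasing sequence.\<close>

lemma upcross_incseq_Union:
  assumes "incseq D" "upcross (\<Union>k. D k) a b f j t"
  shows "\<exists>k. upcross (D k) a b f j t"
  using assms(2)
proof (induction j arbitrary: t)
  case 0 then show ?case by simp
next
  case (Suc j)
  then obtain s p k1 k2 where *: "s \<in> D k1" "p \<in> D k2" "p < s" "s \<le> t" "f p \<le> a" "b \<le> f s" "upcross (\<Union>k. D k) a b f j p"
    by auto
  from Suc.IH[OF this(7)] obtain k3 where k3: "upcross (D k3) a b f j p" by blast
  define k where "k = max k1 (max k2 k3)"
  have "D k1 \<subseteq> D k" "D k2 \<subseteq> D k" "D k3 \<subseteq> D k"
    by (rule incseqD[OF assms(1)], simp add: k_def)+
  then have "upcross (D k) a b f (Suc j) t"
    using * upcross_mono_set[OF k3, of "D k"] unfolding upcross.simps by blast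
  then show ?case by blast
qed

text \<open>A chain inside the grid is matched step by step with the count of the strategy, which
  increases at least once between a visit below \<open>a\<close> and a later visit above
  \<open>b\<close>.\<close>

lemma upcross_le_upcrossings:
  assumes ab: "a < b" and h: "0 < h"
  shows "upcross ((\<lambda>i. real i * h) ` {..n}) a b f j (real m * h) \<Longrightarrow> j \<le> upcrossings a b (\<lambda>i. f (real i * h)) m"
proof (induction j arbitrary: m)
  case 0 then show ?case by simp
next
  case (Suc j)
  then obtain i i' where i: "real i * h < real i' * h" "real i' * h \<le> real m * h" "f (real i * h) \<le> a" "b \<le> f (real i' * h)"
    and up: "upcross ((\<lambda>i. real i * h) ` {..n}) a b f j (real i * h)"
    by auto
  have "i < i'" "i' \<le> m" using i(1,2) h by auto
  have "Suc j \<le> Suc (upcrossings a b (\<lambda>i. f (real i * h)) i)" using Suc.IH[OF up] by simp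
  also have "\<dots> \<le> upcrossings a b (\<lambda>i. f (real i * h)) i'"
    using i(3,4) by (intro upcrossings_step ab \<open>i < i'\<close>) auto
  also have "\<dots> \<le> upcrossings a b (\<lambda>i. f (real i * h)) m" by (rule upcrossings_mono[OF \<open>i' \<le> m\<close>])
  finally show ?case .
qed

text \<open>Mesh and horizon are refined together: spacing \<open>1 / 2 ^ k\<close>, last point
  \<open>2 ^ k\<close>. The grids are thus finite, nested, and exhaust the nonnegative dyadic
  numbers.\<close>

definition dyadic_grid :: "nat \<Rightarrow> real set" where
  "dyadic_grid k = (\<lambda>i. real i * (1 / 2 ^ k)) ` {..4 ^ k}"

definition dyadics :: "real set" where "dyadics = (\<Union>k. dyadic_grid k)"

lemma dyadic_grid_incseq: "incseq dyadic_grid"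
proof (rule incseq_SucI)
  fix k
  show "dyadic_grid k \<subseteq> dyadic_grid (Suc k)"
  proof
    fix x assume "x \<in> dyadic_grid k"
    then obtain i where i: "i \<le> 4 ^ k" "x = real i * (1 / 2 ^ k)" by (auto simp: dyadic_grid_def)
    then have "x = real (2 * i) * (1 / 2 ^ Suc k)" "2 * i \<le> 4 ^ Suc k" by auto
    then show "x \<in> dyadic_grid (Suc k)" unfolding dyadic_grid_def by blast
  qed
qed

lemma countable_dyadics: "countable dyadics"
  by (auto simp: dyadics_def dyadic_grid_def)

lemma dyadics_nonneg: "x \<in> dyadics \<Longrightarrow> 0 \<le> x"
  by (auto simp: dyadics_def dyadic_grid_def)

lemma dyadics_I: "real i / 2 ^ k \<in> dyadics"
proof -
  \<comment> \<open>One level has to meet both demands: \<open>k \<le> m\<close> for the mesh and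
    \<open>i < 2 ^ m\<close> for the horizon.\<close>
  define m where "m = max i k"
  have "i < 2 ^ i" by (rule less_exp)
  also have "(2::nat) ^ i \<le> 2 ^ m" by (rule power_increasing) (auto simp: m_def)
  finally have "i * 2 ^ (m - k) \<le> 2 ^ m * 2 ^ m" by (intro mult_mono power_increasing) auto
  also have "(2::nat) ^ m * 2 ^ m = (2 * 2) ^ m" by (rule power_mult_distrib[symmetric])
  also have "\<dots> = 4 ^ m" by simp
  finally have "i * 2 ^ (m - k) \<le> 4 ^ m" .
  moreover have "real i / 2 ^ k = real (i * 2 ^ (m - k)) * (1 / 2 ^ m)"
  proof -
    have "(2::real) ^ m = 2 ^ (m - k) * 2 ^ k" by (simp add: m_def flip: power_add)
    then show ?thesis by simp
  qed
  ultimately have "real i / 2 ^ k \<in> dyadic_grid m" unfolding dyadic_grid_def by blast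
  then show ?thesis by (auto simp: dyadics_def)
qed

text \<open>Strictly above \<open>t\<close> even if \<open>t\<close> is itself dyadic, so a limit
  along it is a limit from the right that never sees the value at \<open>t\<close>.\<close>

definition dyadic_above :: "nat \<Rightarrow> real \<Rightarrow> real" where
  "dyadic_above n t = (of_int \<lfloor>2 ^ n * t\<rfloor> + 1) / 2 ^ n"

lemma dyadic_above_gt: "t < dyadic_above n t"
proof -
  have "2 ^ n * t < of_int \<lfloor>2 ^ n * t\<rfloor> + 1" by linarith
  then show ?thesis by (simp add: dyadic_above_def field_simps)
qed

lemma dyadic_above_le: "dyadic_above n t \<le> t + (1 / 2) ^ n"
proof -
  have "of_int \<lfloor>2 ^ n * t\<rfloor> \<le> 2 ^ n * t" by linarith
  then show ?thesis by (simp add: dyadic_above_def field_simps)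
qed

lemma dyadic_above_tendsto: "(\<lambda>n. dyadic_above n t) \<longlonglongrightarrow> t"
proof (rule tendsto_sandwich[OF _ _ tendsto_const])
  have "(\<lambda>n. t + (1/2::real) ^ n) \<longlonglongrightarrow> t + 0"
    by (intro tendsto_intros LIMSEQ_power_zero) auto
  then show "(\<lambda>n. t + (1/2::real) ^ n) \<longlonglongrightarrow> t" by simp
qed (use dyadic_above_gt dyadic_above_le in \<open>auto intro!: always_eventually less_imp_le\<close>)

lemma dyadic_above_in: "0 \<le> t \<Longrightarrow> dyadic_above n t \<in> dyadics"
proof -
  assume "0 \<le> t"
  then have "dyadic_above n t = real (nat (\<lfloor>2 ^ n * t\<rfloor> + 1)) / 2 ^ n"
    by (simp add: dyadic_above_def)
  then show ?thesis using dyadics_I by metis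
qed

lemma dyadics_dense: "0 \<le> x \<Longrightarrow> x < y \<Longrightarrow> \<exists>d\<in>dyadics. x < d \<and> d < y"
proof -
  assume x: "0 \<le> x" "x < y"
  have "\<forall>\<^sub>F n in sequentially. dyadic_above n x < y"
    using order_tendstoD(2)[OF dyadic_above_tendsto x(2)] .
  then obtain n where "dyadic_above n x < y" by (auto simp: eventually_sequentially)
  then show ?thesis using dyadic_above_gt[of x n] dyadic_above_in[OF x(1), of n] by auto
qed

text \<open>If the lower limit were below the upper one, two rationals would fit between them and
  both would be passed frequently; the bound 0 makes them nonnegative. The bound \<open>B\<close>
  keeps the common value finite.\<close>

lemma tendsto_if_no_oscillation:
  fixes g :: "'b \<Rightarrow> real"
  assumes nb: "F \<noteq> bot" and bd: "\<forall>\<^sub>F x in F. 0 \<le> g x \<and> g x \<le> B"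
    and no: "\<And>p q :: rat. 0 \<le> p \<Longrightarrow> p < q \<Longrightarrow> \<not> ((\<exists>\<^sub>F x in F. g x \<le> of_rat p) \<and> (\<exists>\<^sub>F x in F. of_rat q \<le> g x))"
  shows "\<exists>l. (g \<longlongrightarrow> l) F"
proof -
  let ?G = "\<lambda>x. ereal (g x)"
  have lo: "0 \<le> Liminf F ?G" by (rule Liminf_bounded) (use bd in \<open>auto elim: eventually_mono\<close>)
  have up: "Limsup F ?G \<le> ereal B" by (rule Limsup_bounded) (use bd in \<open>auto elim: eventually_mono\<close>)
  have le: "Liminf F ?G \<le> Limsup F ?G" by (rule Liminf_le_Limsup[OF nb])
  have "\<not> Liminf F ?G < Limsup F ?G"
  proof
    assume "Liminf F ?G < Limsup F ?G"
    then obtain p where p: "Liminf F ?G < ereal (of_rat p)" "ereal (of_rat p) < Limsup F ?G"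
      using ereal_dense3 by blast
    obtain q where q: "ereal (of_rat p) < ereal (of_rat q)" "ereal (of_rat q) < Limsup F ?G"
      using ereal_dense3[OF p(2)] by blast
    have "0 < ereal (of_rat p)" using lo p(1) by (rule le_less_trans)
    then have "0 \<le> p" "p < q" using q(1) by (auto simp: of_rat_less)
    moreover have "\<exists>\<^sub>F x in F. g x \<le> of_rat p"
    proof (rule ccontr)
      assume "\<not> ?thesis"
      then have "\<forall>\<^sub>F x in F. ereal (of_rat p) \<le> ?G x" by (auto simp: not_frequently elim!: eventually_mono)
      then have "ereal (of_rat p) \<le> Liminf F ?G" by (rule Liminf_bounded)
      then show False using p(1) by simp
    qed
    moreover have "\<exists>\<^sub>F x in F. of_rat q \<le> g x"
    proof (rule ccontr)
      assume "\<not> ?thesis"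
      then have "\<forall>\<^sub>F x in F. ?G x \<le> ereal (of_rat q)" by (auto simp: not_frequently elim!: eventually_mono)
      then have "Limsup F ?G \<le> ereal (of_rat q)" by (rule Limsup_bounded)
      then show False using q(2) by simp
    qed
    ultimately show False using no by blast
  qed
  then have eq: "Liminf F ?G = Limsup F ?G" using le by simp
  have "0 \<le> Limsup F ?G" using lo eq by simp
  then obtain l where l: "Limsup F ?G = ereal l" using up by (cases "Limsup F ?G") auto
  have "(?G \<longlongrightarrow> ereal l) F" by (rule Liminf_eq_Limsup[OF nb]) (use l eq in auto)
  then show ?thesis by auto
qed

text \<open>What the upcrossing estimate gives for almost every path; the consequences drawn within
  the locale are deterministic.\<close>

locale regular_on_dyadics =
  fixes g :: "real \<Rightarrow> real" and B :: real
  assumes bounded: "\<And>d. d \<in> dyadics \<Longrightarrow> 0 \<le> g d \<and> g d \<le> B"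
    and no_upcross: "\<And>p q :: rat. 0 \<le> p \<Longrightarrow> p < q \<Longrightarrow> \<exists>j. \<forall>t. \<not> upcross dyadics (of_rat p) (of_rat q) g j t"
begin

text \<open>A limit along one explicit sequence, so that measurability in \<open>\<omega>\<close> is
  inherited later; \<open>tendsto_right_lim\<close> identifies it with the full right limit along
  \<open>dyadics\<close>.\<close>

definition right_lim :: "real \<Rightarrow> real" where
  "right_lim t = lim (\<lambda>n. g (dyadic_above n t))"

lemma eventually_right_dyadics:
  "eventually P (at t within dyadics \<inter> {t<..}) \<longleftrightarrow> (\<exists>e>t. \<forall>d\<in>dyadics. t < d \<longrightarrow> d < e \<longrightarrow> P d)"
proof
  assume "eventually P (at t within dyadics \<inter> {t<..})"
  then obtain r where r: "0 < r" "\<forall>x\<in>dyadics \<inter> {t<..}. x \<noteq> t \<and> dist x t < r \<longrightarrow> P x"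
    by (auto simp: eventually_at)
  then show "\<exists>e>t. \<forall>d\<in>dyadics. t < d \<longrightarrow> d < e \<longrightarrow> P d"
    by (intro exI[of _ "t + r"]) (auto simp: dist_real_def)
next
  assume "\<exists>e>t. \<forall>d\<in>dyadics. t < d \<longrightarrow> d < e \<longrightarrow> P d"
  then obtain e where "t < e" "\<forall>d\<in>dyadics. t < d \<longrightarrow> d < e \<longrightarrow> P d" by blast
  then show "eventually P (at t within dyadics \<inter> {t<..})"
    by (auto simp: eventually_at dist_real_def intro!: exI[of _ "e - t"])
qed

lemma eventually_left_dyadics:
  "eventually P (at t within dyadics \<inter> {..<t}) \<longleftrightarrow> (\<exists>e<t. \<forall>d\<in>dyadics. e < d \<longrightarrow> d < t \<longrightarrow> P d)"
proof
  assume "eventually P (at t within dyadics \<inter> {..<t})"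
  then obtain r where r: "0 < r" "\<forall>x\<in>dyadics \<inter> {..<t}. x \<noteq> t \<and> dist x t < r \<longrightarrow> P x"
    by (auto simp: eventually_at)
  then show "\<exists>e<t. \<forall>d\<in>dyadics. e < d \<longrightarrow> d < t \<longrightarrow> P d"
    by (intro exI[of _ "t - r"]) (auto simp: dist_real_def)
next
  assume "\<exists>e<t. \<forall>d\<in>dyadics. e < d \<longrightarrow> d < t \<longrightarrow> P d"
  then obtain e where "e < t" "\<forall>d\<in>dyadics. e < d \<longrightarrow> d < t \<longrightarrow> P d" by blast
  then show "eventually P (at t within dyadics \<inter> {..<t})"
    by (auto simp: eventually_at dist_real_def intro!: exI[of _ "t - e"])
qed

lemma right_limit_exists:
  assumes t: "0 \<le> t"
  shows "\<exists>l. (g \<longlongrightarrow> l) (at t within dyadics \<inter> {t<..})"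
proof (rule tendsto_if_no_oscillation)
  show "at t within dyadics \<inter> {t<..} \<noteq> bot"
    using dyadics_dense[OF t] unfolding trivial_limit_def eventually_right_dyadics by blast
  show "\<forall>\<^sub>F x in at t within dyadics \<inter> {t<..}. 0 \<le> g x \<and> g x \<le> B"
    unfolding eventually_right_dyadics using bounded by (intro exI[of _ "t + 1"]) auto
next
  fix p q :: rat assume pq: "0 \<le> p" "p < q"
  show "\<not> ((\<exists>\<^sub>F x in at t within dyadics \<inter> {t<..}. g x \<le> of_rat p) \<and> (\<exists>\<^sub>F x in at t within dyadics \<inter> {t<..}. of_rat q \<le> g x))"
  proof
    assume "(\<exists>\<^sub>F x in at t within dyadics \<inter> {t<..}. g x \<le> of_rat p) \<and> (\<exists>\<^sub>F x in at t within dyadics \<inter> {t<..}. of_rat q \<le> g x)"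
    then have fr: "\<And>e. t < e \<Longrightarrow> \<exists>d\<in>dyadics. t < d \<and> d < e \<and> g d \<le> of_rat p"
      "\<And>e. t < e \<Longrightarrow> \<exists>d\<in>dyadics. t < d \<and> d < e \<and> of_rat q \<le> g d"
      unfolding frequently_def eventually_right_dyadics by blast+
    \<comment> \<open>Oscillation persists arbitrarily close to the right of \<open>t\<close>, so
      the chain is prolonged at its early end: a later pair is chosen first, and the induction
      supplies crossings closer to \<open>t\<close>.\<close>
    have "upcross dyadics (of_rat p) (of_rat q) g j e" if "t < e" for j e using that
    proof (induction j arbitrary: e)
      case 0 then show ?case by simp
    next
      case (Suc j)
      obtain s where s: "s \<in> dyadics" "t < s" "s < e" "of_rat q \<le> g s" using fr(2)[OF Suc.prems] by blast
      obtain d where d: "d \<in> dyadics" "t < d" "d < s" "g d \<le> of_rat p" using fr(1)[OF s(2)] by blast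
      then show ?case using s d Suc.IH[OF d(2)] unfolding upcross.simps by (meson less_imp_le)
    qed
    then show False using no_upcross[OF pq] by (metis less_add_one)
  qed
qed

lemma left_limit_exists:
  assumes t: "0 < t"
  shows "\<exists>l. (g \<longlongrightarrow> l) (at t within dyadics \<inter> {..<t})"
proof (rule tendsto_if_no_oscillation)
  show "at t within dyadics \<inter> {..<t} \<noteq> bot"
    unfolding trivial_limit_def eventually_left_dyadics
  proof clarify
    fix e assume e: "e < t" "\<forall>d\<in>dyadics. e < d \<longrightarrow> d < t \<longrightarrow> False"
    show False using dyadics_dense[of "max 0 e" t] e t by auto
  qed
  show "\<forall>\<^sub>F x in at t within dyadics \<inter> {..<t}. 0 \<le> g x \<and> g x \<le> B"
    unfolding eventually_left_dyadics using bounded by (intro exI[of _ "t - 1"]) auto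
next
  fix p q :: rat assume pq: "0 \<le> p" "p < q"
  show "\<not> ((\<exists>\<^sub>F x in at t within dyadics \<inter> {..<t}. g x \<le> of_rat p) \<and> (\<exists>\<^sub>F x in at t within dyadics \<inter> {..<t}. of_rat q \<le> g x))"
  proof
    assume "(\<exists>\<^sub>F x in at t within dyadics \<inter> {..<t}. g x \<le> of_rat p) \<and> (\<exists>\<^sub>F x in at t within dyadics \<inter> {..<t}. of_rat q \<le> g x)"
    then have fr: "\<And>e. e < t \<Longrightarrow> \<exists>d\<in>dyadics. e < d \<and> d < t \<and> g d \<le> of_rat p"
      "\<And>e. e < t \<Longrightarrow> \<exists>d\<in>dyadics. e < d \<and> d < t \<and> of_rat q \<le> g d"
      unfolding frequently_def eventually_left_dyadics by blast+
    \<comment> \<open>From the left the chain is prolonged at its late end instead, so the claim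
      carries an end point \<open>e < t\<close> that moves with \<open>j\<close>.\<close>
    have "\<exists>e<t. upcross dyadics (of_rat p) (of_rat q) g j e" for j
    proof (induction j)
      case 0 show ?case by (intro exI[of _ "t - 1"]) simp
    next
      case (Suc j)
      then obtain e where e: "e < t" "upcross dyadics (of_rat p) (of_rat q) g j e" by blast
      obtain d where d: "d \<in> dyadics" "e < d" "d < t" "g d \<le> of_rat p" using fr(1)[OF e(1)] by blast
      obtain s where s: "s \<in> dyadics" "d < s" "s < t" "of_rat q \<le> g s" using fr(2)[OF d(3)] by blast
      have "upcross dyadics (of_rat p) (of_rat q) g (Suc j) s"
        using s d upcross_mono[OF e(2), of d] unfolding upcross.simps by (meson less_imp_le order_refl)
      then show ?case using s by blast
    qed
    then show False using no_upcross[OF pq] by metis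
  qed
qed

lemma tendsto_right_lim:
  assumes t: "0 \<le> t"
  shows "(g \<longlongrightarrow> right_lim t) (at t within dyadics \<inter> {t<..})" and "(\<lambda>n. g (dyadic_above n t)) \<longlonglongrightarrow> right_lim t"
proof -
  obtain l where l: "(g \<longlongrightarrow> l) (at t within dyadics \<inter> {t<..})" using right_limit_exists[OF t] by blast
  have "filterlim (\<lambda>n. dyadic_above n t) (at t within dyadics \<inter> {t<..}) sequentially"
    using dyadic_above_tendsto[of t] dyadic_above_gt[of t] dyadic_above_in[OF t]
    by (auto simp: filterlim_at less_imp_neq[symmetric])
  then have *: "(\<lambda>n. g (dyadic_above n t)) \<longlonglongrightarrow> l" using l by (rule filterlim_compose[rotated])
  then have "right_lim t = l" unfolding right_lim_def by (rule limI)
  then show "(g \<longlongrightarrow> right_lim t) (at t within dyadics \<inter> {t<..})" "(\<lambda>n. g (dyadic_above n t)) \<longlonglongrightarrow> right_lim t" using l * by auto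
qed

text \<open>A non-strict bound on the dyadics of an interval passes to the right limit at its left
  end; both one-sided limits of \<open>right_lim\<close> are obtained from this.\<close>

lemma right_lim_close:
  assumes s: "0 \<le> s" "s < e" and close: "\<And>d. d \<in> dyadics \<Longrightarrow> s < d \<Longrightarrow> d < e \<Longrightarrow> \<bar>g d - l\<bar> \<le> \<epsilon>"
  shows "\<bar>right_lim s - l\<bar> \<le> \<epsilon>"
proof (rule tendsto_le[OF sequentially_bot tendsto_const])
  show "(\<lambda>n. \<bar>g (dyadic_above n s) - l\<bar>) \<longlonglongrightarrow> \<bar>right_lim s - l\<bar>"
    by (intro tendsto_intros tendsto_right_lim s)
  have "\<forall>\<^sub>F n in sequentially. dyadic_above n s < e"
    using order_tendstoD(2)[OF dyadic_above_tendsto s(2)] .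
  then show "\<forall>\<^sub>F n in sequentially. \<bar>g (dyadic_above n s) - l\<bar> \<le> \<epsilon>"
    by eventually_elim (use close dyadic_above_in[OF s(1)] dyadic_above_gt in auto)
qed

lemma cadlag_right_lim: "cadlag_path right_lim"
  unfolding cadlag_path_def
proof (intro allI impI conjI)
  fix t :: real assume t: "0 \<le> t"
  show "continuous (at_right t) right_lim"
    unfolding continuous_within
  proof (rule tendstoI)
    fix \<epsilon> :: real assume "0 < \<epsilon>"
    then have "\<forall>\<^sub>F d in at t within dyadics \<inter> {t<..}. dist (g d) (right_lim t) < \<epsilon> / 2"
      using tendstoD[OF tendsto_right_lim(1)[OF t], of "\<epsilon> / 2"] by simp
    then obtain e where e: "t < e" "\<And>d. d \<in> dyadics \<Longrightarrow> t < d \<Longrightarrow> d < e \<Longrightarrow> \<bar>g d - right_lim t\<bar> < \<epsilon> / 2"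
      unfolding eventually_right_dyadics by (auto simp: dist_real_def)
    have "dist (right_lim s) (right_lim t) < \<epsilon>" if s: "t < s" "s < e" for s
    proof -
      have "\<bar>right_lim s - right_lim t\<bar> \<le> \<epsilon> / 2"
        using s t by (intro right_lim_close[of _ e] less_imp_le[OF e(2)]) auto
      then show ?thesis using \<open>0 < \<epsilon>\<close> by (simp add: dist_real_def)
    qed
    then show "\<forall>\<^sub>F s in at_right t. dist (right_lim s) (right_lim t) < \<epsilon>"
      using e(1) unfolding eventually_at_right_field by blast
  qed
next
  fix t :: real assume t: "0 < t"
  obtain l where l: "(g \<longlongrightarrow> l) (at t within dyadics \<inter> {..<t})" using left_limit_exists[OF t] by blast
  have "(right_lim \<longlongrightarrow> l) (at_left t)"
  proof (rule tendstoI)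
    fix \<epsilon> :: real assume "0 < \<epsilon>"
    then have "\<forall>\<^sub>F d in at t within dyadics \<inter> {..<t}. dist (g d) l < \<epsilon> / 2"
      using tendstoD[OF l, of "\<epsilon> / 2"] by simp
    then obtain e where e: "e < t" "\<And>d. d \<in> dyadics \<Longrightarrow> e < d \<Longrightarrow> d < t \<Longrightarrow> \<bar>g d - l\<bar> < \<epsilon> / 2"
      unfolding eventually_left_dyadics by (auto simp: dist_real_def)
    have "dist (right_lim s) l < \<epsilon>" if s: "max 0 e < s" "s < t" for s
    proof -
      have "\<bar>right_lim s - l\<bar> \<le> \<epsilon> / 2"
        using s t by (intro right_lim_close[of _ t] less_imp_le[OF e(2)]) auto
      then show ?thesis using \<open>0 < \<epsilon>\<close> by (simp add: dist_real_def)
    qed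
    then show "\<forall>\<^sub>F s in at_left t. dist (right_lim s) l < \<epsilon>"
      unfolding eventually_at_left_field using e(1) t by (intro exI[of _ "max 0 e"]) simp
  qed
  then show "\<exists>l. (right_lim \<longlongrightarrow> l) (at_left t)" by blast
qed

end

section \<open>Cadlag versions of martingales and potentials\<close>

context filtered_space
begin

text \<open>When \<open>\<xi>\<close> has finite mean, \<open>enn2real\<close> changes nothing
  almost surely. The versions at different times are chosen independently, so the paths have no
  regularity yet.\<close>

definition cond_mart :: "('a \<Rightarrow> ennreal) \<Rightarrow> real \<Rightarrow> 'a \<Rightarrow> real" where
  "cond_mart \<xi> t \<omega> = enn2real (nn_cond_exp M (F t) \<xi> \<omega>)"

lemma cond_mart_nonneg: "0 \<le> cond_mart \<xi> t \<omega>"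
  by (simp add: cond_mart_def)

lemma cond_mart_adapted: "cond_mart \<xi> t \<in> borel_measurable (F t)"
  unfolding cond_mart_def[abs_def] by measurable

lemma cond_mart_measurable: "0 \<le> t \<Longrightarrow> cond_mart \<xi> t \<in> borel_measurable M"
  by (rule measurable_F_M[OF cond_mart_adapted])

lemma cond_mart_test:
  assumes \<xi>: "\<xi> \<in> borel_measurable M" and fin: "(\<integral>\<^sup>+\<omega>. \<xi> \<omega> \<partial>M) < \<infinity>" and t: "0 \<le> t"
    and g: "g \<in> borel_measurable (F t)"
  shows "(\<integral>\<^sup>+\<omega>. g \<omega> * ennreal (cond_mart \<xi> t \<omega>) \<partial>M) = (\<integral>\<^sup>+\<omega>. g \<omega> * \<xi> \<omega> \<partial>M)"
proof -
  interpret sf: sigma_finite_subalgebra M "F t" by (rule sigma_finite_F[OF t])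
  have "(\<integral>\<^sup>+\<omega>. nn_cond_exp M (F t) \<xi> \<omega> \<partial>M) = (\<integral>\<^sup>+\<omega>. \<xi> \<omega> \<partial>M)"
    using sf.nn_cond_exp_intg[of "\<lambda>_. 1" \<xi>] \<xi> by simp
  then have "AE \<omega> in M. nn_cond_exp M (F t) \<xi> \<omega> \<noteq> \<infinity>"
    using fin by (intro nn_integral_PInf_AE) auto
  then have "(\<integral>\<^sup>+\<omega>. g \<omega> * ennreal (cond_mart \<xi> t \<omega>) \<partial>M) = (\<integral>\<^sup>+\<omega>. g \<omega> * nn_cond_exp M (F t) \<xi> \<omega> \<partial>M)"
    by (intro nn_integral_cong_AE) (auto elim!: eventually_mono simp: cond_mart_def less_top)
  also have "\<dots> = (\<integral>\<^sup>+\<omega>. g \<omega> * \<xi> \<omega> \<partial>M)" by (rule sf.nn_cond_exp_intg[OF g \<xi>])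
  finally show ?thesis .
qed

lemma cond_exp_testI:
  assumes f: "f \<in> borel_measurable (F t)" and \<xi>: "\<xi> \<in> borel_measurable M" and t: "0 \<le> t"
    and eq: "\<And>A. A \<in> sets (F t) \<Longrightarrow> (\<integral>\<^sup>+\<omega>. indicator A \<omega> * f \<omega> \<partial>M) = (\<integral>\<^sup>+\<omega>. indicator A \<omega> * \<xi> \<omega> \<partial>M)"
    and g: "g \<in> borel_measurable (F t)"
  shows "(\<integral>\<^sup>+\<omega>. g \<omega> * f \<omega> \<partial>M) = (\<integral>\<^sup>+\<omega>. g \<omega> * \<xi> \<omega> \<partial>M)"
proof -
  interpret sf: sigma_finite_subalgebra M "F t" by (rule sigma_finite_F[OF t])
  have "AE \<omega> in M. f \<omega> = nn_cond_exp M (F t) \<xi> \<omega>"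
    by (rule sf.nn_cond_exp_charact[OF _ \<xi> f]) (use eq in \<open>simp add: mult.commute\<close>)
  then have "(\<integral>\<^sup>+\<omega>. g \<omega> * f \<omega> \<partial>M) = (\<integral>\<^sup>+\<omega>. g \<omega> * nn_cond_exp M (F t) \<xi> \<omega> \<partial>M)"
    by (intro nn_integral_cong_AE) (auto elim!: eventually_mono)
  also have "\<dots> = (\<integral>\<^sup>+\<omega>. g \<omega> * \<xi> \<omega> \<partial>M)" by (rule sf.nn_cond_exp_intg[OF g \<xi>])
  finally show ?thesis .
qed

section \<open>Doob's upcrossing inequality on dyadic times\<close>

lemma upcross_pred:
  assumes N: "\<And>s. s \<in> D \<Longrightarrow> N s \<in> borel_measurable M" and D: "finite D"
  shows "Measurable.pred M (\<lambda>\<omega>. upcross D a b (\<lambda>t. N t \<omega>) j t)"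
proof (induction j arbitrary: t)
  case 0 then show ?case by simp
next
  case (Suc j)
  have "Measurable.pred M (\<lambda>\<omega>. \<exists>s\<in>D. \<exists>p\<in>D. p < s \<and> s \<le> t \<and> N p \<omega> \<le> a \<and> b \<le> N s \<omega> \<and> upcross D a b (\<lambda>t. N t \<omega>) j p)"
  proof (intro pred_intros_finite(4)[OF D])
    fix s p assume [simp]: "s \<in> D" "p \<in> D"
    note [measurable] = N[of s] N[of p] Suc[of p]
    show "Measurable.pred M (\<lambda>\<omega>. p < s \<and> s \<le> t \<and> N p \<omega> \<le> a \<and> b \<le> N s \<omega> \<and> upcross D a b (\<lambda>t. N t \<omega>) j p)"
      by measurable
  qed
  then show ?case by simp
qed

lemma holding_pred_F:
  assumes N: "\<And>i. N i \<in> borel_measurable (F (real i * h))" and h: "0 \<le> h"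
  shows "Measurable.pred (F (real k * h)) (\<lambda>\<omega>. holding a b (\<lambda>i. N i \<omega>) k)"
proof (induction k)
  case 0
  note [measurable] = N[of 0, simplified]
  show ?case by simp
next
  case (Suc k)
  have [measurable]: "Measurable.pred (F (real (Suc k) * h)) (\<lambda>\<omega>. holding a b (\<lambda>i. N i \<omega>) k)"
    by (rule measurable_F_mono[OF Suc]) (use h in \<open>auto intro: mult_right_mono\<close>)
  note [measurable] = N[of "Suc k"]
  show ?case unfolding holding.simps by measurable
qed

text \<open>The gain of the strategy has mean zero, each completed upcrossing earns at least
  \<open>b - a\<close>, and a position left open at the end loses at most \<open>a\<close> because
  the martingale is nonnegative.\<close>

lemma upcrossings_expectation:
  assumes \<xi>: "\<xi> \<in> borel_measurable M" and fin: "(\<integral>\<^sup>+\<omega>. \<xi> \<omega> \<partial>M) < \<infinity>"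
    and h: "0 < h" and ab: "0 \<le> a" "a < b"
  shows "integrable M (\<lambda>\<omega>. real (upcrossings a b (\<lambda>i. cond_mart \<xi> (real i * h) \<omega>) n))"
    and "expectation (\<lambda>\<omega>. real (upcrossings a b (\<lambda>i. cond_mart \<xi> (real i * h) \<omega>) n)) \<le> a / (b - a)"
proof -
  define N where "N i = cond_mart \<xi> (real i * h)" for i
  have NF: "N i \<in> borel_measurable (F (real i * h))" for i unfolding N_def by (rule cond_mart_adapted)
  have [measurable]: "N i \<in> borel_measurable M" for i
    unfolding N_def using h by (intro cond_mart_measurable) simp
  have N0: "0 \<le> N i \<omega>" for i \<omega> by (simp add: N_def cond_mart_nonneg)
  have Hp: "Measurable.pred (F (real k * h)) (\<lambda>\<omega>. holding a b (\<lambda>i. N i \<omega>) k)" for k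
    by (rule holding_pred_F[OF NF]) (use h in simp)
  have HpM [measurable]: "Measurable.pred M (\<lambda>\<omega>. holding a b (\<lambda>i. N i \<omega>) k)" for k
    by (rule measurable_F_M[OF Hp]) (use h in simp)
  have test: "(\<integral>\<^sup>+\<omega>. g \<omega> * ennreal (N i \<omega>) \<partial>M) = (\<integral>\<^sup>+\<omega>. g \<omega> * \<xi> \<omega> \<partial>M)" if "g \<in> borel_measurable (F (real i * h))" for g i
    unfolding N_def using h that by (intro cond_mart_test \<xi> fin) auto
  have Nint: "integrable M (N i)" for i
  proof (rule integrableI_nonneg)
    show "(\<integral>\<^sup>+\<omega>. ennreal (N i \<omega>) \<partial>M) < \<infinity>" using test[of "\<lambda>_. 1" i] fin by simp
  qed (simp_all add: N0)
  let ?H = "\<lambda>k \<omega>. holding a b (\<lambda>i. N i \<omega>) k"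
  \<comment> \<open>The position is known at grid time \<open>k\<close>, and on a set known then
    both neighbouring values integrate to the same as \<open>\<xi>\<close>, so each one-step gain
    has mean zero.\<close>
  have zero: "expectation (\<lambda>\<omega>. if ?H k \<omega> then N (Suc k) \<omega> - N k \<omega> else 0) = 0"
    and gint: "integrable M (\<lambda>\<omega>. if ?H k \<omega> then N (Suc k) \<omega> - N k \<omega> else 0)" for k
  proof -
    define A where "A = {\<omega>\<in>space M. ?H k \<omega>}"
    have AF: "A \<in> sets (F (real k * h))"
      using Hp[of k] h space_F[of "real k * h"] by (simp add: A_def pred_def)
    have AF': "A \<in> sets (F (real (Suc k) * h))"
      using AF F_mono[of "real k * h" "real (Suc k) * h"] h by (auto simp: distrib_right)
    have AM [measurable]: "A \<in> sets M" unfolding A_def by measurable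
    have int: "integrable M (\<lambda>\<omega>. indicator A \<omega> * N i \<omega>)" for i
      using integrable_mult_indicator[OF AM Nint[of i]] by simp
    have "expectation (\<lambda>\<omega>. indicator A \<omega> * N i \<omega>) = enn2real (\<integral>\<^sup>+\<omega>. indicator A \<omega> * ennreal (N i \<omega>) \<partial>M)" for i
    proof -
      have "expectation (\<lambda>\<omega>. indicator A \<omega> * N i \<omega>) = enn2real (\<integral>\<^sup>+\<omega>. ennreal (indicator A \<omega> * N i \<omega>) \<partial>M)"
        by (rule integral_eq_nn_integral) (auto simp: N0)
      also have "(\<integral>\<^sup>+\<omega>. ennreal (indicator A \<omega> * N i \<omega>) \<partial>M) = (\<integral>\<^sup>+\<omega>. indicator A \<omega> * ennreal (N i \<omega>) \<partial>M)"
        by (intro nn_integral_cong) (auto simp: indicator_def)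
      finally show ?thesis .
    qed
    then have eq: "expectation (\<lambda>\<omega>. indicator A \<omega> * N (Suc k) \<omega>) = expectation (\<lambda>\<omega>. indicator A \<omega> * N k \<omega>)"
      using test[of "indicator A" k] test[of "indicator A" "Suc k"] AF AF' by simp
    have cong: "(if ?H k \<omega> then N (Suc k) \<omega> - N k \<omega> else 0) = indicator A \<omega> * N (Suc k) \<omega> - indicator A \<omega> * N k \<omega>"
      if "\<omega> \<in> space M" for \<omega> using that by (auto simp: A_def)
    have "integrable M (\<lambda>\<omega>. indicator A \<omega> * N (Suc k) \<omega> - indicator A \<omega> * N k \<omega>)"
      by (intro Bochner_Integration.integrable_diff int)
    then show "integrable M (\<lambda>\<omega>. if ?H k \<omega> then N (Suc k) \<omega> - N k \<omega> else 0)"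
      by (subst Bochner_Integration.integrable_cong[OF refl cong])
    have "expectation (\<lambda>\<omega>. if ?H k \<omega> then N (Suc k) \<omega> - N k \<omega> else 0)
      = expectation (\<lambda>\<omega>. indicator A \<omega> * N (Suc k) \<omega> - indicator A \<omega> * N k \<omega>)"
      by (rule Bochner_Integration.integral_cong[OF refl cong])
    also have "\<dots> = 0" using eq by (simp add: Bochner_Integration.integral_diff int)
    finally show "expectation (\<lambda>\<omega>. if ?H k \<omega> then N (Suc k) \<omega> - N k \<omega> else 0) = 0" .
  qed
  let ?U = "\<lambda>n \<omega>. real (upcrossings a b (\<lambda>i. N i \<omega>) n)"
  have Um: "?U n \<in> borel_measurable M" for n
  proof (induction n)
    case (Suc n)
    note [measurable] = Suc
    have "(\<lambda>\<omega>. ?U n \<omega> + (if ?H n \<omega> \<and> b \<le> N (Suc n) \<omega> then 1 else 0)) \<in> borel_measurable M" by measurable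
    moreover have "?U (Suc n) \<omega> = ?U n \<omega> + (if ?H n \<omega> \<and> b \<le> N (Suc n) \<omega> then 1 else 0)" for \<omega> by simp
    ultimately show ?case by simp
  qed simp
  have Ule: "upcrossings a b f n \<le> n" for f n by (induction n) auto
  have Uint: "integrable M (?U n)"
    by (rule integrable_const_bound[where B="real n"]) (use Ule Um in auto)
  then show "integrable M (\<lambda>\<omega>. real (upcrossings a b (\<lambda>i. cond_mart \<xi> (real i * h) \<omega>) n))"
    by (simp add: N_def)
  have "(b - a) * expectation (?U n) - a = expectation (\<lambda>\<omega>. (b - a) * ?U n \<omega> - a)"
    using Uint by (simp add: Bochner_Integration.integral_diff prob_space)
  also have "\<dots> \<le> expectation (\<lambda>\<omega>. \<Sum>k<n. if ?H k \<omega> then N (Suc k) \<omega> - N k \<omega> else 0)"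
  proof (rule integral_mono)
    fix \<omega>
    have "(b - a) * ?U n \<omega> + (if ?H n \<omega> then N n \<omega> - a else 0) \<le> (\<Sum>k<n. if ?H k \<omega> then N (Suc k) \<omega> - N k \<omega> else 0)"
      by (rule upcrossings_gain[OF ab(2)])
    moreover have "- a \<le> (if ?H n \<omega> then N n \<omega> - a else 0)" using N0[of n \<omega>] ab by simp
    ultimately show "(b - a) * ?U n \<omega> - a \<le> (\<Sum>k<n. if ?H k \<omega> then N (Suc k) \<omega> - N k \<omega> else 0)" by linarith
  qed (use Uint gint in auto)
  also have "\<dots> = 0" using gint zero by (simp add: Bochner_Integration.integral_sum)
  finally show "expectation (\<lambda>\<omega>. real (upcrossings a b (\<lambda>i. cond_mart \<xi> (real i * h) \<omega>) n)) \<le> a / (b - a)"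
    using ab by (simp add: N_def field_simps)
qed

text \<open>On a finite grid this is Markov's inequality for the number of upcrossings; the bound
  does not depend on the grid, and continuity from below passes to the union.\<close>

lemma upcross_probability:
  assumes \<xi>: "\<xi> \<in> borel_measurable M" and fin: "(\<integral>\<^sup>+\<omega>. \<xi> \<omega> \<partial>M) < \<infinity>"
    and ab: "0 \<le> a" "a < b" and j: "0 < j"
  shows "{\<omega>\<in>space M. \<exists>t. upcross dyadics a b (\<lambda>t. cond_mart \<xi> t \<omega>) j t} \<in> events"
    and "prob {\<omega>\<in>space M. \<exists>t. upcross dyadics a b (\<lambda>t. cond_mart \<xi> t \<omega>) j t} \<le> a / ((b - a) * real j)"
proof -
  let ?N = "\<lambda>\<omega> t. cond_mart \<xi> t \<omega>"
  \<comment> \<open>The time bound \<open>2 ^ k\<close> is the horizon of the grid; it grows with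
    \<open>k\<close>, so the union of the events covers every \<open>t\<close>.\<close>
  define E where "E k = {\<omega>\<in>space M. upcross (dyadic_grid k) a b (?N \<omega>) j (2 ^ k)}" for k
  have Em [measurable]: "E k \<in> events" for k
  proof -
    have "Measurable.pred M (\<lambda>\<omega>. upcross (dyadic_grid k) a b (?N \<omega>) j (2 ^ k))"
      by (rule upcross_pred) (auto simp: dyadic_grid_def intro!: cond_mart_measurable)
    then show ?thesis unfolding E_def pred_def .
  qed
  have E_inc: "incseq E"
  proof (rule incseq_SucI)
    fix k
    have "upcross (dyadic_grid (Suc k)) a b f j (2 ^ Suc k)" if "upcross (dyadic_grid k) a b f j (2 ^ k)" for f
      using upcross_mono[OF upcross_mono_set[OF that incseq_SucD[OF dyadic_grid_incseq]], of "2 ^ Suc k"] by simp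
    then show "E k \<subseteq> E (Suc k)" by (auto simp: E_def)
  qed
  have EU: "{\<omega>\<in>space M. \<exists>t. upcross dyadics a b (?N \<omega>) j t} = (\<Union>k. E k)"
  proof (intro equalityI subsetI)
    fix \<omega> assume "\<omega> \<in> {\<omega>\<in>space M. \<exists>t. upcross dyadics a b (?N \<omega>) j t}"
    then obtain t where w: "\<omega> \<in> space M" and "upcross dyadics a b (?N \<omega>) j t" by auto
    then obtain k where k: "upcross (dyadic_grid k) a b (?N \<omega>) j t"
      using upcross_incseq_Union[OF dyadic_grid_incseq] unfolding dyadics_def by blast
    obtain k' :: nat where k': "t < 2 ^ k'" using real_arch_pow[of 2 t] by auto
    define m where "m = max k k'"
    have "(2::real) ^ k' \<le> 2 ^ m" by (rule power_increasing) (auto simp: m_def)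
    moreover have "upcross (dyadic_grid m) a b (?N \<omega>) j t"
      by (rule upcross_mono_set[OF k incseqD[OF dyadic_grid_incseq]]) (simp add: m_def)
    ultimately have "upcross (dyadic_grid m) a b (?N \<omega>) j (2 ^ m)"
      using upcross_mono[of "dyadic_grid m" a b "?N \<omega>" j t "2 ^ m"] k' by linarith
    then show "\<omega> \<in> (\<Union>k. E k)" using w by (auto simp: E_def)
  next
    fix \<omega> assume "\<omega> \<in> (\<Union>k. E k)"
    then show "\<omega> \<in> {\<omega>\<in>space M. \<exists>t. upcross dyadics a b (?N \<omega>) j t}"
      by (auto simp: E_def dyadics_def intro: upcross_mono_set)
  qed
  then show "{\<omega>\<in>space M. \<exists>t. upcross dyadics a b (?N \<omega>) j t} \<in> events" by simp
  have "prob (E k) \<le> a / ((b - a) * real j)" for k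
  proof -
    let ?U = "\<lambda>\<omega>. real (upcrossings a b (\<lambda>i. ?N \<omega> (real i * (1 / 2 ^ k))) (4 ^ k))"
    have "0 < (1 / 2 ^ k :: real)" by simp
    note Ue = upcrossings_expectation[OF \<xi> fin this ab, of "4 ^ k"]
    have e: "real ((4::nat) ^ k) * (1 / 2 ^ k) = 2 ^ k"
    proof -
      have "(4::real) ^ k = 2 ^ k * 2 ^ k" by (simp flip: power_mult_distrib)
      then show ?thesis by simp
    qed
    have "E k \<subseteq> {\<omega>\<in>space M. real j \<le> ?U \<omega>}"
    proof
      fix \<omega> assume "\<omega> \<in> E k"
      then have "\<omega> \<in> space M" "j \<le> upcrossings a b (\<lambda>i. ?N \<omega> (real i * (1 / 2 ^ k))) (4 ^ k)"
        using upcross_le_upcrossings[OF ab(2), of "1 / 2 ^ k" "4 ^ k" "?N \<omega>" j "4 ^ k"] unfolding e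
        by (auto simp: E_def dyadic_grid_def)
      then show "\<omega> \<in> {\<omega>\<in>space M. real j \<le> ?U \<omega>}" by simp
    qed
    moreover have "{\<omega>\<in>space M. real j \<le> ?U \<omega>} \<in> events"
      by (rule borel_measurable_le[OF borel_measurable_const borel_measurable_integrable[OF Ue(1)]])
    ultimately have "prob (E k) \<le> prob {\<omega>\<in>space M. real j \<le> ?U \<omega>}" by (intro finite_measure_mono)
    also have "\<dots> \<le> expectation ?U / real j"
      using Ue(1) j by (intro integral_Markov_inequality_measure[where A="{}"]) auto
    also have "\<dots> \<le> (a / (b - a)) / real j" using Ue(2) by (intro divide_right_mono) auto
    finally show ?thesis by simp
  qed
  then have "prob (\<Union>k. E k) \<le> a / ((b - a) * real j)"
    by (intro LIMSEQ_le_const2[OF finite_Lim_measure_incseq[OF _ E_inc]]) auto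
  then show "prob {\<omega>\<in>space M. \<exists>t. upcross dyadics a b (?N \<omega>) j t} \<le> a / ((b - a) * real j)"
    unfolding EU .
qed

text \<open>For fixed rational levels the probability of \<open>j\<close> upcrossings is of order
  \<open>1 / j\<close>, so almost surely their number is finite; countably many pairs of levels
  share one null set.\<close>

lemma AE_regular_on_dyadics:
  assumes \<xi>: "\<xi> \<in> borel_measurable M" and fin: "(\<integral>\<^sup>+\<omega>. \<xi> \<omega> \<partial>M) < \<infinity>"
  shows "AE \<omega> in M. \<exists>B. regular_on_dyadics (\<lambda>t. cond_mart \<xi> t \<omega>) B"
proof -
  let ?N = "\<lambda>\<omega> t. cond_mart \<xi> t \<omega>"
  have small: "AE \<omega> in M. \<exists>k::nat. \<omega> \<notin> G k"
    if Gm: "\<And>k. G k \<in> events" and Gl: "\<And>k. prob (G k) \<le> r k" and r: "r \<longlonglongrightarrow> 0" for G :: "nat \<Rightarrow> 'a set" and r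
  proof -
    have "prob (\<Inter>k. G k) \<le> r k" for k
      by (rule order_trans[OF finite_measure_mono Gl[of k]]) (auto intro: Gm)
    then have "prob (\<Inter>k. G k) \<le> 0" by (intro LIMSEQ_le_const[OF r]) auto
    then have "(\<Inter>k. G k) \<in> null_sets M"
      using Gm by (simp add: null_sets_def emeasure_eq_measure measure_le_0_iff sets.countable_INT')
    from AE_not_in[OF this] show ?thesis by simp
  qed
  have up: "AE \<omega> in M. \<forall>p q :: rat. 0 \<le> p \<longrightarrow> p < q \<longrightarrow> (\<exists>j. \<forall>t. \<not> upcross dyadics (of_rat p) (of_rat q) (?N \<omega>) j t)"
    unfolding AE_all_countable
  proof (intro allI AE_impI)
    fix p q :: rat assume pq: "0 \<le> p" "p < q"
    define a b where "a = real_of_rat p" and "b = real_of_rat q"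
    have ab: "0 \<le> a" "a < b" using pq by (auto simp: a_def b_def of_rat_less)
    note P = upcross_probability[OF \<xi> fin ab]
    have "AE \<omega> in M. \<exists>k. \<omega> \<notin> {\<omega>\<in>space M. \<exists>t. upcross dyadics a b (?N \<omega>) (Suc k) t}"
    proof (rule small)
      show "(\<lambda>k. a / ((b - a) * real (Suc k))) \<longlonglongrightarrow> 0" using ab by real_asymp
    qed (rule P, simp)+
    then show "AE \<omega> in M. \<exists>j. \<forall>t. \<not> upcross dyadics (of_rat p) (of_rat q) (?N \<omega>) j t"
      using AE_space unfolding a_def b_def by eventually_elim blast
  qed
  \<comment> \<open>Boundedness from a single upcrossing: if the path starts no higher than
    \<open>a\<close>, a value of at least \<open>a + k + 1\<close> completes an upcrossing begun at
    time 0, an event of probability at most \<open>a / (k + 1)\<close>.\<close>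
  have bd: "AE \<omega> in M. \<forall>a::nat. \<exists>k. \<forall>t. \<not> upcross dyadics (real a) (real (a + Suc k)) (?N \<omega>) 1 t"
    unfolding AE_all_countable
  proof
    fix a :: nat
    note P = upcross_probability[OF \<xi> fin, of "real a" "real (a + Suc k)" 1 for k]
    have "AE \<omega> in M. \<exists>k. \<omega> \<notin> {\<omega>\<in>space M. \<exists>t. upcross dyadics (real a) (real (a + Suc k)) (?N \<omega>) 1 t}"
    proof (rule small)
      show "(\<lambda>k. real a / ((real (a + Suc k) - real a) * real 1)) \<longlonglongrightarrow> 0" by simp real_asymp
    qed (rule P, simp, simp, simp)+
    then show "AE \<omega> in M. \<exists>k. \<forall>t. \<not> upcross dyadics (real a) (real (a + Suc k)) (?N \<omega>) 1 t"
      using AE_space by eventually_elim blast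
  qed
  from up bd show ?thesis
  proof eventually_elim
    case (elim \<omega>)
    have z: "0 \<in> dyadics" using dyadics_I[of 0 0] by simp
    obtain a :: nat where a: "?N \<omega> 0 \<le> real a" using real_arch_simple by blast
    obtain k where k: "\<And>t. \<not> upcross dyadics (real a) (real (a + Suc k)) (?N \<omega>) 1 t" using elim(2) by blast
    have "?N \<omega> d \<le> real (a + Suc k)" if d: "d \<in> dyadics" for d
    proof (cases "d = 0")
      case True then show ?thesis using a by simp
    next
      case False
      then have "0 < d" using dyadics_nonneg[OF d] by simp
      then show ?thesis using k[of d] d z a by (force simp: not_le[symmetric])
    qed
    then have "regular_on_dyadics (?N \<omega>) (real (a + Suc k))"
      using elim(1) by unfold_locales (auto simp: cond_mart_nonneg)
    then show ?case by blast
  qed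
qed

end

context filtered_space
begin

text \<open>Completeness: a property that holds almost surely defines a set known at time 0, so a
  process may be redefined off it and stays adapted.\<close>

lemma AE_F0:
  assumes "AE \<omega> in M. P \<omega>"
  shows "{\<omega>\<in>space M. P \<omega>} \<in> sets (F 0)"
proof -
  obtain B where "B \<in> null_sets M" "{\<omega>\<in>space M. \<not> P \<omega>} \<subseteq> B"
    using assms by (auto simp: eventually_ae_filter)
  then have "{\<omega>\<in>space M. \<not> P \<omega>} \<in> sets (F 0)" by (rule null_F)
  then have "space (F 0) - {\<omega>\<in>space M. \<not> P \<omega>} \<in> sets (F 0)" by (rule sets.compl_sets)
  moreover have "space (F 0) - {\<omega>\<in>space M. \<not> P \<omega>} = {\<omega>\<in>space M. P \<omega>}" by (auto simp: space_F)
  ultimately show ?thesis by simp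
qed

lemma F0_subset: "0 \<le> t \<Longrightarrow> A \<in> sets (F 0) \<Longrightarrow> A \<in> sets (F t)"
  using F_mono[of 0 t] by auto

lemma measurable_F_right:
  assumes t: "0 \<le> t" and f: "\<And>s. t < s \<Longrightarrow> f \<in> measurable (F s) N"
  shows "f \<in> measurable (F t) N"
proof (rule measurableI)
  have sp: "space (F s) = space M" if "t \<le> s" for s using space_F[of s] t that by simp
  show "f x \<in> space N" if "x \<in> space (F t)" for x
    using measurable_space[OF f[of "t + 1"], of x] that sp[of t] sp[of "t + 1"] by simp
  fix A assume "A \<in> sets N"
  then have "f -` A \<inter> space M \<in> sets (F s)" if "t < s" for s
    using measurable_sets[OF f[OF that], of A] sp[of s] that by simp
  then show "f -` A \<inter> space (F t) \<in> sets (F t)"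
    unfolding F_right[OF t] by (simp add: sp)
qed

text \<open>The regularised martingale is bounded above by Fatou's lemma; the reverse bound follows
  from the martingales of the truncations \<open>min \<xi> m\<close>.\<close>

lemma cadlag_martingale:
  assumes \<xi>: "\<xi> \<in> borel_measurable M" and fin: "(\<integral>\<^sup>+\<omega>. \<xi> \<omega> \<partial>M) < \<infinity>"
  obtains N where "\<And>t. 0 \<le> t \<Longrightarrow> N t \<in> borel_measurable (F t)"
    and "\<And>\<omega>. \<omega> \<in> space M \<Longrightarrow> cadlag_path (\<lambda>t. N t \<omega>)"
    and "\<And>t \<omega>. 0 \<le> t \<Longrightarrow> \<omega> \<in> space M \<Longrightarrow> 0 \<le> N t \<omega>"
    and "\<And>t (g :: 'a \<Rightarrow> ennreal). 0 \<le> t \<Longrightarrow> g \<in> borel_measurable (F t) \<Longrightarrow>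
      (\<integral>\<^sup>+\<omega>. g \<omega> * ennreal (N t \<omega>) \<partial>M) = (\<integral>\<^sup>+\<omega>. g \<omega> * \<xi> \<omega> \<partial>M)"
proof -
  let ?m = "cond_mart \<xi>"
  define G where "G = {\<omega>\<in>space M. \<exists>B. regular_on_dyadics (\<lambda>t. ?m t \<omega>) B}"
  have G0: "G \<in> sets (F 0)" unfolding G_def by (rule AE_F0[OF AE_regular_on_dyadics[OF \<xi> fin]])
  have AEG: "AE \<omega> in M. \<omega> \<in> G"
    using AE_regular_on_dyadics[OF \<xi> fin] AE_space unfolding G_def by eventually_elim simp
  \<comment> \<open>Off the set \<open>G\<close> of regular paths, which is known at time 0, the
    process is set to zero; it stays adapted and every path is cadlag.\<close>
  define N where "N t \<omega> = (if \<omega> \<in> G then lim (\<lambda>n. ?m (dyadic_above n t) \<omega>) else 0)" for t \<omega>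
  have lim: "(\<lambda>n. indicator G \<omega> * ?m (dyadic_above n t) \<omega>) \<longlonglongrightarrow> N t \<omega>" if t: "0 \<le> t" for t \<omega>
  proof (cases "\<omega> \<in> G")
    case True
    then obtain B where "regular_on_dyadics (\<lambda>t. ?m t \<omega>) B" by (auto simp: G_def)
    then interpret r: regular_on_dyadics "\<lambda>t. ?m t \<omega>" B .
    show ?thesis using r.tendsto_right_lim(2)[OF t] True by (simp add: N_def r.right_lim_def)
  qed (simp add: N_def)
  have N0: "0 \<le> N t \<omega>" if "0 \<le> t" for t \<omega>
    by (rule LIMSEQ_le_const[OF lim[OF that]]) (auto intro!: mult_nonneg_nonneg cond_mart_nonneg)
  \<comment> \<open>\<open>N t\<close> is a limit of variables observed strictly after
    \<open>t\<close>, hence measurable for every later \<open>F s\<close>; right-continuity of the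
    filtration brings this down to \<open>F t\<close>.\<close>
  have ad: "N t \<in> borel_measurable (F t)" if t: "0 \<le> t" for t
  proof (rule measurable_F_right[OF t])
    fix s assume s: "t < s"
    have "\<forall>\<^sub>F n in sequentially. dyadic_above n t < s" using order_tendstoD(2)[OF dyadic_above_tendsto s] .
    then obtain n0 where n0: "\<And>n. n0 \<le> n \<Longrightarrow> dyadic_above n t < s" by (auto simp: eventually_sequentially)
    have [measurable]: "G \<in> sets (F s)" using F0_subset[OF _ G0] t s by simp
    have [measurable]: "?m (dyadic_above (n + n0) t) \<in> borel_measurable (F s)" for n
      using n0[of "n + n0"] dyadic_above_gt[of t "n + n0"] t
      by (intro measurable_F_mono[OF cond_mart_adapted]) auto
    show "N t \<in> borel_measurable (F s)"
      by (rule borel_measurable_LIMSEQ_real[OF LIMSEQ_ignore_initial_segment[OF lim[OF t], where k=n0]]) measurable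
  qed
  have cad: "cadlag_path (\<lambda>t. N t \<omega>)" for \<omega>
  proof (cases "\<omega> \<in> G")
    case True
    then obtain B where "regular_on_dyadics (\<lambda>t. ?m t \<omega>) B" by (auto simp: G_def)
    then interpret r: regular_on_dyadics "\<lambda>t. ?m t \<omega>" B .
    have "(\<lambda>t. N t \<omega>) = r.right_lim" using True by (auto simp: N_def r.right_lim_def)
    then show ?thesis using r.cadlag_right_lim by simp
  next
    case False
    then show ?thesis by (auto simp: N_def cadlag_path_def)
  qed
  have AElim: "AE \<omega> in M. (\<lambda>n. ?m (dyadic_above n t) \<omega>) \<longlonglongrightarrow> N t \<omega>" if t: "0 \<le> t" for t
    using AEG
  proof eventually_elim
    case (elim \<omega>)
    then show ?case using lim[OF t, of \<omega>] by simp
  qed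
  have eq: "AE \<omega> in M. ennreal (N t \<omega>) = ennreal (?m t \<omega>)" if t: "0 \<le> t" for t
  proof -
    note Nm [measurable] = ad[OF t] measurable_F_M[OF ad[OF t] t]
    have d0: "0 \<le> dyadic_above n t" "t \<le> dyadic_above n t" for n using dyadic_above_gt[of t n] t by auto
    have mm [measurable]: "?m (dyadic_above n t) \<in> borel_measurable M" for n
      by (intro cond_mart_measurable d0)
    have gd: "indicator A \<in> borel_measurable (F (dyadic_above n t))" if "A \<in> sets (F t)" for A n
      using that F_mono[OF t d0(2)[of n]] by auto
    have fin_m: "(\<integral>\<^sup>+\<omega>. ennreal (?m t \<omega>) \<partial>M) < \<infinity>"
      using cond_mart_test[OF \<xi> fin t, of "\<lambda>_. 1"] fin by simp
    have le: "(\<integral>\<^sup>+\<omega>. indicator A \<omega> * ennreal (N t \<omega>) \<partial>M) \<le> (\<integral>\<^sup>+\<omega>. indicator A \<omega> * \<xi> \<omega> \<partial>M)" if A: "A \<in> sets (F t)" for A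
    proof -
      have [measurable]: "A \<in> events" using A subalgebra_F[OF t] by (auto simp: subalgebra_def)
      have "(\<integral>\<^sup>+\<omega>. indicator A \<omega> * ennreal (N t \<omega>) \<partial>M) = (\<integral>\<^sup>+\<omega>. liminf (\<lambda>n. indicator A \<omega> * ennreal (?m (dyadic_above n t) \<omega>)) \<partial>M)"
      proof (rule nn_integral_cong_AE)
        show "AE \<omega> in M. indicator A \<omega> * ennreal (N t \<omega>) = liminf (\<lambda>n. indicator A \<omega> * ennreal (?m (dyadic_above n t) \<omega>))"
          using AElim[OF t]
        proof eventually_elim
          case (elim \<omega>)
          then have "(\<lambda>n. ennreal (?m (dyadic_above n t) \<omega>)) \<longlonglongrightarrow> ennreal (N t \<omega>)" by (rule tendsto_ennrealI)
          then have "(\<lambda>n. indicator A \<omega> * ennreal (?m (dyadic_above n t) \<omega>)) \<longlonglongrightarrow> indicator A \<omega> * ennreal (N t \<omega>)"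
            by (intro ennreal_tendsto_cmult) (simp_all add: indicator_def)
          then show ?case by (rule lim_imp_Liminf[OF sequentially_bot, symmetric])
        qed
      qed
      also have "\<dots> \<le> liminf (\<lambda>n. \<integral>\<^sup>+\<omega>. indicator A \<omega> * ennreal (?m (dyadic_above n t) \<omega>) \<partial>M)"
        by (rule nn_integral_liminf) measurable
      also have "\<dots> = liminf (\<lambda>n::nat. \<integral>\<^sup>+\<omega>. indicator A \<omega> * \<xi> \<omega> \<partial>M)"
        using cond_mart_test[OF \<xi> fin d0(1) gd[OF A]] by simp
      also have "\<dots> = (\<integral>\<^sup>+\<omega>. indicator A \<omega> * \<xi> \<omega> \<partial>M)" by (simp add: Liminf_const)
      finally show ?thesis .
    qed
    have ge: "(\<integral>\<^sup>+\<omega>. indicator A \<omega> * \<xi> \<omega> \<partial>M) \<le> (\<integral>\<^sup>+\<omega>. indicator A \<omega> * ennreal (N t \<omega>) \<partial>M)" if A: "A \<in> sets (F t)" for A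
    proof -
      have [measurable]: "A \<in> events" using A subalgebra_F[OF t] by (auto simp: subalgebra_def)
      note [measurable] = \<xi>
      define \<xi>m where "\<xi>m k \<omega> = min (\<xi> \<omega>) (of_nat k)" for k :: nat and \<omega>
      have \<xi>mm [measurable]: "\<xi>m k \<in> borel_measurable M" for k unfolding \<xi>m_def by measurable
      have trunc: "(\<integral>\<^sup>+\<omega>. indicator A \<omega> * \<xi>m k \<omega> \<partial>M) \<le> (\<integral>\<^sup>+\<omega>. indicator A \<omega> * ennreal (N t \<omega>) \<partial>M)" for k
      proof -
        have "(\<integral>\<^sup>+\<omega>. \<xi>m k \<omega> \<partial>M) \<le> (\<integral>\<^sup>+\<omega>. \<xi> \<omega> \<partial>M)"
          by (intro nn_integral_mono) (simp add: \<xi>m_def)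
        then have finm: "(\<integral>\<^sup>+\<omega>. \<xi>m k \<omega> \<partial>M) < \<infinity>" using fin by (rule le_less_trans)
        \<comment> \<open>The truncated variable is at most \<open>\<xi>\<close> and at most
          \<open>k\<close>, and both bounds survive conditioning; the limit is then taken along
          \<open>?m\<close> alone.\<close>
        have mle: "AE \<omega> in M. ennreal (cond_mart (\<xi>m k) s \<omega>) \<le> min (ennreal (?m s \<omega>)) (of_nat k)" if s: "0 \<le> s" for s
        proof -
          note tests = cond_mart_test[OF \<xi>mm finm s]
          have gs: "indicator B \<in> borel_measurable (F s)" "B \<in> events" if "B \<in> sets (F s)" for B
            using that subalgebra_F[OF s] by (auto simp: subalgebra_def)
          note [measurable] = cond_mart_adapted[of _ s]
          have finc: "(\<integral>\<^sup>+\<omega>. ennreal (cond_mart (\<xi>m k) s \<omega>) \<partial>M) < \<infinity>" using tests[of "\<lambda>_. 1"] finm by simp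
          have "AE \<omega> in M. ennreal (cond_mart (\<xi>m k) s \<omega>) \<le> ennreal (?m s \<omega>)"
          proof (rule AE_le_of_nn_integral_le[OF subalgebra_F[OF s] _ _ finc])
            fix B assume B: "B \<in> sets (F s)"
            show "(\<integral>\<^sup>+\<omega>. indicator B \<omega> * ennreal (cond_mart (\<xi>m k) s \<omega>) \<partial>M) \<le> (\<integral>\<^sup>+\<omega>. indicator B \<omega> * ennreal (?m s \<omega>) \<partial>M)"
              unfolding tests[OF gs(1)[OF B]] cond_mart_test[OF \<xi> fin s gs(1)[OF B]]
              by (intro nn_integral_mono mult_left_mono) (auto simp: \<xi>m_def)
          qed measurable
          moreover have "AE \<omega> in M. ennreal (cond_mart (\<xi>m k) s \<omega>) \<le> of_nat k"
          proof (rule AE_le_of_nn_integral_le[OF subalgebra_F[OF s] _ _ finc])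
            fix B assume B: "B \<in> sets (F s)"
            show "(\<integral>\<^sup>+\<omega>. indicator B \<omega> * ennreal (cond_mart (\<xi>m k) s \<omega>) \<partial>M) \<le> (\<integral>\<^sup>+\<omega>. indicator B \<omega> * of_nat k \<partial>M)"
              unfolding tests[OF gs(1)[OF B]]
              by (intro nn_integral_mono mult_left_mono) (auto simp: \<xi>m_def)
          qed measurable
          ultimately show ?thesis by eventually_elim simp
        qed
        \<comment> \<open>Cut off at \<open>k\<close> the variables are bounded, so dominated
          convergence takes the place of Fatou's lemma and no mass is lost in the limit.\<close>
        have "(\<lambda>n. \<integral>\<^sup>+\<omega>. indicator A \<omega> * min (ennreal (?m (dyadic_above n t) \<omega>)) (of_nat k) \<partial>M)
            \<longlonglongrightarrow> (\<integral>\<^sup>+\<omega>. indicator A \<omega> * min (ennreal (N t \<omega>)) (of_nat k) \<partial>M)"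
        proof (rule nn_integral_dominated_convergence[where w="\<lambda>_. of_nat k"])
          show "AE \<omega> in M. (\<lambda>n. indicator A \<omega> * min (ennreal (?m (dyadic_above n t) \<omega>)) (of_nat k)) \<longlonglongrightarrow> indicator A \<omega> * min (ennreal (N t \<omega>)) (of_nat k)"
            using AElim[OF t]
          proof eventually_elim
            case (elim \<omega>)
            then have "(\<lambda>n. ennreal (?m (dyadic_above n t) \<omega>)) \<longlonglongrightarrow> ennreal (N t \<omega>)" by (rule tendsto_ennrealI)
            then have "(\<lambda>n. min (ennreal (?m (dyadic_above n t) \<omega>)) (of_nat k)) \<longlonglongrightarrow> min (ennreal (N t \<omega>)) (of_nat k)"
              by (intro tendsto_min tendsto_const)
            then show ?case by (intro ennreal_tendsto_cmult) (simp_all add: indicator_def)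
          qed
        qed (auto simp: indicator_def emeasure_space_1 ennreal_mult_less_top of_nat_less_top)
        moreover have "(\<integral>\<^sup>+\<omega>. indicator A \<omega> * \<xi>m k \<omega> \<partial>M) \<le> (\<integral>\<^sup>+\<omega>. indicator A \<omega> * min (ennreal (?m (dyadic_above n t) \<omega>)) (of_nat k) \<partial>M)" for n
        proof -
          have "(\<integral>\<^sup>+\<omega>. indicator A \<omega> * \<xi>m k \<omega> \<partial>M) = (\<integral>\<^sup>+\<omega>. indicator A \<omega> * ennreal (cond_mart (\<xi>m k) (dyadic_above n t) \<omega>) \<partial>M)"
            by (rule cond_mart_test[OF \<xi>mm finm d0(1) gd[OF A], symmetric])
          also have "\<dots> \<le> (\<integral>\<^sup>+\<omega>. indicator A \<omega> * min (ennreal (?m (dyadic_above n t) \<omega>)) (of_nat k) \<partial>M)"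
          proof (rule nn_integral_mono_AE)
            show "AE \<omega> in M. indicator A \<omega> * ennreal (cond_mart (\<xi>m k) (dyadic_above n t) \<omega>)
                \<le> indicator A \<omega> * min (ennreal (?m (dyadic_above n t) \<omega>)) (of_nat k)"
              using mle[OF d0(1)[of n]] by eventually_elim (rule mult_left_mono, simp_all)
          qed
          finally show ?thesis .
        qed
        ultimately have "(\<integral>\<^sup>+\<omega>. indicator A \<omega> * \<xi>m k \<omega> \<partial>M) \<le> (\<integral>\<^sup>+\<omega>. indicator A \<omega> * min (ennreal (N t \<omega>)) (of_nat k) \<partial>M)"
          by (intro LIMSEQ_le_const) auto
        also have "\<dots> \<le> (\<integral>\<^sup>+\<omega>. indicator A \<omega> * ennreal (N t \<omega>) \<partial>M)"
          by (intro nn_integral_mono mult_left_mono) auto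
        finally show ?thesis .
      qed
      have "(\<integral>\<^sup>+\<omega>. indicator A \<omega> * \<xi> \<omega> \<partial>M) = (\<integral>\<^sup>+\<omega>. (SUP k. indicator A \<omega> * \<xi>m k \<omega>) \<partial>M)"
      proof (rule nn_integral_cong)
        fix \<omega>
        have "(SUP k. \<xi>m k \<omega>) = \<xi> \<omega>"
        proof -
          have "(SUP k. \<xi>m k \<omega>) = inf (\<xi> \<omega>) (SUP k::nat. of_nat k)"
            unfolding \<xi>m_def inf_min[symmetric] by (rule inf_SUP[symmetric])
          then show ?thesis by (simp add: ennreal_SUP_of_nat_eq_top)
        qed
        then show "indicator A \<omega> * \<xi> \<omega> = (SUP k. indicator A \<omega> * \<xi>m k \<omega>)"
          by (simp add: SUP_mult_left_ennreal[symmetric])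
      qed
      also have "\<dots> = (SUP k. \<integral>\<^sup>+\<omega>. indicator A \<omega> * \<xi>m k \<omega> \<partial>M)"
      proof (rule nn_integral_monotone_convergence_SUP)
        show "incseq (\<lambda>k \<omega>. indicator A \<omega> * \<xi>m k \<omega>)"
          by (intro incseq_SucI le_funI mult_left_mono) (auto simp: \<xi>m_def min_le_iff_disj intro!: min.mono)
      qed measurable
      also have "\<dots> \<le> (\<integral>\<^sup>+\<omega>. indicator A \<omega> * ennreal (N t \<omega>) \<partial>M)" by (rule SUP_least) (rule trunc)
      finally show ?thesis .
    qed
    note [measurable] = cond_mart_adapted[of _ t]
    have gt: "indicator B \<in> borel_measurable (F t)" if "B \<in> sets (F t)" for B using that by auto
    have finN: "(\<integral>\<^sup>+\<omega>. ennreal (N t \<omega>) \<partial>M) < \<infinity>"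
    proof -
      have "(\<integral>\<^sup>+\<omega>. ennreal (N t \<omega>) \<partial>M) = (\<integral>\<^sup>+\<omega>. indicator (space M) \<omega> * ennreal (N t \<omega>) \<partial>M)"
        by (intro nn_integral_cong) (simp add: indicator_def)
      also have "\<dots> \<le> (\<integral>\<^sup>+\<omega>. indicator (space M) \<omega> * \<xi> \<omega> \<partial>M)" by (rule le) (metis sets.top space_F[OF t])
      also have "\<dots> = (\<integral>\<^sup>+\<omega>. \<xi> \<omega> \<partial>M)" by (intro nn_integral_cong) (simp add: indicator_def)
      finally show ?thesis using fin by (rule le_less_trans)
    qed
    have "AE \<omega> in M. ennreal (N t \<omega>) \<le> ennreal (?m t \<omega>)"
      by (rule AE_le_of_nn_integral_le[OF subalgebra_F[OF t] _ _ finN])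
        (measurable, use le in \<open>simp add: cond_mart_test[OF \<xi> fin t gt]\<close>)
    moreover have "AE \<omega> in M. ennreal (?m t \<omega>) \<le> ennreal (N t \<omega>)"
      by (rule AE_le_of_nn_integral_le[OF subalgebra_F[OF t] _ _ fin_m])
        (measurable, use ge in \<open>simp add: cond_mart_test[OF \<xi> fin t gt]\<close>)
    ultimately show ?thesis by eventually_elim simp
  qed
  show thesis
  proof (rule that[of N])
    fix t and g :: "'a \<Rightarrow> ennreal" assume t: "0 \<le> t" and g: "g \<in> borel_measurable (F t)"
    have "(\<integral>\<^sup>+\<omega>. g \<omega> * ennreal (N t \<omega>) \<partial>M) = (\<integral>\<^sup>+\<omega>. g \<omega> * ennreal (?m t \<omega>) \<partial>M)"
      using eq[OF t] by (intro nn_integral_cong_AE) (auto elim!: eventually_mono)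
    also have "\<dots> = (\<integral>\<^sup>+\<omega>. g \<omega> * \<xi> \<omega> \<partial>M)" by (rule cond_mart_test[OF \<xi> fin t g])
    finally show "(\<integral>\<^sup>+\<omega>. g \<omega> * ennreal (N t \<omega>) \<partial>M) = (\<integral>\<^sup>+\<omega>. g \<omega> * \<xi> \<omega> \<partial>M)" .
  qed (use ad cad N0 in auto)
qed

end

section \<open>Continuity of the accrued integral, and cadlag potentials\<close>

lemma continuous_on_nn_integral_Icc:
  fixes f :: "real \<Rightarrow> ennreal"
  assumes [measurable]: "f \<in> borel_measurable borel" and fin: "(\<integral>\<^sup>+s\<in>{0..}. f s \<partial>lborel) < \<infinity>"
  shows "continuous_on {0..} (\<lambda>t. enn2real (\<integral>\<^sup>+s\<in>{0..t}. f s \<partial>lborel))"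
  unfolding continuous_on_sequentially o_def
proof (intro allI ballI impI)
  fix x :: "nat \<Rightarrow> real" and t :: real
  assume t: "t \<in> {0..}" and x: "(\<forall>n. x n \<in> {0..}) \<and> x \<longlonglongrightarrow> t"
  have "(\<lambda>n. \<integral>\<^sup>+s\<in>{0..x n}. f s \<partial>lborel) \<longlonglongrightarrow> (\<integral>\<^sup>+s\<in>{0..t}. f s \<partial>lborel)"
  proof (rule nn_integral_dominated_convergence[where w="\<lambda>s. f s * indicator {0..} s"])
    have "AE s in lborel. s \<noteq> t" by (rule AE_lborel_singleton)
    then show "AE s in lborel. (\<lambda>n. f s * indicator {0..x n} s) \<longlonglongrightarrow> f s * indicator {0..t} s"
    proof eventually_elim
      case (elim s)
      have "\<forall>\<^sub>F n in sequentially. indicator {0..x n} s = (indicator {0..t} s :: ennreal)"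
      proof (cases "s < t")
        case True
        have "\<forall>\<^sub>F n in sequentially. s < x n" using order_tendstoD(1)[OF conjunct2[OF x] True] .
        then show ?thesis by eventually_elim (use True in \<open>auto simp: indicator_def\<close>)
      next
        case False
        then have ts: "t < s" using elim by simp
        have "\<forall>\<^sub>F n in sequentially. x n < s" using order_tendstoD(2)[OF conjunct2[OF x] ts] .
        then show ?thesis by eventually_elim (use ts in \<open>auto simp: indicator_def\<close>)
      qed
      then show ?case by (intro tendsto_eventually) (auto elim: eventually_mono)
    qed
  qed (use fin in \<open>auto simp: indicator_def\<close>)
  moreover have "(\<integral>\<^sup>+s\<in>{0..t}. f s \<partial>lborel) \<le> (\<integral>\<^sup>+s\<in>{0..}. f s \<partial>lborel)"
    by (intro nn_integral_mono) (auto simp: indicator_def)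
  then have "(\<integral>\<^sup>+s\<in>{0..t}. f s \<partial>lborel) = ennreal (enn2real (\<integral>\<^sup>+s\<in>{0..t}. f s \<partial>lborel))"
    using fin by (intro ennreal_enn2real[symmetric]) (simp add: le_less_trans)
  ultimately have "(\<lambda>n. \<integral>\<^sup>+s\<in>{0..x n}. f s \<partial>lborel) \<longlonglongrightarrow> ennreal (enn2real (\<integral>\<^sup>+s\<in>{0..t}. f s \<partial>lborel))" by simp
  then show "(\<lambda>n. enn2real (\<integral>\<^sup>+s\<in>{0..x n}. f s \<partial>lborel)) \<longlonglongrightarrow> enn2real (\<integral>\<^sup>+s\<in>{0..t}. f s \<partial>lborel)"
    by (rule tendsto_enn2real) simp
qed

lemma cadlag_path_continuous_on:
  assumes "continuous_on {0..} g"
  shows "cadlag_path g"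
  unfolding cadlag_path_def
proof (intro allI impI conjI)
  fix t :: real assume "0 \<le> t"
  then have "continuous (at t within {0..}) g" using assms by (simp add: continuous_on_eq_continuous_within)
  then show "continuous (at_right t) g" by (rule continuous_within_subset) (use \<open>0 \<le> t\<close> in auto)
next
  fix t :: real assume "0 < t"
  then have "isCont g t" using assms by (simp add: continuous_on_interior)
  then have "(g \<longlongrightarrow> g t) (at_left t)"
    unfolding isCont_def by (rule tendsto_within_subset) simp
  then show "\<exists>l. (g \<longlongrightarrow> l) (at_left t)" by blast
qed

lemma cadlag_path_diff: "cadlag_path f \<Longrightarrow> cadlag_path g \<Longrightarrow> cadlag_path (\<lambda>t. f t - g t)"
  unfolding cadlag_path_def
proof (intro allI impI conjI)
  fix t :: real
  assume f: "\<forall>t\<ge>0. continuous (at_right t) f \<and> (0 < t \<longrightarrow> (\<exists>l. (f \<longlongrightarrow> l) (at_left t)))"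
    and g: "\<forall>t\<ge>0. continuous (at_right t) g \<and> (0 < t \<longrightarrow> (\<exists>l. (g \<longlongrightarrow> l) (at_left t)))" and t: "0 \<le> t"
  then show "continuous (at_right t) (\<lambda>t. f t - g t)" by (intro continuous_diff) auto
  assume "0 < t"
  then obtain l l' where "(f \<longlongrightarrow> l) (at_left t)" "(g \<longlongrightarrow> l') (at_left t)" using f g t by blast
  then show "\<exists>l. ((\<lambda>t. f t - g t) \<longlongrightarrow> l) (at_left t)" by (blast intro: tendsto_diff)
qed

context filtered_space
begin

text \<open>The version is the regularised martingale of the total integral minus the part accrued
  up to \<open>t\<close>, which is adapted and continuous. Conditioning the tail gives exactly this
  difference.\<close>

lemma cadlag_potential:
  assumes \<phi>: "nonneg_proc \<phi>" and int: "integrable_proc \<phi>"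
  shows "\<exists>W. nonneg_proc W \<and> (\<forall>\<omega>\<in>space M. cadlag_path (\<lambda>t. W t \<omega>)) \<and> potential \<phi> W"
proof -
  have \<phi>p: "prog_meas F \<phi>" using \<phi> by (simp add: nonneg_proc_def)
  let ?\<xi> = "tail_integral \<phi> 0"
  have \<xi>m [measurable]: "?\<xi> \<in> borel_measurable M" by (rule tail_integral_measurable[OF \<phi>p]) simp
  have fin: "(\<integral>\<^sup>+\<omega>. ?\<xi> \<omega> \<partial>M) < \<infinity>" using int by (simp add: integrable_proc_def)
  obtain N where N: "\<And>t. 0 \<le> t \<Longrightarrow> N t \<in> borel_measurable (F t)"
    and Nc: "\<And>\<omega>. \<omega> \<in> space M \<Longrightarrow> cadlag_path (\<lambda>t. N t \<omega>)"
    and N0: "\<And>t \<omega>. 0 \<le> t \<Longrightarrow> \<omega> \<in> space M \<Longrightarrow> 0 \<le> N t \<omega>"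
    and Nt: "\<And>t (g :: 'a \<Rightarrow> ennreal). 0 \<le> t \<Longrightarrow> g \<in> borel_measurable (F t) \<Longrightarrow>
      (\<integral>\<^sup>+\<omega>. g \<omega> * ennreal (N t \<omega>) \<partial>M) = (\<integral>\<^sup>+\<omega>. g \<omega> * ?\<xi> \<omega> \<partial>M)"
    by (rule cadlag_martingale[OF \<xi>m fin]) (rule that; assumption)
  define I where "I t \<omega> = (\<integral>\<^sup>+s\<in>{0..t}. ennreal (\<phi> s \<omega>) \<partial>lborel)" for t \<omega>
  have IF: "I t \<in> borel_measurable (F t)" if t: "0 \<le> t" for t
  proof -
    note [measurable] = prog_meas_joint_F[OF \<phi>p t]
    have "(\<lambda>\<omega>. \<integral>\<^sup>+s. ennreal (\<phi> (max 0 (min s t)) \<omega>) * indicator {0..t} s \<partial>lborel) \<in> borel_measurable (F t)"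
      by measurable
    moreover have "(\<integral>\<^sup>+s. ennreal (\<phi> (max 0 (min s t)) \<omega>) * indicator {0..t} s \<partial>lborel) = I t \<omega>" for \<omega>
      unfolding I_def by (intro nn_integral_cong) (auto simp: indicator_def)
    ultimately show ?thesis by (metis (no_types, lifting) ext)
  qed
  have split: "?\<xi> \<omega> = I t \<omega> + tail_integral \<phi> t \<omega>" if "0 \<le> t" "\<omega> \<in> space M" for t \<omega>
    unfolding I_def using that by (intro tail_integral_split[OF \<phi>p]) auto
  have Ile: "I t \<omega> \<le> ?\<xi> \<omega>" for t \<omega>
    unfolding I_def tail_integral_def by (intro nn_integral_mono) (auto simp: indicator_def)
  have Ifin: "(\<integral>\<^sup>+\<omega>. I t \<omega> \<partial>M) < \<infinity>" for t
    by (rule le_less_trans[OF nn_integral_mono[OF Ile] fin])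
  have IN: "AE \<omega> in M. I t \<omega> \<le> ennreal (N t \<omega>)" if t: "0 \<le> t" for t
  proof (rule AE_le_of_nn_integral_le[OF subalgebra_F[OF t] IF[OF t] _ Ifin])
    show "(\<lambda>\<omega>. ennreal (N t \<omega>)) \<in> borel_measurable (F t)" using N[OF t] by measurable
    fix A assume A: "A \<in> sets (F t)"
    then show "(\<integral>\<^sup>+\<omega>. indicator A \<omega> * I t \<omega> \<partial>M) \<le> (\<integral>\<^sup>+\<omega>. indicator A \<omega> * ennreal (N t \<omega>) \<partial>M)"
      using t by (subst Nt) (auto intro!: nn_integral_mono mult_left_mono Ile)
  qed
  \<comment> \<open>Nonnegativity is secured at the countably many dyadic times; right-continuity of
    \<open>W\<close> extends it to all times.\<close>
  define G where "G = {\<omega>\<in>space M. ?\<xi> \<omega> < \<infinity> \<and> (\<forall>d\<in>dyadics. I d \<omega> \<le> ennreal (N d \<omega>))}"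
  have AE1: "AE \<omega> in M. ?\<xi> \<omega> < \<infinity> \<and> (\<forall>d\<in>dyadics. I d \<omega> \<le> ennreal (N d \<omega>))"
  proof -
    have "AE \<omega> in M. ?\<xi> \<omega> \<noteq> \<infinity>" using fin by (intro nn_integral_PInf_AE) auto
    moreover have "AE \<omega> in M. \<forall>d\<in>dyadics. I d \<omega> \<le> ennreal (N d \<omega>)"
      by (subst AE_ball_countable[OF countable_dyadics]) (use IN dyadics_nonneg in blast)
    ultimately show ?thesis by eventually_elim (simp add: less_top)
  qed
  have G0: "G \<in> sets (F 0)" unfolding G_def by (rule AE_F0[OF AE1])
  have AEG: "AE \<omega> in M. \<omega> \<in> G" using AE1 AE_space unfolding G_def by eventually_elim simp
  define W where "W t \<omega> = (if \<omega> \<in> G then N t \<omega> - enn2real (I t \<omega>) else 0)" for t \<omega>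
  have Ic: "continuous_on {0..} (\<lambda>t. enn2real (I t \<omega>))" if w: "\<omega> \<in> G" for \<omega>
  proof -
    have wM [measurable]: "\<omega> \<in> space M" using w by (simp add: G_def)
    note [measurable] = prog_meas_joint[OF \<phi>p]
    have [measurable]: "(\<lambda>s. ennreal (\<phi> (max 0 s) \<omega>)) \<in> borel_measurable borel" by measurable
    have e: "(\<integral>\<^sup>+s\<in>A. ennreal (\<phi> (max 0 s) \<omega>) \<partial>lborel) = (\<integral>\<^sup>+s\<in>A. ennreal (\<phi> s \<omega>) \<partial>lborel)" if "A \<subseteq> {0..}" for A
      using that by (intro nn_integral_cong) (auto simp: indicator_def max_def)
    have "continuous_on {0..} (\<lambda>t. enn2real (\<integral>\<^sup>+s\<in>{0..t}. ennreal (\<phi> (max 0 s) \<omega>) \<partial>lborel))"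
      by (rule continuous_on_nn_integral_Icc) (use w e[of "{0..}"] in \<open>auto simp: G_def tail_integral_def\<close>)
    then show ?thesis unfolding I_def by (subst (asm) e) auto
  qed
  have Wcad: "cadlag_path (\<lambda>t. W t \<omega>)" if w: "\<omega> \<in> space M" for \<omega>
  proof (cases "\<omega> \<in> G")
    case True
    then show ?thesis unfolding W_def
      using cadlag_path_diff[OF Nc[OF w] cadlag_path_continuous_on[OF Ic[OF True]]] by simp
  next
    case False
    then show ?thesis by (auto simp: W_def cadlag_path_def)
  qed
  have Wad: "W t \<in> borel_measurable (F t)" if t: "0 \<le> t" for t
  proof -
    note [measurable] = N[OF t] IF[OF t] F0_subset[OF t G0]
    have "{\<omega>\<in>space (F t). \<omega> \<in> G} = G" using sets.sets_into_space[OF F0_subset[OF t G0]] by auto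
    then have "Measurable.pred (F t) (\<lambda>\<omega>. \<omega> \<in> G)" unfolding pred_def using F0_subset[OF t G0] by simp
    then show ?thesis unfolding W_def[abs_def] by measurable
  qed
  have Wp: "prog_meas F W"
    by (rule prog_meas_right_continuous[OF Wad]) (use Wcad in \<open>auto simp: cadlag_path_def\<close>)
  have W0: "0 \<le> W t \<omega>" if t: "0 \<le> t" and w: "\<omega> \<in> space M" for t \<omega>
  proof (cases "\<omega> \<in> G")
    case True
    have "filterlim (\<lambda>n. dyadic_above n t) (at_right t) sequentially"
      using dyadic_above_tendsto[of t] dyadic_above_gt[of t] by (auto simp: filterlim_at less_imp_neq[symmetric])
    moreover have "((\<lambda>t. W t \<omega>) \<longlongrightarrow> W t \<omega>) (at_right t)"
      using Wcad[OF w] t by (auto simp: cadlag_path_def continuous_within)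
    ultimately have "(\<lambda>n. W (dyadic_above n t) \<omega>) \<longlonglongrightarrow> W t \<omega>" by (rule filterlim_compose[rotated])
    moreover have "0 \<le> W (dyadic_above n t) \<omega>" for n
    proof -
      have d: "dyadic_above n t \<in> dyadics" by (rule dyadic_above_in[OF t])
      then have "I (dyadic_above n t) \<omega> \<le> ennreal (N (dyadic_above n t) \<omega>)" using True by (simp add: G_def)
      then have "enn2real (I (dyadic_above n t) \<omega>) \<le> N (dyadic_above n t) \<omega>"
        by (rule enn2real_leI[OF N0[OF dyadics_nonneg[OF d] w]])
      then show ?thesis using True by (simp add: W_def)
    qed
    ultimately show ?thesis by (intro LIMSEQ_le_const) auto
  qed (simp add: W_def)
  have "potential \<phi> W"
    unfolding potential_def
  proof (intro allI impI ballI)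
    fix t :: real and g :: "'a \<Rightarrow> ennreal" assume t: "0 \<le> t" and g: "g \<in> borel_measurable (F t)"
    note tm [measurable] = tail_integral_measurable[OF \<phi>p t]
    note [measurable] = measurable_F_M[OF IF[OF t] t] measurable_F_M[OF Wad[OF t] t]
    show "(\<integral>\<^sup>+\<omega>. g \<omega> * ennreal (W t \<omega>) \<partial>M) = (\<integral>\<^sup>+\<omega>. g \<omega> * tail_integral \<phi> t \<omega> \<partial>M)"
    proof (rule cond_exp_testI[OF _ tm t _ g])
      show "(\<lambda>\<omega>. ennreal (W t \<omega>)) \<in> borel_measurable (F t)" using Wad[OF t] by measurable
      fix A assume A: "A \<in> sets (F t)"
      have [measurable]: "A \<in> events" using A subalgebra_F[OF t] by (auto simp: subalgebra_def)
      let ?i = "\<integral>\<^sup>+\<omega>. indicator A \<omega> * I t \<omega> \<partial>M"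
      have "?i \<le> (\<integral>\<^sup>+\<omega>. I t \<omega> \<partial>M)" by (intro nn_integral_mono) (auto simp: indicator_def)
      then have ifin: "?i < \<infinity>" using Ifin by (rule le_less_trans)
      \<comment> \<open>The finite \<open>?i\<close> is added to both sides and cancelled at the
        end, since subtraction in \<open>ennreal\<close> is truncated.\<close>
      have "?i + (\<integral>\<^sup>+\<omega>. indicator A \<omega> * ennreal (W t \<omega>) \<partial>M) = (\<integral>\<^sup>+\<omega>. indicator A \<omega> * I t \<omega> + indicator A \<omega> * ennreal (W t \<omega>) \<partial>M)"
        by (rule nn_integral_add[symmetric]) measurable
      also have "\<dots> = (\<integral>\<^sup>+\<omega>. indicator A \<omega> * ennreal (N t \<omega>) \<partial>M)"
      proof (rule nn_integral_cong_AE)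
        show "AE \<omega> in M. indicator A \<omega> * I t \<omega> + indicator A \<omega> * ennreal (W t \<omega>) = indicator A \<omega> * ennreal (N t \<omega>)"
          using AEG AE_space
        proof eventually_elim
          case (elim \<omega>)
          have "I t \<omega> < \<infinity>" using Ile[of t \<omega>] elim by (auto simp: G_def intro: le_less_trans)
          then obtain x where x: "I t \<omega> = ennreal x" "0 \<le> x" by (metis ennreal_cases infinity_ennreal_def less_irrefl)
          have "0 \<le> N t \<omega> - x" using W0[OF t elim(2)] elim(1) x by (simp add: W_def)
          then have "I t \<omega> + ennreal (W t \<omega>) = ennreal (N t \<omega>)"
            using x elim(1) by (simp add: W_def ennreal_plus[symmetric] del: ennreal_plus)
          then show ?case by (simp flip: distrib_left)
        qed
      qed
      also have "\<dots> = (\<integral>\<^sup>+\<omega>. indicator A \<omega> * ?\<xi> \<omega> \<partial>M)" using A by (intro Nt t) auto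
      also have "\<dots> = (\<integral>\<^sup>+\<omega>. indicator A \<omega> * I t \<omega> + indicator A \<omega> * tail_integral \<phi> t \<omega> \<partial>M)"
        using split[OF t] by (intro nn_integral_cong) (simp add: distrib_left)
      also have "\<dots> = ?i + (\<integral>\<^sup>+\<omega>. indicator A \<omega> * tail_integral \<phi> t \<omega> \<partial>M)"
        by (rule nn_integral_add) measurable
      finally show "(\<integral>\<^sup>+\<omega>. indicator A \<omega> * ennreal (W t \<omega>) \<partial>M) = (\<integral>\<^sup>+\<omega>. indicator A \<omega> * tail_integral \<phi> t \<omega> \<partial>M)"
        using ifin by (auto simp: ennreal_add_left_cancel)
    qed
  qed
  then show ?thesis using Wp W0 Wcad by (auto simp: nonneg_proc_def)
qed

end

section \<open>Uniqueness and existence\<close>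

context filtered_space
begin

section \<open>Invariance under modification at each fixed time\<close>

lemma tail_integral_test_cong:
  assumes "prog_meas F \<phi>" "prog_meas F \<psi>" "0 \<le> t"
    and eq: "\<And>s. t \<le> s \<Longrightarrow> AE \<omega> in M. \<phi> s \<omega> = \<psi> s \<omega>"
    and g: "g \<in> borel_measurable M"
  shows "(\<integral>\<^sup>+\<omega>. g \<omega> * tail_integral \<phi> t \<omega> \<partial>M) = (\<integral>\<^sup>+\<omega>. g \<omega> * tail_integral \<psi> t \<omega> \<partial>M)"
proof (rule antisym)
  have le: "AE \<omega> in M. \<phi> s \<omega> \<le> 1 * \<psi> s \<omega>" "AE \<omega> in M. \<psi> s \<omega> \<le> 1 * \<phi> s \<omega>" if "t \<le> s" for s
    using eq[OF that] by (eventually_elim, simp)+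
  show "(\<integral>\<^sup>+\<omega>. g \<omega> * tail_integral \<phi> t \<omega> \<partial>M) \<le> (\<integral>\<^sup>+\<omega>. g \<omega> * tail_integral \<psi> t \<omega> \<partial>M)"
    using tail_integral_test_mono[OF assms(1,2,3) _ le(1) g] by simp
  show "(\<integral>\<^sup>+\<omega>. g \<omega> * tail_integral \<psi> t \<omega> \<partial>M) \<le> (\<integral>\<^sup>+\<omega>. g \<omega> * tail_integral \<phi> t \<omega> \<partial>M)"
    using tail_integral_test_mono[OF assms(2,1,3) _ le(2) g] by simp
qed

lemma potential_cong:
  assumes \<phi>: "prog_meas F \<phi>" "prog_meas F \<psi>" and eq: "\<And>s. 0 \<le> s \<Longrightarrow> AE \<omega> in M. \<phi> s \<omega> = \<psi> s \<omega>"
    and eqW: "\<And>s. 0 \<le> s \<Longrightarrow> AE \<omega> in M. W s \<omega> = Z s \<omega>" and pot: "potential \<phi> W"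
  shows "potential \<psi> Z"
  unfolding potential_def
proof (intro allI impI ballI)
  fix t :: real and g :: "'a \<Rightarrow> ennreal" assume t: "0 \<le> t" and g: "g \<in> borel_measurable (F t)"
  have "(\<integral>\<^sup>+\<omega>. g \<omega> * ennreal (Z t \<omega>) \<partial>M) = (\<integral>\<^sup>+\<omega>. g \<omega> * ennreal (W t \<omega>) \<partial>M)"
    using eqW[OF t] by (intro nn_integral_cong_AE) (auto elim!: eventually_mono)
  also have "\<dots> = (\<integral>\<^sup>+\<omega>. g \<omega> * tail_integral \<phi> t \<omega> \<partial>M)" by (rule potentialD[OF pot t g])
  also have "\<dots> = (\<integral>\<^sup>+\<omega>. g \<omega> * tail_integral \<psi> t \<omega> \<partial>M)"
    using eq t by (intro tail_integral_test_cong \<phi> t measurable_F_M[OF g t]) auto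
  finally show "(\<integral>\<^sup>+\<omega>. g \<omega> * ennreal (Z t \<omega>) \<partial>M) = (\<integral>\<^sup>+\<omega>. g \<omega> * tail_integral \<psi> t \<omega> \<partial>M)" .
qed

lemma integrable_proc_le:
  assumes "prog_meas F \<phi>" "prog_meas F \<psi>" "0 \<le> c" "integrable_proc \<psi>"
    and "\<And>s. 0 \<le> s \<Longrightarrow> AE \<omega> in M. \<phi> s \<omega> \<le> c * \<psi> s \<omega>"
  shows "integrable_proc \<phi>"
proof -
  have "(\<integral>\<^sup>+\<omega>. tail_integral \<phi> 0 \<omega> \<partial>M) \<le> ennreal c * (\<integral>\<^sup>+\<omega>. tail_integral \<psi> 0 \<omega> \<partial>M)"
    using tail_integral_test_mono[OF assms(1,2) _ assms(3,5), of 0 "\<lambda>_. 1"] by simp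
  also have "\<dots> < \<infinity>" using assms(4) by (simp add: integrable_proc_def ennreal_mult_less_top)
  finally show ?thesis by (simp add: integrable_proc_def)
qed

lemma integrable_proc_cong:
  assumes "prog_meas F \<phi>" "prog_meas F \<psi>" "integrable_proc \<psi>"
    and "\<And>s. 0 \<le> s \<Longrightarrow> AE \<omega> in M. \<phi> s \<omega> = \<psi> s \<omega>"
  shows "integrable_proc \<phi>"
proof (rule integrable_proc_le[OF assms(1,2) _ assms(3), of 1])
  fix s :: real assume "0 \<le> s"
  from assms(4)[OF this] show "AE \<omega> in M. \<phi> s \<omega> \<le> 1 * \<psi> s \<omega>" by eventually_elim simp
qed simp

lemma integrable_proc_tail:
  assumes "integrable_proc \<phi>" "0 \<le> t"
  shows "(\<integral>\<^sup>+\<omega>. tail_integral \<phi> t \<omega> \<partial>M) < \<infinity>"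
proof -
  have "(\<integral>\<^sup>+\<omega>. tail_integral \<phi> t \<omega> \<partial>M) \<le> (\<integral>\<^sup>+\<omega>. tail_integral \<phi> 0 \<omega> \<partial>M)"
    by (intro nn_integral_mono tail_integral_antimono assms)
  then show ?thesis using assms(1) by (simp add: integrable_proc_def le_less_trans)
qed

text \<open>The driver is homogeneous of degree \<open>1 - a < 1\<close> in \<open>W\<close>, hence the potential map is a contraction
  for the ratio metric: a bound \<open>W \<le> c Z\<close> improves to \<open>W \<le> c powr (1 - a) ^ n Z\<close> for all \<open>n\<close>.\<close>

lemma EZ_potential_le:
  assumes a: "0 < a" "a < 1" and X: "prog_meas F X"
    and W: "nonneg_proc W" "potential (EZ_driver a X W) W" "integrable_proc (EZ_driver a X W)"
    and Z: "nonneg_proc Z" "potential (EZ_driver a X Z) Z"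
    and c: "0 < c" and le: "\<And>t. 0 \<le> t \<Longrightarrow> AE \<omega> in M. W t \<omega> \<le> c * Z t \<omega>" and t: "0 \<le> t"
  shows "AE \<omega> in M. W t \<omega> \<le> Z t \<omega>"
proof -
  have Wp: "prog_meas F W" "\<And>t \<omega>. 0 \<le> t \<Longrightarrow> \<omega> \<in> space M \<Longrightarrow> 0 \<le> W t \<omega>"
    and Zp: "prog_meas F Z" "\<And>t \<omega>. 0 \<le> t \<Longrightarrow> \<omega> \<in> space M \<Longrightarrow> 0 \<le> Z t \<omega>"
    using W Z by (auto simp: nonneg_proc_def)
  have step: "AE \<omega> in M. W t \<omega> \<le> d powr (1 - a) * Z t \<omega>"
    if d: "0 < d" and le: "\<And>t. 0 \<le> t \<Longrightarrow> AE \<omega> in M. W t \<omega> \<le> d * Z t \<omega>" and t: "0 \<le> t" for d t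
  proof (rule potential_mono[OF prog_meas_EZ_driver[OF X Wp(1)] prog_meas_EZ_driver[OF X Zp(1)] W(2) Z(2) Wp(1) Z(1) W(3) t])
    fix s assume "t \<le> s"
    then have s: "0 \<le> s" using t by simp
    show "AE \<omega> in M. EZ_driver a X W s \<omega> \<le> d powr (1 - a) * EZ_driver a X Z s \<omega>"
      using le[OF s] AE_space
    proof eventually_elim
      case (elim \<omega>)
      have "W s \<omega> powr (1 - a) \<le> (d * Z s \<omega>) powr (1 - a)"
        using a elim Wp(2)[OF s elim(2)] by (intro powr_mono2) auto
      also have "\<dots> = d powr (1 - a) * Z s \<omega> powr (1 - a)"
        using d Zp(2)[OF s elim(2)] by (simp add: powr_mult)
      finally have "X s \<omega> powr a * W s \<omega> powr (1 - a) / a \<le> X s \<omega> powr a * (d powr (1 - a) * Z s \<omega> powr (1 - a)) / a"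
        using a by (intro divide_right_mono mult_left_mono) auto
      then show ?case by (simp add: EZ_driver_def ac_simps)
    qed
  qed simp
  have iter: "\<forall>t\<ge>0. AE \<omega> in M. W t \<omega> \<le> c powr ((1 - a) ^ n) * Z t \<omega>" for n
  proof (induction n)
    case 0 then show ?case using le c by simp
  next
    case (Suc n)
    show ?case
    proof (intro allI impI)
      fix t :: real assume t: "0 \<le> t"
      have "AE \<omega> in M. W t \<omega> \<le> (c powr ((1 - a) ^ n)) powr (1 - a) * Z t \<omega>"
        by (rule step) (use Suc t c in auto)
      then show "AE \<omega> in M. W t \<omega> \<le> c powr ((1 - a) ^ Suc n) * Z t \<omega>" by (simp add: powr_powr mult.commute)
    qed
  qed
  \<comment> \<open>One null set serves all \<open>n\<close>, and since the exponents
    \<open>(1 - a) ^ n\<close> tend to 0 the factor tends to 1.\<close>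
  have "AE \<omega> in M. \<forall>n. W t \<omega> \<le> c powr ((1 - a) ^ n) * Z t \<omega>"
    unfolding AE_all_countable using iter t by blast
  then show ?thesis
  proof eventually_elim
    case (elim \<omega>)
    have "(\<lambda>n. (1 - a) ^ n) \<longlonglongrightarrow> 0" using a by (intro LIMSEQ_power_zero) auto
    then have "(\<lambda>n. c powr ((1 - a) ^ n) * Z t \<omega>) \<longlonglongrightarrow> c powr 0 * Z t \<omega>"
      using c by (intro tendsto_mult tendsto_powr tendsto_const) auto
    then have "W t \<omega> \<le> c powr 0 * Z t \<omega>" using elim by (intro LIMSEQ_le_const) auto
    then show ?case using c by simp
  qed
qed

text \<open>After conditioning, the tail of \<open>X\<close> is at most \<open>X / k\<close>; this
  is what makes \<open>hi * X\<close> a supersolution later.\<close>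

lemma potential_le_proc:
  assumes tb: "tail_bounds k K X" and k: "0 < k" and X: "prog_meas F X" "\<And>t \<omega>. 0 \<le> t \<Longrightarrow> \<omega> \<in> space M \<Longrightarrow> 0 < X t \<omega>"
    and \<phi>: "prog_meas F \<phi>" "integrable_proc \<phi>" and W: "prog_meas F W" "potential \<phi> W" and c: "0 \<le> c"
    and le: "\<And>s. 0 \<le> s \<Longrightarrow> AE \<omega> in M. \<phi> s \<omega> \<le> c * X s \<omega>" and t: "0 \<le> t"
  shows "AE \<omega> in M. W t \<omega> \<le> c / k * X t \<omega>"
proof -
  note [measurable] = prog_meas_adapted[OF W(1) t] prog_meas_adapted[OF X(1) t]
  have "AE \<omega> in M. ennreal (W t \<omega>) \<le> ennreal (c / k * X t \<omega>)"
  proof (rule AE_le_of_nn_integral_le[OF subalgebra_F[OF t] _ _ potential_finite[OF W(2) \<phi>(2) t]])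
    fix A assume A: "A \<in> sets (F t)"
    have g: "indicator A \<in> borel_measurable (F t)" using A by simp
    note gM [measurable] = measurable_F_M[OF g t] prog_meas_M[OF X(1) t]
    have "(\<integral>\<^sup>+\<omega>. indicator A \<omega> * ennreal (W t \<omega>) \<partial>M) = (\<integral>\<^sup>+\<omega>. indicator A \<omega> * tail_integral \<phi> t \<omega> \<partial>M)"
      by (rule potentialD[OF W(2) t g])
    also have "\<dots> \<le> ennreal c * (\<integral>\<^sup>+\<omega>. indicator A \<omega> * tail_integral X t \<omega> \<partial>M)"
      by (rule tail_integral_test_mono[OF \<phi>(1) X(1) t c]) (use le t gM in auto)
    also have "\<dots> = ennreal (c / k) * (ennreal k * (\<integral>\<^sup>+\<omega>. indicator A \<omega> * tail_integral X t \<omega> \<partial>M))"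
    proof -
      have "ennreal c = ennreal (c / k) * ennreal k" using c k by (subst ennreal_mult[symmetric]) auto
      then show ?thesis by (simp only: mult.assoc)
    qed
    also have "\<dots> \<le> ennreal (c / k) * (\<integral>\<^sup>+\<omega>. indicator A \<omega> * ennreal (X t \<omega>) \<partial>M)"
      by (intro mult_left_mono tail_boundsD(1)[OF tb t g]) auto
    also have "\<dots> = (\<integral>\<^sup>+\<omega>. ennreal (c / k) * (indicator A \<omega> * ennreal (X t \<omega>)) \<partial>M)"
      by (rule nn_integral_cmult[symmetric]) measurable
    also have "\<dots> = (\<integral>\<^sup>+\<omega>. indicator A \<omega> * ennreal (c / k * X t \<omega>) \<partial>M)"
      using c k by (intro nn_integral_cong) (auto simp: ennreal_mult' indicator_def simp del: times_divide_eq_left)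
    finally show "(\<integral>\<^sup>+\<omega>. indicator A \<omega> * ennreal (W t \<omega>) \<partial>M) \<le> (\<integral>\<^sup>+\<omega>. indicator A \<omega> * ennreal (c / k * X t \<omega>) \<partial>M)" .
  qed measurable
  then show ?thesis
    using AE_space
  proof eventually_elim
    case (elim \<omega>)
    then show ?case using X(2)[OF t elim(2)] c k by (subst (asm) ennreal_le_iff) auto
  qed
qed

text \<open>After conditioning, the tail of \<open>X\<close> is at least \<open>X / K\<close>; this
  is what makes \<open>lo * X\<close> a subsolution later.\<close>

lemma proc_le_potential:
  assumes tb: "tail_bounds k K X" and K: "0 < K" and X: "prog_meas F X" "\<And>t \<omega>. 0 \<le> t \<Longrightarrow> \<omega> \<in> space M \<Longrightarrow> 0 < X t \<omega>"
    and Xint: "integrable_proc X"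
    and \<phi>: "prog_meas F \<phi>" and W: "nonneg_proc W" "potential \<phi> W" and c: "0 < c"
    and le: "\<And>s. 0 \<le> s \<Longrightarrow> AE \<omega> in M. c * X s \<omega> \<le> \<phi> s \<omega>" and t: "0 \<le> t"
  shows "AE \<omega> in M. c / K * X t \<omega> \<le> W t \<omega>"
proof -
  have Wp: "prog_meas F W" "\<And>\<omega>. \<omega> \<in> space M \<Longrightarrow> 0 \<le> W t \<omega>" using W t by (auto simp: nonneg_proc_def)
  note [measurable] = prog_meas_adapted[OF Wp(1) t] prog_meas_adapted[OF X(1) t]
  have test: "(\<integral>\<^sup>+\<omega>. g \<omega> * ennreal (c / K * X t \<omega>) \<partial>M) \<le> ennreal c * (\<integral>\<^sup>+\<omega>. g \<omega> * tail_integral X t \<omega> \<partial>M)"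
    if g: "g \<in> borel_measurable (F t)" for g
  proof -
    note [measurable] = measurable_F_M[OF g t] prog_meas_M[OF X(1) t]
    have "(\<integral>\<^sup>+\<omega>. g \<omega> * ennreal (c / K * X t \<omega>) \<partial>M) = (\<integral>\<^sup>+\<omega>. ennreal (c / K) * (g \<omega> * ennreal (X t \<omega>)) \<partial>M)"
      using c K by (intro nn_integral_cong) (simp add: ennreal_mult' mult.left_commute del: times_divide_eq_left)
    also have "\<dots> = ennreal (c / K) * (\<integral>\<^sup>+\<omega>. g \<omega> * ennreal (X t \<omega>) \<partial>M)"
      by (rule nn_integral_cmult) measurable
    also have "\<dots> \<le> ennreal (c / K) * (ennreal K * (\<integral>\<^sup>+\<omega>. g \<omega> * tail_integral X t \<omega> \<partial>M))"
      by (intro mult_left_mono tail_boundsD(2)[OF tb t g]) auto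
    also have "\<dots> = ennreal c * (\<integral>\<^sup>+\<omega>. g \<omega> * tail_integral X t \<omega> \<partial>M)"
    proof -
      have "ennreal (c / K) * ennreal K = ennreal c" using c K by (subst ennreal_mult[symmetric]) auto
      then show ?thesis by (simp only: mult.assoc[symmetric])
    qed
    finally show ?thesis .
  qed
  have "AE \<omega> in M. ennreal (c / K * X t \<omega>) \<le> ennreal (W t \<omega>)"
  proof (rule AE_le_of_nn_integral_le[OF subalgebra_F[OF t]])
    have "(\<integral>\<^sup>+\<omega>. ennreal (c / K * X t \<omega>) \<partial>M) \<le> ennreal c * (\<integral>\<^sup>+\<omega>. tail_integral X t \<omega> \<partial>M)"
      using test[of "\<lambda>_. 1"] by simp
    also have "\<dots> \<le> ennreal c * (\<integral>\<^sup>+\<omega>. tail_integral X 0 \<omega> \<partial>M)"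
      by (intro mult_left_mono nn_integral_mono tail_integral_antimono t) auto
    also have "\<dots> < \<infinity>" using Xint by (simp add: integrable_proc_def ennreal_mult_less_top)
    finally show "(\<integral>\<^sup>+\<omega>. ennreal (c / K * X t \<omega>) \<partial>M) < \<infinity>" .
    fix A assume A: "A \<in> sets (F t)"
    have g: "indicator A \<in> borel_measurable (F t)" using A by simp
    note gM = measurable_F_M[OF g t]
    have "AE \<omega> in M. X s \<omega> \<le> 1 / c * \<phi> s \<omega>" if "t \<le> s" for s
    proof -
      have "0 \<le> s" using that t by simp
      from le[OF this] show ?thesis by eventually_elim (use c in \<open>simp add: field_simps\<close>)
    qed
    then have "(\<integral>\<^sup>+\<omega>. indicator A \<omega> * tail_integral X t \<omega> \<partial>M) \<le> ennreal (1 / c) * (\<integral>\<^sup>+\<omega>. indicator A \<omega> * tail_integral \<phi> t \<omega> \<partial>M)"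
      using c by (intro tail_integral_test_mono X \<phi> t gM) auto
    then have "ennreal c * (\<integral>\<^sup>+\<omega>. indicator A \<omega> * tail_integral X t \<omega> \<partial>M) \<le> ennreal c * (ennreal (1 / c) * (\<integral>\<^sup>+\<omega>. indicator A \<omega> * tail_integral \<phi> t \<omega> \<partial>M))"
      by (rule mult_left_mono) simp
    also have "\<dots> = (\<integral>\<^sup>+\<omega>. indicator A \<omega> * tail_integral \<phi> t \<omega> \<partial>M)"
    proof -
      have "ennreal c * ennreal (1 / c) = 1" using c by (subst ennreal_mult[symmetric]) auto
      then show ?thesis by (simp only: mult.assoc[symmetric] mult_1)
    qed
    also have "\<dots> = (\<integral>\<^sup>+\<omega>. indicator A \<omega> * ennreal (W t \<omega>) \<partial>M)" by (rule potentialD[OF W(2) t g, symmetric])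
    finally show "(\<integral>\<^sup>+\<omega>. indicator A \<omega> * ennreal (c / K * X t \<omega>) \<partial>M) \<le> (\<integral>\<^sup>+\<omega>. indicator A \<omega> * ennreal (W t \<omega>) \<partial>M)"
      using test[OF g] by (rule order_trans[rotated])
  qed measurable
  then show ?thesis
    using AE_space
  proof eventually_elim
    case (elim \<omega>)
    then show ?case using Wp(2)[OF elim(2)] by (subst (asm) ennreal_le_iff) auto
  qed
qed

text \<open>Monotone iteration of the potential map, started at the subsolution \<open>lo X\<close> and bounded by the
  supersolution \<open>hi X\<close>; the truncations by \<open>max\<close> and \<open>min\<close> change nothing almost surely, but make all bounds hold pointwise.\<close>

lemma EZ_potential_exists:
  assumes a: "0 < a" "a < 1" and X: "prog_meas F X" "\<And>t \<omega>. 0 \<le> t \<Longrightarrow> \<omega> \<in> space M \<Longrightarrow> 0 < X t \<omega>"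
    and tb: "tail_bounds k K X" and k: "0 < k" "k \<le> K" and Xint: "integrable_proc X"
  shows "\<exists>W c. nonneg_proc W \<and> (\<forall>\<omega>\<in>space M. cadlag_path (\<lambda>t. W t \<omega>)) \<and> potential (EZ_driver a X W) W \<and>
    integrable_proc (EZ_driver a X W) \<and> 0 < c \<and> (\<forall>t\<ge>0. AE \<omega> in M. c * X t \<omega> \<le> W t \<omega>)"
proof -
  \<comment> \<open>The solutions of \<open>x powr (1 - a) / (a * K) = x\<close> and of the same
    equation with \<open>k\<close>. The driver of \<open>lo * X\<close> is
    \<open>lo powr (1 - a) / a * X\<close>, and conditioning its tail costs at most the factor
    \<open>1 / K\<close>, so the map sends \<open>lo * X\<close> above itself; dually for
    \<open>hi\<close>.\<close>
  define lo hi where "lo = (1 / (a * K)) powr (1 / a)" and "hi = (1 / (a * k)) powr (1 / a)"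
  have K: "0 < K" using k by simp
  have pos: "0 < lo" "0 < hi" using a k by (auto simp: lo_def hi_def)
  have lohi: "lo \<le> hi" unfolding lo_def hi_def using a k by (intro powr_mono2 divide_left_mono mult_left_mono) auto
  have lo_fix: "lo powr (1 - a) / a / K = lo" and hi_fix: "hi powr (1 - a) / a / k = hi"
  proof -
    have "x powr (1 - a) / a / q = x" if "0 < q" "x = (1 / (a * q)) powr (1 / a)" for x q
    proof -
      have x: "0 < x" using that a by simp
      have "x powr a = 1 / (a * q)" using that a by (simp add: powr_powr)
      moreover have "x powr (1 - a) * x powr a = x" using x by (simp flip: powr_add)
      ultimately show ?thesis by (simp add: divide_divide_eq_left)
    qed
    then show "lo powr (1 - a) / a / K = lo" "hi powr (1 - a) / a / k = hi"
      using K k by (auto simp: lo_def hi_def)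
  qed
  have drv_eq: "EZ_driver a X (\<lambda>t \<omega>. d * X t \<omega>) t \<omega> = d powr (1 - a) / a * X t \<omega>" if "0 < d" "0 \<le> t" "\<omega> \<in> space M" for d t \<omega>
  proof -
    have "X t \<omega> powr a * X t \<omega> powr (1 - a) = X t \<omega>" using X(2)[OF that(2,3)] by (simp flip: powr_add)
    then show ?thesis using that X(2)[OF that(2,3)] by (simp add: EZ_driver_def powr_mult ac_simps)
  qed
  have drv_mono: "EZ_driver a X W t \<omega> \<le> EZ_driver a X Z t \<omega>" if "0 \<le> W t \<omega>" "W t \<omega> \<le> Z t \<omega>" for W Z t \<omega>
    unfolding EZ_driver_def using a that by (intro divide_right_mono mult_left_mono powr_mono2) auto
  have drv0: "0 \<le> EZ_driver a X W t \<omega>" for W t \<omega> using a by (simp add: EZ_driver_def)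
  \<comment> \<open>The order interval is imposed at every point, so that driver bounds and suprema
    are available on each path.\<close>
  define good where "good u \<longleftrightarrow> prog_meas F u \<and> (\<forall>t\<ge>0. \<forall>\<omega>\<in>space M. lo * X t \<omega> \<le> u t \<omega> \<and> u t \<omega> \<le> hi * X t \<omega>)" for u
  have good_nn: "0 \<le> u t \<omega>" if "good u" "0 \<le> t" "\<omega> \<in> space M" for u t \<omega>
  proof -
    have "0 \<le> lo * X t \<omega>" using pos X(2)[OF that(2,3)] by simp
    then show ?thesis using that by (force simp: good_def)
  qed
  have dp: "prog_meas F (EZ_driver a X u)" if "good u" for u
    using that by (intro prog_meas_EZ_driver X) (simp add: good_def)
  have dhi: "EZ_driver a X u t \<omega> \<le> hi powr (1 - a) / a * X t \<omega>" and dlo: "lo powr (1 - a) / a * X t \<omega> \<le> EZ_driver a X u t \<omega>"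
    if u: "good u" and t: "0 \<le> t" and w: "\<omega> \<in> space M" for u t \<omega>
  proof -
    have b: "lo * X t \<omega> \<le> u t \<omega>" "u t \<omega> \<le> hi * X t \<omega>" "0 \<le> lo * X t \<omega>" using u t w pos X(2)[OF t w] by (auto simp: good_def)
    show "EZ_driver a X u t \<omega> \<le> hi powr (1 - a) / a * X t \<omega>"
      using drv_mono[of u t \<omega> "\<lambda>t \<omega>. hi * X t \<omega>"] b good_nn[OF u t w] drv_eq[OF pos(2) t w] by simp
    show "lo powr (1 - a) / a * X t \<omega> \<le> EZ_driver a X u t \<omega>"
      using drv_mono[of "\<lambda>t \<omega>. lo * X t \<omega>" t \<omega> u] b drv_eq[OF pos(1) t w] by simp
  qed
  have di: "integrable_proc (EZ_driver a X u)" if u: "good u" for u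
    by (rule integrable_proc_le[OF dp[OF u] X(1) _ Xint, of "hi powr (1 - a) / a"]) (use dhi[OF u] a in auto)
  have dn: "nonneg_proc (EZ_driver a X u)" if "good u" for u
    using dp[OF that] drv0 by (simp add: nonneg_proc_def)
  \<comment> \<open>A cadlag version is chosen separately for each argument, so order relations
    between values of \<open>S\<close> hold only almost surely at each time.\<close>
  define S where "S u = (SOME W. nonneg_proc W \<and> (\<forall>\<omega>\<in>space M. cadlag_path (\<lambda>t. W t \<omega>)) \<and> potential (EZ_driver a X u) W)" for u
  have S: "nonneg_proc (S u)" "\<And>\<omega>. \<omega> \<in> space M \<Longrightarrow> cadlag_path (\<lambda>t. S u t \<omega>)" "potential (EZ_driver a X u) (S u)" if u: "good u" for u
    using someI_ex[OF cadlag_potential[OF dn[OF u] di[OF u]]] unfolding S_def[symmetric] by auto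
  have Sp: "prog_meas F (S u)" if "good u" for u using S(1)[OF that] by (simp add: nonneg_proc_def)
  have S_hi: "AE \<omega> in M. S u t \<omega> \<le> hi * X t \<omega>" if u: "good u" and t: "0 \<le> t" for u t
  proof -
    have "AE \<omega> in M. S u t \<omega> \<le> (hi powr (1 - a) / a) / k * X t \<omega>"
      by (rule potential_le_proc[OF tb k(1) X dp[OF u] di[OF u] Sp[OF u] S(3)[OF u] _ _ t]) (use dhi[OF u] a in auto)
    then show ?thesis unfolding hi_fix .
  qed
  have S_lo: "AE \<omega> in M. lo * X t \<omega> \<le> S u t \<omega>" if u: "good u" and t: "0 \<le> t" for u t
  proof -
    have "AE \<omega> in M. (lo powr (1 - a) / a) / K * X t \<omega> \<le> S u t \<omega>"
      by (rule proc_le_potential[OF tb K X Xint dp[OF u] S(1)[OF u] S(3)[OF u] _ _ t]) (use dlo[OF u] a pos in auto)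
    then show ?thesis unfolding lo_fix .
  qed
  have S_mono: "AE \<omega> in M. S u t \<omega> \<le> S v t \<omega>" if u: "good u" and v: "good v" and t: "0 \<le> t"
    and uv: "\<And>t \<omega>. 0 \<le> t \<Longrightarrow> \<omega> \<in> space M \<Longrightarrow> u t \<omega> \<le> v t \<omega>" for u v t
  proof -
    have "AE \<omega> in M. S u t \<omega> \<le> 1 * S v t \<omega>"
      by (rule potential_mono[OF dp[OF u] dp[OF v] S(3)[OF u] S(3)[OF v] Sp[OF u] S(1)[OF v] di[OF u] t])
        (use drv_mono good_nn[OF u] uv t in auto)
    then show ?thesis by simp
  qed
  define u where "u = rec_nat (\<lambda>t \<omega>. lo * X t \<omega>) (\<lambda>_ v t \<omega>. max (v t \<omega>) (min (hi * X t \<omega>) (S v t \<omega>)))"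
  have u0: "u 0 = (\<lambda>t \<omega>. lo * X t \<omega>)" and uS: "u (Suc n) = (\<lambda>t \<omega>. max (u n t \<omega>) (min (hi * X t \<omega>) (S (u n) t \<omega>)))" for n
    by (simp_all add: u_def)
  have gu: "good (u n)" for n
  proof (induction n)
    case 0
    have "prog_meas F (\<lambda>t \<omega>. (\<lambda>x y. lo * x) (X t \<omega>) (X t \<omega>))" by (rule prog_meas_compose2[OF X(1) X(1)]) measurable
    then show ?case using lohi X(2) by (auto simp: good_def u0 intro!: mult_right_mono less_imp_le)
  next
    case (Suc n)
    have "prog_meas F (\<lambda>t \<omega>. (\<lambda>x y. min (hi * x) y) (X t \<omega>) (S (u n) t \<omega>))"
      by (rule prog_meas_compose2[OF X(1) Sp[OF Suc]]) measurable
    then have "prog_meas F (\<lambda>t \<omega>. max (u n t \<omega>) (min (hi * X t \<omega>) (S (u n) t \<omega>)))"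
      using Suc by (intro prog_meas_compose2[where f=max]) (auto simp: good_def)
    then show ?case using Suc by (auto simp: good_def uS le_max_iff_disj)
  qed
  have u_inc: "u n t \<omega> \<le> u (Suc n) t \<omega>" for n t \<omega> by (simp add: uS)
  \<comment> \<open>By induction the map lies almost surely above the current iterate: at the start
    because \<open>lo * X\<close> is a subsolution, then by monotonicity. Together with the bound
    \<open>hi * X\<close> this makes both truncations inactive.\<close>
  have u_S: "AE \<omega> in M. u (Suc n) t \<omega> = S (u n) t \<omega>" if t: "0 \<le> t" for n t
  proof -
    have "AE \<omega> in M. u n t \<omega> \<le> S (u n) t \<omega>"
    proof (induction n)
      case 0
      then show ?case using S_lo[OF gu[of 0] t] by (simp add: u0)
    next
      case (Suc n)
      show ?case using Suc S_hi[OF gu[of n] t] S_mono[OF gu[of n] gu[of "Suc n"] t u_inc]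
        by eventually_elim (simp add: uS)
    qed
    then show ?thesis using S_hi[OF gu[of n] t] by eventually_elim (simp add: uS)
  qed
  have inc: "incseq (\<lambda>n. u n t \<omega>)" for t \<omega> by (rule incseq_SucI) (rule u_inc)
  define U where "U t \<omega> = (SUP n. u n t \<omega>)" for t \<omega>
  have bdd: "bdd_above (range (\<lambda>n. u n t \<omega>))" if "0 \<le> t" "\<omega> \<in> space M" for t \<omega>
    using gu that by (intro bdd_aboveI[of _ "hi * X t \<omega>"]) (auto simp: good_def)
  have U_lim: "(\<lambda>n. u n t \<omega>) \<longlonglongrightarrow> U t \<omega>" if "0 \<le> t" "\<omega> \<in> space M" for t \<omega>
    unfolding U_def by (rule LIMSEQ_incseq_SUP[OF bdd[OF that] inc])
  have u_le_U: "u n t \<omega> \<le> U t \<omega>" if "0 \<le> t" "\<omega> \<in> space M" for n t \<omega>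
    unfolding U_def by (rule cSUP_upper[OF UNIV_I bdd[OF that]])
  have Up: "prog_meas F U" by (rule prog_meas_LIMSEQ[OF _ U_lim]) (use gu in \<open>auto simp: good_def\<close>)
  have gU: "good U"
    unfolding good_def
  proof (intro conjI Up allI impI ballI)
    fix t \<omega> assume t: "(0::real) \<le> t" and w: "\<omega> \<in> space M"
    show "lo * X t \<omega> \<le> U t \<omega>" using u_le_U[OF t w, of 0] by (simp add: u0)
    show "U t \<omega> \<le> hi * X t \<omega>" unfolding U_def by (rule cSUP_least) (use gu t w in \<open>auto simp: good_def\<close>)
  qed
  \<comment> \<open>The pointwise supremum \<open>U\<close> need not be cadlag; one more application
    of the map yields a cadlag process, which is then shown to be a version of
    \<open>U\<close>.\<close>
  define V where "V = S U"
  have VU: "AE \<omega> in M. V t \<omega> = U t \<omega>" if t: "0 \<le> t" for t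
  proof -
    have "AE \<omega> in M. U t \<omega> \<le> V t \<omega>"
    proof -
      have "AE \<omega> in M. \<forall>n. u (Suc n) t \<omega> \<le> V t \<omega>"
        unfolding AE_all_countable
      proof
        fix n
        have "AE \<omega> in M. S (u n) t \<omega> \<le> S U t \<omega>" by (rule S_mono[OF gu gU t]) (rule u_le_U)
        then show "AE \<omega> in M. u (Suc n) t \<omega> \<le> V t \<omega>"
          using u_S[OF t, of n] by eventually_elim (simp add: V_def)
      qed
      then show ?thesis using AE_space
      proof eventually_elim
        case (elim \<omega>)
        have "u n t \<omega> \<le> V t \<omega>" for n using u_inc[of n t \<omega>] elim(1) by (meson order_trans)
        then show ?case unfolding U_def by (intro cSUP_least) auto
      qed
    qed
    \<comment> \<open>Monotone convergence inside the potential: the tested integrals of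
      \<open>V\<close> are suprema of those of \<open>S (u n)\<close>, and each
      \<open>S (u n)\<close> is almost surely \<open>u (Suc n)\<close>, hence below
      \<open>U\<close>.\<close>
    moreover have "AE \<omega> in M. ennreal (V t \<omega>) \<le> ennreal (U t \<omega>)"
    proof (rule AE_le_of_nn_integral_le[OF subalgebra_F[OF t]])
      note [measurable] = prog_meas_adapted[OF Up t] prog_meas_adapted[OF Sp[OF gU] t]
      show "(\<lambda>\<omega>. ennreal (V t \<omega>)) \<in> borel_measurable (F t)" "(\<lambda>\<omega>. ennreal (U t \<omega>)) \<in> borel_measurable (F t)"
        unfolding V_def by measurable
      show "(\<integral>\<^sup>+\<omega>. ennreal (V t \<omega>) \<partial>M) < \<infinity>" unfolding V_def by (rule potential_finite[OF S(3)[OF gU] di[OF gU] t])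
      fix A assume A: "A \<in> sets (F t)"
      have g: "indicator A \<in> borel_measurable (F t)" using A by simp
      note gM [measurable] = measurable_F_M[OF g t]
      have tm [measurable]: "tail_integral (EZ_driver a X (u n)) t \<in> borel_measurable M" for n
        by (rule tail_integral_measurable[OF dp[OF gu] t])
      have d_inc: "EZ_driver a X (u n) s \<omega> \<le> EZ_driver a X (u (Suc n)) s \<omega>" if "0 \<le> s" "\<omega> \<in> space M" for n s \<omega>
        by (rule drv_mono) (rule good_nn[OF gu that], rule u_inc)
      have tail_sup: "tail_integral (EZ_driver a X U) t \<omega> = (SUP n. tail_integral (EZ_driver a X (u n)) t \<omega>)" if w: "\<omega> \<in> space M" for \<omega>
      proof -
        note [measurable] = w
        have [measurable]: "(\<lambda>s. EZ_driver a X (u n) (max 0 s) \<omega>) \<in> borel_measurable borel" for n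
          using measurable_compose[OF measurable_Pair2'[OF w] prog_meas_joint[OF dp[OF gu[of n]]]] by simp
        have e: "tail_integral \<phi> t \<omega> = (\<integral>\<^sup>+s. ennreal (\<phi> (max 0 s) \<omega>) * indicator {t..} s \<partial>lborel)" for \<phi> :: "real \<Rightarrow> 'a \<Rightarrow> real"
          unfolding tail_integral_def using t by (intro nn_integral_cong) (auto simp: indicator_def max_def)
        have sup: "ennreal (EZ_driver a X U s \<omega>) = (SUP n. ennreal (EZ_driver a X (u n) s \<omega>))" if s: "0 \<le> s" for s
        proof (rule LIMSEQ_unique)
          have "0 < U s \<omega>"
          proof -
            have "0 < lo * X s \<omega>" using pos X(2)[OF s w] by simp
            then show ?thesis using gU s w by (force simp: good_def)
          qed
          then have "(\<lambda>n. EZ_driver a X (u n) s \<omega>) \<longlonglongrightarrow> EZ_driver a X U s \<omega>"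
            unfolding EZ_driver_def using a by (intro tendsto_intros U_lim s w) auto
          then show "(\<lambda>n. ennreal (EZ_driver a X (u n) s \<omega>)) \<longlonglongrightarrow> ennreal (EZ_driver a X U s \<omega>)"
            by (rule tendsto_ennrealI)
          show "(\<lambda>n. ennreal (EZ_driver a X (u n) s \<omega>)) \<longlonglongrightarrow> (SUP n. ennreal (EZ_driver a X (u n) s \<omega>))"
            by (intro LIMSEQ_SUP incseq_SucI ennreal_leI d_inc s w)
        qed
        have "tail_integral (EZ_driver a X U) t \<omega> = (\<integral>\<^sup>+s. (SUP n. ennreal (EZ_driver a X (u n) (max 0 s) \<omega>) * indicator {t..} s) \<partial>lborel)"
          unfolding e by (intro nn_integral_cong) (simp add: sup SUP_mult_right_ennreal)
        also have "\<dots> = (SUP n. \<integral>\<^sup>+s. ennreal (EZ_driver a X (u n) (max 0 s) \<omega>) * indicator {t..} s \<partial>lborel)"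
        proof (rule nn_integral_monotone_convergence_SUP)
          show "incseq (\<lambda>n s. ennreal (EZ_driver a X (u n) (max 0 s) \<omega>) * indicator {t..} s)"
            by (intro incseq_SucI le_funI mult_right_mono ennreal_leI d_inc w) auto
        qed measurable
        finally show ?thesis unfolding e .
      qed
      have "(\<integral>\<^sup>+\<omega>. indicator A \<omega> * ennreal (V t \<omega>) \<partial>M) = (\<integral>\<^sup>+\<omega>. indicator A \<omega> * tail_integral (EZ_driver a X U) t \<omega> \<partial>M)"
        unfolding V_def by (rule potentialD[OF S(3)[OF gU] t g])
      also have "\<dots> = (\<integral>\<^sup>+\<omega>. (SUP n. indicator A \<omega> * tail_integral (EZ_driver a X (u n)) t \<omega>) \<partial>M)"
        by (intro nn_integral_cong) (simp add: tail_sup SUP_mult_left_ennreal)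
      \<comment> \<open>Monotonicity in \<open>n\<close> is available on \<open>space M\<close>,
        while the convergence theorem asks for it at every point; the indicator supplies it
        elsewhere.\<close>
      also have "\<dots> = (\<integral>\<^sup>+\<omega>. (SUP n. indicator A \<omega> * (tail_integral (EZ_driver a X (u n)) t \<omega> * indicator (space M) \<omega>)) \<partial>M)"
        by (intro nn_integral_cong) simp
      also have "\<dots> = (SUP n. \<integral>\<^sup>+\<omega>. indicator A \<omega> * (tail_integral (EZ_driver a X (u n)) t \<omega> * indicator (space M) \<omega>) \<partial>M)"
      proof (rule nn_integral_monotone_convergence_SUP)
        have "tail_integral (EZ_driver a X (u n)) t \<omega> * indicator (space M) \<omega> \<le> tail_integral (EZ_driver a X (u (Suc n))) t \<omega> * indicator (space M) \<omega>" for n \<omega>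
          unfolding tail_integral_def using t
          by (auto simp: indicator_def intro!: nn_integral_mono ennreal_leI d_inc)
        then show "incseq (\<lambda>n \<omega>. indicator A \<omega> * (tail_integral (EZ_driver a X (u n)) t \<omega> * indicator (space M) \<omega>))"
          by (intro incseq_SucI le_funI mult_left_mono) auto
      qed measurable
      also have "\<dots> \<le> (\<integral>\<^sup>+\<omega>. indicator A \<omega> * ennreal (U t \<omega>) \<partial>M)"
      proof (rule SUP_least)
        fix n
        have "(\<integral>\<^sup>+\<omega>. indicator A \<omega> * (tail_integral (EZ_driver a X (u n)) t \<omega> * indicator (space M) \<omega>) \<partial>M)
            = (\<integral>\<^sup>+\<omega>. indicator A \<omega> * tail_integral (EZ_driver a X (u n)) t \<omega> \<partial>M)"
          by (intro nn_integral_cong) simp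
        also have "\<dots> = (\<integral>\<^sup>+\<omega>. indicator A \<omega> * ennreal (S (u n) t \<omega>) \<partial>M)"
          by (rule potentialD[OF S(3)[OF gu] t g, symmetric])
        also have "\<dots> \<le> (\<integral>\<^sup>+\<omega>. indicator A \<omega> * ennreal (U t \<omega>) \<partial>M)"
        proof (rule nn_integral_mono_AE)
          show "AE \<omega> in M. indicator A \<omega> * ennreal (S (u n) t \<omega>) \<le> indicator A \<omega> * ennreal (U t \<omega>)"
            using u_S[OF t, of n] AE_space
          proof eventually_elim
            case (elim \<omega>)
            then have "S (u n) t \<omega> \<le> U t \<omega>" using u_le_U[OF t elim(2), of "Suc n"] by simp
            then show ?case by (intro mult_left_mono ennreal_leI) auto
          qed
        qed
        finally show "(\<integral>\<^sup>+\<omega>. indicator A \<omega> * (tail_integral (EZ_driver a X (u n)) t \<omega> * indicator (space M) \<omega>) \<partial>M)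
            \<le> (\<integral>\<^sup>+\<omega>. indicator A \<omega> * ennreal (U t \<omega>) \<partial>M)" .
      qed
      finally show "(\<integral>\<^sup>+\<omega>. indicator A \<omega> * ennreal (V t \<omega>) \<partial>M) \<le> (\<integral>\<^sup>+\<omega>. indicator A \<omega> * ennreal (U t \<omega>) \<partial>M)" .
    qed
    ultimately show ?thesis using AE_space
    proof eventually_elim
      case (elim \<omega>)
      then have "V t \<omega> \<le> U t \<omega>" using good_nn[OF gU t elim(3)] by (subst (asm) ennreal_le_iff) auto
      then show ?case using elim by simp
    qed
  qed
  have dVU: "AE \<omega> in M. EZ_driver a X U t \<omega> = EZ_driver a X V t \<omega>" if "0 \<le> t" for t
    using VU[OF that] by eventually_elim (simp add: EZ_driver_def)
  have dVp: "prog_meas F (EZ_driver a X V)"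
    unfolding V_def by (intro prog_meas_EZ_driver X Sp gU)
  have "potential (EZ_driver a X V) V"
    by (rule potential_cong[OF dp[OF gU] dVp dVU AE_I2[OF refl] S(3)[OF gU, folded V_def]])
  moreover have "integrable_proc (EZ_driver a X V)"
  proof (rule integrable_proc_cong[OF dVp dp[OF gU] di[OF gU]])
    fix s :: real assume "0 \<le> s"
    from dVU[OF this] show "AE \<omega> in M. EZ_driver a X V s \<omega> = EZ_driver a X U s \<omega>" by eventually_elim simp
  qed
  moreover have "\<forall>t\<ge>0. AE \<omega> in M. lo * X t \<omega> \<le> V t \<omega>" using S_lo[OF gU] by (simp add: V_def)
  ultimately show ?thesis using S(1,2)[OF gU] pos(1) by (intro exI[of _ V] exI[of _ lo]) (simp add: V_def)
qed

end

section \<open>Epstein--Zin solutions\<close>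

context filtered_space
begin

section \<open>Translation between conditional expectations and the weak form\<close>

lemma potential_iff_cond_mart:
  assumes \<phi>: "prog_meas F \<phi>" "integrable_proc \<phi>" and W: "nonneg_proc W"
  shows "potential \<phi> W \<longleftrightarrow> (\<forall>t\<ge>0. AE \<omega> in M. W t \<omega> = cond_mart (tail_integral \<phi> t) t \<omega>)"
proof -
  have Wp: "prog_meas F W" "\<And>t \<omega>. 0 \<le> t \<Longrightarrow> \<omega> \<in> space M \<Longrightarrow> 0 \<le> W t \<omega>" using W by (auto simp: nonneg_proc_def)
  have tfin: "(\<integral>\<^sup>+\<omega>. tail_integral \<phi> t \<omega> \<partial>M) < \<infinity>" if "0 \<le> t" for t
    by (rule integrable_proc_tail[OF \<phi>(2) that])
  show ?thesis
  proof (intro iffI allI impI)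
    fix t :: real assume pot: "potential \<phi> W" and t: "0 \<le> t"
    interpret sf: sigma_finite_subalgebra M "F t" by (rule sigma_finite_F[OF t])
    note [measurable] = prog_meas_adapted[OF Wp(1) t]
    have "AE \<omega> in M. ennreal (W t \<omega>) = nn_cond_exp M (F t) (tail_integral \<phi> t) \<omega>"
    proof (rule sf.nn_cond_exp_charact)
      fix A assume A: "A \<in> sets (F t)"
      then show "(\<integral>\<^sup>+\<omega>\<in>A. tail_integral \<phi> t \<omega> \<partial>M) = (\<integral>\<^sup>+\<omega>\<in>A. ennreal (W t \<omega>) \<partial>M)"
        using potentialD[OF pot t, of "indicator A"] by (simp add: mult.commute)
    qed (use tail_integral_measurable[OF \<phi>(1) t] in \<open>simp_all\<close>)
    then show "AE \<omega> in M. W t \<omega> = cond_mart (tail_integral \<phi> t) t \<omega>"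
      using AE_space
    proof eventually_elim
      case (elim \<omega>)
      show ?case unfolding cond_mart_def elim(1)[symmetric] using Wp(2)[OF t elim(2)] by simp
    qed
  next
    assume *: "\<forall>t\<ge>0. AE \<omega> in M. W t \<omega> = cond_mart (tail_integral \<phi> t) t \<omega>"
    show "potential \<phi> W"
      unfolding potential_def
    proof (intro allI impI ballI)
      fix t :: real and g :: "'a \<Rightarrow> ennreal" assume t: "0 \<le> t" and g: "g \<in> borel_measurable (F t)"
      have "(\<integral>\<^sup>+\<omega>. g \<omega> * ennreal (W t \<omega>) \<partial>M) = (\<integral>\<^sup>+\<omega>. g \<omega> * ennreal (cond_mart (tail_integral \<phi> t) t \<omega>) \<partial>M)"
      proof (rule nn_integral_cong_AE)
        from * t have "AE \<omega> in M. W t \<omega> = cond_mart (tail_integral \<phi> t) t \<omega>" by blast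
        then show "AE \<omega> in M. g \<omega> * ennreal (W t \<omega>) = g \<omega> * ennreal (cond_mart (tail_integral \<phi> t) t \<omega>)"
          by eventually_elim simp
      qed
      also have "\<dots> = (\<integral>\<^sup>+\<omega>. g \<omega> * tail_integral \<phi> t \<omega> \<partial>M)"
        by (rule cond_mart_test[OF tail_integral_measurable[OF \<phi>(1) t] tfin[OF t] t g])
      finally show "(\<integral>\<^sup>+\<omega>. g \<omega> * ennreal (W t \<omega>) \<partial>M) = (\<integral>\<^sup>+\<omega>. g \<omega> * tail_integral \<phi> t \<omega> \<partial>M)" .
    qed
  qed
qed

text \<open>\<open>real_cond_exp\<close> is the difference of the conditional expectations of the
  positive and the negative part. The constant \<open>\<kappa>\<close>, later \<open>1 - R\<close>
  and of either sign, is factored out, and the negative part of what remains vanishes.\<close>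

lemma real_cond_exp_tail:
  assumes \<phi>: "nonneg_proc \<phi>" "integrable_proc \<phi>" and t: "0 \<le> t" and \<kappa>: "\<kappa> \<noteq> 0"
    and f: "\<And>s \<omega>. 0 \<le> s \<Longrightarrow> \<omega> \<in> space M \<Longrightarrow> f s \<omega> = \<phi> s \<omega> / \<kappa>"
  shows "AE \<omega> in M. real_cond_exp M (F t) (\<lambda>\<omega>. LINT s:{t..}|lborel. f s \<omega>) \<omega> = cond_mart (tail_integral \<phi> t) t \<omega> / \<kappa>"
proof -
  interpret sf: sigma_finite_subalgebra M "F t" by (rule sigma_finite_F[OF t])
  have \<phi>p: "prog_meas F \<phi>" and \<phi>0: "\<And>t \<omega>. 0 \<le> t \<Longrightarrow> \<omega> \<in> space M \<Longrightarrow> 0 \<le> \<phi> t \<omega>" using \<phi> by (auto simp: nonneg_proc_def)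
  note tm [measurable] = tail_integral_measurable[OF \<phi>p t]
  have tfin: "(\<integral>\<^sup>+\<omega>. tail_integral \<phi> t \<omega> \<partial>M) < \<infinity>"
    by (rule integrable_proc_tail[OF \<phi>(2) t])
  define h where "h \<omega> = enn2real (tail_integral \<phi> t \<omega>)" for \<omega>
  have hm [measurable]: "h \<in> borel_measurable M" unfolding h_def by measurable
  have AEh: "AE \<omega> in M. ennreal (h \<omega>) = tail_integral \<phi> t \<omega>"
  proof -
    have "AE \<omega> in M. tail_integral \<phi> t \<omega> \<noteq> \<infinity>" using tfin by (intro nn_integral_PInf_AE) auto
    then show ?thesis by eventually_elim (simp add: h_def less_top)
  qed
  have hint: "integrable M h"
  proof (rule integrableI_nonneg)
    have "(\<integral>\<^sup>+\<omega>. ennreal (h \<omega>) \<partial>M) = (\<integral>\<^sup>+\<omega>. tail_integral \<phi> t \<omega> \<partial>M)" by (rule nn_integral_cong_AE[OF AEh])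
    then show "(\<integral>\<^sup>+\<omega>. ennreal (h \<omega>) \<partial>M) < \<infinity>" using tfin by simp
  qed (simp_all add: h_def)
  \<comment> \<open>This holds on every path: where the tail integral diverges, the Bochner integral
    is 0 by convention, and so is \<open>enn2real\<close> of infinity.\<close>
  have lint: "(LINT s:{t..}|lborel. f s \<omega>) = h \<omega> / \<kappa>" if w: "\<omega> \<in> space M" for \<omega>
  proof -
    have [measurable]: "(\<lambda>s. \<phi> (max 0 s) \<omega>) \<in> borel_measurable borel"
      using measurable_compose[OF measurable_Pair2'[OF w] prog_meas_joint[OF \<phi>p]] by simp
    have "(LINT s:{t..}|lborel. f s \<omega>) = (LINT s|lborel. (indicator {t..} s * \<phi> (max 0 s) \<omega>) / \<kappa>)"
      unfolding set_lebesgue_integral_def using t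
      by (intro Bochner_Integration.integral_cong) (auto simp: indicator_def f[OF _ w] max_def)
    also have "\<dots> = (LINT s|lborel. indicator {t..} s * \<phi> (max 0 s) \<omega>) / \<kappa>" by simp
    also have "(LINT s|lborel. indicator {t..} s * \<phi> (max 0 s) \<omega>) = enn2real (\<integral>\<^sup>+s. ennreal (indicator {t..} s * \<phi> (max 0 s) \<omega>) \<partial>lborel)"
      by (rule integral_eq_nn_integral) (auto intro!: AE_I2 mult_nonneg_nonneg \<phi>0 w)
    also have "(\<integral>\<^sup>+s. ennreal (indicator {t..} s * \<phi> (max 0 s) \<omega>) \<partial>lborel) = tail_integral \<phi> t \<omega>"
      unfolding tail_integral_def using t by (intro nn_integral_cong) (auto simp: indicator_def max_def)
    finally show ?thesis by (simp add: h_def)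
  qed
  have hk: "(\<lambda>\<omega>. h \<omega> / \<kappa>) \<in> borel_measurable M" by measurable
  have "(\<lambda>\<omega>. LINT s:{t..}|lborel. f s \<omega>) \<in> borel_measurable M"
    using hk by (rule measurable_cong[THEN iffD1, rotated]) (simp add: lint)
  then have 1: "AE \<omega> in M. real_cond_exp M (F t) (\<lambda>\<omega>. LINT s:{t..}|lborel. f s \<omega>) \<omega> = real_cond_exp M (F t) (\<lambda>\<omega>. h \<omega> / \<kappa>) \<omega>"
    by (intro sf.real_cond_exp_cong hk) (auto simp: lint intro!: AE_I2)
  have 2: "AE \<omega> in M. real_cond_exp M (F t) (\<lambda>\<omega>. h \<omega> / \<kappa>) \<omega> = real_cond_exp M (F t) h \<omega> / \<kappa>"
    by (rule sf.real_cond_exp_cdiv[OF hint])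
  have 3: "AE \<omega> in M. nn_cond_exp M (F t) (\<lambda>\<omega>. ennreal (h \<omega>)) \<omega> = nn_cond_exp M (F t) (tail_integral \<phi> t) \<omega>"
    by (rule sf.nn_cond_exp_cong[OF AEh]) measurable
  have "AE \<omega> in M. (0::ennreal) = nn_cond_exp M (F t) (\<lambda>\<omega>. ennreal (- h \<omega>)) \<omega>"
    by (rule sf.nn_cond_exp_charact) (simp_all add: h_def ennreal_neg)
  with 1 2 3 show ?thesis
    by eventually_elim (simp add: real_cond_exp_def cond_mart_def)
qed

text \<open>Positivity of \<open>Jproc\<close> follows from \<open>X > 0\<close> and the upper
  bound; it later reduces properness to almost sure positivity at each time.\<close>

lemma SO_tail_bounds:
  assumes "SO M F X"
  obtains k K where "prog_meas F X" "\<And>t \<omega>. 0 \<le> t \<Longrightarrow> \<omega> \<in> space M \<Longrightarrow> 0 < X t \<omega>" "integrable_proc X"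
    "0 < k" "k \<le> K" "tail_bounds k K X" "\<And>t. 0 \<le> t \<Longrightarrow> AE \<omega> in M. 0 < Jproc M F X t \<omega>"
proof -
  from assms obtain k K where Xp: "prog_meas F X" and Xpos: "\<And>t \<omega>. 0 \<le> t \<Longrightarrow> \<omega> \<in> space M \<Longrightarrow> 0 < X t \<omega>"
    and fin: "(\<integral>\<^sup>+ \<omega>. (\<integral>\<^sup>+ s\<in>{0..}. ennreal (X s \<omega>) \<partial>lborel) \<partial>M) < \<infinity>"
    and k: "0 < k" "k \<le> K"
    and kK: "\<And>t. 0 \<le> t \<Longrightarrow> AE \<omega> in M. k * Jproc M F X t \<omega> \<le> X t \<omega> \<and> X t \<omega> \<le> K * Jproc M F X t \<omega>"
    unfolding SO_def by blast
  have Xint: "integrable_proc X" using fin by (simp add: integrable_proc_def tail_integral_def)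
  have Xn: "nonneg_proc X" using Xp Xpos by (auto simp: nonneg_proc_def less_imp_le)
  have J: "AE \<omega> in M. Jproc M F X t \<omega> = cond_mart (tail_integral X t) t \<omega>" if t: "0 \<le> t" for t
    unfolding Jproc_def using real_cond_exp_tail[OF Xn Xint t, of 1 X] by simp
  have tfin: "(\<integral>\<^sup>+\<omega>. tail_integral X t \<omega> \<partial>M) < \<infinity>" if "0 \<le> t" for t
    by (rule integrable_proc_tail[OF Xint that])
  have tb: "tail_bounds k K X"
    unfolding tail_bounds_def
  proof (intro allI impI ballI)
    fix t :: real and g :: "'a \<Rightarrow> ennreal" assume t: "0 \<le> t" and g: "g \<in> borel_measurable (F t)"
    note [measurable] = measurable_F_M[OF g t] cond_mart_measurable[OF t] prog_meas_M[OF Xp t]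
    let ?m = "cond_mart (tail_integral X t) t"
    have test: "(\<integral>\<^sup>+\<omega>. g \<omega> * ennreal (c * ?m \<omega>) \<partial>M) = ennreal c * (\<integral>\<^sup>+\<omega>. g \<omega> * tail_integral X t \<omega> \<partial>M)" if "0 \<le> c" for c
    proof -
      have "(\<integral>\<^sup>+\<omega>. g \<omega> * ennreal (c * ?m \<omega>) \<partial>M) = (\<integral>\<^sup>+\<omega>. ennreal c * (g \<omega> * ennreal (?m \<omega>)) \<partial>M)"
        using that by (intro nn_integral_cong) (simp add: ennreal_mult' ac_simps)
      also have "\<dots> = ennreal c * (\<integral>\<^sup>+\<omega>. g \<omega> * ennreal (?m \<omega>) \<partial>M)" by (rule nn_integral_cmult) measurable
      also have "(\<integral>\<^sup>+\<omega>. g \<omega> * ennreal (?m \<omega>) \<partial>M) = (\<integral>\<^sup>+\<omega>. g \<omega> * tail_integral X t \<omega> \<partial>M)"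
        by (rule cond_mart_test[OF tail_integral_measurable[OF Xp t] tfin[OF t] t g])
      finally show ?thesis .
    qed
    have "(\<integral>\<^sup>+\<omega>. g \<omega> * ennreal (k * ?m \<omega>) \<partial>M) \<le> (\<integral>\<^sup>+\<omega>. g \<omega> * ennreal (X t \<omega>) \<partial>M)"
    proof (rule nn_integral_mono_AE)
      show "AE \<omega> in M. g \<omega> * ennreal (k * ?m \<omega>) \<le> g \<omega> * ennreal (X t \<omega>)"
        using J[OF t] kK[OF t] by eventually_elim (auto intro!: mult_left_mono ennreal_leI)
    qed
    moreover have "(\<integral>\<^sup>+\<omega>. g \<omega> * ennreal (X t \<omega>) \<partial>M) \<le> (\<integral>\<^sup>+\<omega>. g \<omega> * ennreal (K * ?m \<omega>) \<partial>M)"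
    proof (rule nn_integral_mono_AE)
      show "AE \<omega> in M. g \<omega> * ennreal (X t \<omega>) \<le> g \<omega> * ennreal (K * ?m \<omega>)"
        using J[OF t] kK[OF t] by eventually_elim (auto intro!: mult_left_mono ennreal_leI)
    qed
    ultimately show "ennreal k * (\<integral>\<^sup>+\<omega>. g \<omega> * tail_integral X t \<omega> \<partial>M) \<le> (\<integral>\<^sup>+\<omega>. g \<omega> * ennreal (X t \<omega>) \<partial>M) \<and>
        (\<integral>\<^sup>+\<omega>. g \<omega> * ennreal (X t \<omega>) \<partial>M) \<le> ennreal K * (\<integral>\<^sup>+\<omega>. g \<omega> * tail_integral X t \<omega> \<partial>M)"
      using test[of k] test[of K] k by simp
  qed
  have "AE \<omega> in M. 0 < Jproc M F X t \<omega>" if t: "0 \<le> t" for t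
    using kK[OF t] AE_space
  proof eventually_elim
    case (elim \<omega>)
    then have "0 < K * Jproc M F X t \<omega>" using Xpos[OF t elim(2)] by linarith
    then show ?case using k by (simp add: zero_less_mult_iff)
  qed
  then show thesis using that[OF Xp Xpos Xint k tb] by blast
qed

lemma f_EZ_eq_driver:
  fixes R S c v :: real
  assumes "R \<noteq> 1" "S \<noteq> 1" "0 < c"
  shows "f_EZ R S c v = EZ_driver ((1 - S) / (1 - R)) (\<lambda>_ _. c powr (1 - R)) (\<lambda>_ _. (1 - R) * v) t \<omega> / (1 - R)"
proof -
  have \<rho>: "((1 - R) / (1 - S) - 1) / ((1 - R) / (1 - S)) = 1 - (1 - S) / (1 - R)"
  proof -
    have "(\<theta> - 1) / \<theta> = 1 - 1 / \<theta>" if "\<theta> \<noteq> 0" for \<theta> :: real using that by (simp add: diff_divide_distrib)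
    from this[of "(1 - R) / (1 - S)"] assms show ?thesis by (simp only: divide_divide_eq_right mult_1) simp
  qed
  have "(c powr (1 - R)) powr ((1 - S) / (1 - R)) = c powr (1 - S)"
    using assms by (simp add: powr_powr)
  moreover have "x / p * w = x * w / (p / q) / q" if "p \<noteq> 0" "q \<noteq> 0" for x w p q :: real
    using that by simp
  ultimately show ?thesis
    unfolding f_EZ_def EZ_driver_def Let_def \<rho> using assms by (metis eq_iff_diff_eq_0)
qed

text \<open>The factor \<open>1 / (1 - R)\<close> between aggregator and driver only changes sign
  and scale, so integrability and the conditional expectation carry over to \<open>W\<close>; path
  regularity is left as a condition on \<open>V\<close>.\<close>

lemma is_solution_iff:
  fixes R S :: real and C V :: "real \<Rightarrow> 'a \<Rightarrow> real"
  defines "a \<equiv> (1 - S) / (1 - R)" and "X \<equiv> \<lambda>t \<omega>. C t \<omega> powr (1 - R)" and "W \<equiv> \<lambda>t \<omega>. (1 - R) * V t \<omega>"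
  assumes RS: "R \<noteq> 1" "S \<noteq> 1" and a: "0 < a" and Xp: "prog_meas F X"
    and C: "\<And>t \<omega>. 0 \<le> t \<Longrightarrow> \<omega> \<in> space M \<Longrightarrow> 0 < C t \<omega>"
  shows "is_solution M F R S C V \<longleftrightarrow> nonneg_proc W \<and> (\<forall>\<omega>\<in>space M. cadlag_path (\<lambda>t. V t \<omega>)) \<and>
    integrable_proc (EZ_driver a X W) \<and> potential (EZ_driver a X W) W"
proof -
  let ?D = "EZ_driver a X W"
  have f: "f_EZ R S (C s \<omega>) (V s \<omega>) = ?D s \<omega> / (1 - R)" if "0 \<le> s" "\<omega> \<in> space M" for s \<omega>
    using f_EZ_eq_driver[OF RS C[OF that], of "V s \<omega>" s \<omega>] by (simp add: a_def X_def W_def EZ_driver_def)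
  have D0: "0 \<le> ?D s \<omega>" for s \<omega> using a by (simp add: EZ_driver_def)
  have VW: "prog_meas F V \<longleftrightarrow> prog_meas F W"
  proof
    assume V: "prog_meas F V"
    have "prog_meas F (\<lambda>t \<omega>. (\<lambda>x y. (1 - R) * x) (V t \<omega>) (V t \<omega>))"
      by (rule prog_meas_compose2[OF V V]) measurable
    then show "prog_meas F W" by (simp add: W_def)
  next
    assume W: "prog_meas F W"
    have "prog_meas F (\<lambda>t \<omega>. (\<lambda>x y. x / (1 - R)) (W t \<omega>) (W t \<omega>))"
      by (rule prog_meas_compose2[OF W W]) measurable
    then show "prog_meas F V" using RS by (simp add: W_def)
  qed
  have int_iff: "(\<integral>\<^sup>+ \<omega>. (\<integral>\<^sup>+ s\<in>{0..}. ennreal \<bar>f_EZ R S (C s \<omega>) (V s \<omega>)\<bar> \<partial>lborel) \<partial>M) < \<infinity> \<longleftrightarrow> integrable_proc ?D"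
    if Wp: "prog_meas F W"
  proof -
    have Dp: "prog_meas F ?D" by (rule prog_meas_EZ_driver[OF Xp Wp])
    note [measurable] = tail_integral_measurable[OF Dp, of 0, simplified]
    let ?c = "ennreal (1 / \<bar>1 - R\<bar>)"
    have "(\<integral>\<^sup>+ s\<in>{0..}. ennreal \<bar>f_EZ R S (C s \<omega>) (V s \<omega>)\<bar> \<partial>lborel) = ?c * tail_integral ?D 0 \<omega>" if w: "\<omega> \<in> space M" for \<omega>
    proof -
      have [measurable]: "(\<lambda>s. ?D (max 0 s) \<omega>) \<in> borel_measurable borel"
        using measurable_compose[OF measurable_Pair2'[OF w] prog_meas_joint[OF Dp]] by simp
      have "(\<integral>\<^sup>+ s\<in>{0..}. ennreal \<bar>f_EZ R S (C s \<omega>) (V s \<omega>)\<bar> \<partial>lborel) = (\<integral>\<^sup>+ s. ?c * (ennreal (?D (max 0 s) \<omega>) * indicator {0..} s) \<partial>lborel)"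
      proof (rule nn_integral_cong)
        fix s :: real
        show "ennreal \<bar>f_EZ R S (C s \<omega>) (V s \<omega>)\<bar> * indicator {0..} s = ?c * (ennreal (?D (max 0 s) \<omega>) * indicator {0..} s)"
        proof (cases "0 \<le> s")
          case True
          have "\<bar>?D s \<omega> / (1 - R)\<bar> = 1 / \<bar>1 - R\<bar> * ?D s \<omega>" using D0[of s \<omega>] by simp
          then have "ennreal \<bar>?D s \<omega> / (1 - R)\<bar> = ?c * ennreal (?D s \<omega>)"
            using ennreal_mult[of "1 / \<bar>1 - R\<bar>" "?D s \<omega>"] D0[of s \<omega>] by simp
          then show ?thesis unfolding f[OF True w] using True by (simp only: max_absorb2 mult.assoc)
        qed simp
      qed
      also have "\<dots> = ?c * (\<integral>\<^sup>+ s. ennreal (?D (max 0 s) \<omega>) * indicator {0..} s \<partial>lborel)"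
        by (rule nn_integral_cmult) measurable
      also have "(\<integral>\<^sup>+ s. ennreal (?D (max 0 s) \<omega>) * indicator {0..} s \<partial>lborel) = tail_integral ?D 0 \<omega>"
        unfolding tail_integral_def by (intro nn_integral_cong) (auto simp: indicator_def max_def)
      finally show ?thesis .
    qed
    then have "(\<integral>\<^sup>+ \<omega>. (\<integral>\<^sup>+ s\<in>{0..}. ennreal \<bar>f_EZ R S (C s \<omega>) (V s \<omega>)\<bar> \<partial>lborel) \<partial>M) = (\<integral>\<^sup>+ \<omega>. ?c * tail_integral ?D 0 \<omega> \<partial>M)"
      by (rule nn_integral_cong)
    also have "\<dots> = ?c * (\<integral>\<^sup>+ \<omega>. tail_integral ?D 0 \<omega> \<partial>M)" by (rule nn_integral_cmult) measurable
    finally show ?thesis using RS by (auto simp: integrable_proc_def ennreal_mult_less_top)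
  qed
  have pot_iff: "(\<forall>t\<ge>0. AE \<omega> in M. V t \<omega> = real_cond_exp M (F t) (\<lambda>\<omega>. LINT s:{t..}|lborel. f_EZ R S (C s \<omega>) (V s \<omega>)) \<omega>)
      \<longleftrightarrow> potential ?D W" if W: "nonneg_proc W" and int: "integrable_proc ?D"
  proof -
    have Dp: "prog_meas F ?D" using W by (intro prog_meas_EZ_driver[OF Xp]) (simp add: nonneg_proc_def)
    then have Dn: "nonneg_proc ?D" using D0 by (simp add: nonneg_proc_def)
    have "(AE \<omega> in M. V t \<omega> = real_cond_exp M (F t) (\<lambda>\<omega>. LINT s:{t..}|lborel. f_EZ R S (C s \<omega>) (V s \<omega>)) \<omega>)
      \<longleftrightarrow> (AE \<omega> in M. W t \<omega> = cond_mart (tail_integral ?D t) t \<omega>)" if t: "0 \<le> t" for t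
    proof -
      have "AE \<omega> in M. real_cond_exp M (F t) (\<lambda>\<omega>. LINT s:{t..}|lborel. f_EZ R S (C s \<omega>) (V s \<omega>)) \<omega> = cond_mart (tail_integral ?D t) t \<omega> / (1 - R)"
        by (rule real_cond_exp_tail[OF Dn int t]) (use RS f in auto)
      then have eq: "AE \<omega> in M. (V t \<omega> = real_cond_exp M (F t) (\<lambda>\<omega>. LINT s:{t..}|lborel. f_EZ R S (C s \<omega>) (V s \<omega>)) \<omega>)
         = (W t \<omega> = cond_mart (tail_integral ?D t) t \<omega>)"
      proof eventually_elim
        case (elim \<omega>)
        have "1 - R \<noteq> 0" using RS by simp
        then show ?case unfolding elim W_def by (simp add: eq_divide_eq mult.commute)
      qed
      show ?thesis
      proof
        assume "AE \<omega> in M. V t \<omega> = real_cond_exp M (F t) (\<lambda>\<omega>. LINT s:{t..}|lborel. f_EZ R S (C s \<omega>) (V s \<omega>)) \<omega>"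
        then show "AE \<omega> in M. W t \<omega> = cond_mart (tail_integral ?D t) t \<omega>" using eq by eventually_elim blast
      next
        assume "AE \<omega> in M. W t \<omega> = cond_mart (tail_integral ?D t) t \<omega>"
        then show "AE \<omega> in M. V t \<omega> = real_cond_exp M (F t) (\<lambda>\<omega>. LINT s:{t..}|lborel. f_EZ R S (C s \<omega>) (V s \<omega>)) \<omega>"
          using eq by eventually_elim blast
      qed
    qed
    then show ?thesis unfolding potential_iff_cond_mart[OF Dp int W] by blast
  qed
  show ?thesis
    unfolding is_solution_def
    using VW int_iff pot_iff by (auto simp: nonneg_proc_def W_def)
qed

text \<open>Equality at the countably many dyadic times holds off one null set, and right-continuity
  extends it to all times.\<close>

lemma indistinguishable_if_cadlag:
  assumes V: "\<And>\<omega>. \<omega> \<in> space M \<Longrightarrow> cadlag_path (\<lambda>t. V t \<omega>)" and W: "\<And>\<omega>. \<omega> \<in> space M \<Longrightarrow> cadlag_path (\<lambda>t. W t \<omega>)"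
    and eq: "\<And>t. 0 \<le> t \<Longrightarrow> AE \<omega> in M. V t \<omega> = W t \<omega>"
  shows "AE \<omega> in M. \<forall>t\<ge>0. V t \<omega> = W t \<omega>"
proof -
  have "AE \<omega> in M. \<forall>d\<in>dyadics. V d \<omega> = W d \<omega>"
    by (subst AE_ball_countable[OF countable_dyadics]) (use eq dyadics_nonneg in blast)
  then show ?thesis using AE_space
  proof eventually_elim
    case (elim \<omega>)
    show ?case
    proof (intro allI impI)
      fix t :: real assume t: "0 \<le> t"
      have lim: "filterlim (\<lambda>n. dyadic_above n t) (at_right t) sequentially"
        using dyadic_above_tendsto[of t] dyadic_above_gt[of t] by (auto simp: filterlim_at less_imp_neq[symmetric])
      have right: "((\<lambda>t. V t \<omega>) \<longlongrightarrow> V t \<omega>) (at_right t)" "((\<lambda>t. W t \<omega>) \<longlongrightarrow> W t \<omega>) (at_right t)"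
        using V[OF elim(2)] W[OF elim(2)] t by (auto simp: cadlag_path_def continuous_within)
      have "V (dyadic_above n t) \<omega> = W (dyadic_above n t) \<omega>" for n
        using elim(1) dyadic_above_in[OF t] by blast
      then have "(\<lambda>n. V (dyadic_above n t) \<omega>) \<longlonglongrightarrow> W t \<omega>"
        using filterlim_compose[OF right(2) lim] by simp
      then show "V t \<omega> = W t \<omega>" by (rule LIMSEQ_unique[OF filterlim_compose[OF right(1) lim]])
    qed
  qed
qed

text \<open>A solution which is almost surely positive at each time is replaced by a version which is
  positive everywhere, to which the two-sided comparison with \<open>X\<close> applies.\<close>

lemma EZ_potential_comparable:
  assumes a: "0 < a" "a < 1" and Xp: "prog_meas F X" and Xpos: "\<And>t \<omega>. 0 \<le> t \<Longrightarrow> \<omega> \<in> space M \<Longrightarrow> 0 < X t \<omega>"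
    and tb: "tail_bounds k K X" and k: "0 < k" "k \<le> K" and Xint: "integrable_proc X"
    and tb': "tail_bounds k' K' (\<lambda>t \<omega>. exp (\<nu> * t) * X t \<omega>)" and \<nu>: "0 < \<nu>" "0 < k'"
    and W: "nonneg_proc W" "potential (EZ_driver a X W) W" "integrable_proc (EZ_driver a X W)"
    and pos: "\<And>t. 0 \<le> t \<Longrightarrow> AE \<omega> in M. 0 < W t \<omega>"
  shows "\<exists>c>0. \<exists>d>0. \<forall>t\<ge>0. AE \<omega> in M. c * X t \<omega> \<le> W t \<omega> \<and> W t \<omega> \<le> d * X t \<omega>"
proof -
  have Wp: "prog_meas F W" using W by (simp add: nonneg_proc_def)
  define Z where "Z t \<omega> = (if 0 < W t \<omega> then W t \<omega> else X t \<omega>)" for t \<omega>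
  have Zp: "prog_meas F Z"
  proof -
    have "prog_meas F (\<lambda>t \<omega>. (\<lambda>w x. if 0 < w then w else x) (W t \<omega>) (X t \<omega>))"
      by (rule prog_meas_compose2[OF Wp Xp]) measurable
    then show ?thesis by (simp add: Z_def[abs_def])
  qed
  have Zpos: "0 < Z t \<omega>" if "0 \<le> t" "\<omega> \<in> space M" for t \<omega> using Xpos[OF that] by (simp add: Z_def)
  have ZW: "AE \<omega> in M. W t \<omega> = Z t \<omega>" if "0 \<le> t" for t
    using pos[OF that] by eventually_elim (simp add: Z_def)
  have dZW: "AE \<omega> in M. EZ_driver a X W t \<omega> = EZ_driver a X Z t \<omega>" if "0 \<le> t" for t
    using ZW[OF that] by eventually_elim (simp add: EZ_driver_def)
  note dp = prog_meas_EZ_driver[OF Xp Wp] prog_meas_EZ_driver[OF Xp Zp]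
  have potZ: "potential (EZ_driver a X Z) Z" by (rule potential_cong[OF dp dZW ZW W(2)])
  have intZ: "integrable_proc (EZ_driver a X Z)"
  proof (rule integrable_proc_cong[OF dp(2,1) W(3)])
    fix s :: real assume "0 \<le> s"
    from dZW[OF this] show "AE \<omega> in M. EZ_driver a X Z s \<omega> = EZ_driver a X W s \<omega>" by eventually_elim simp
  qed
  have Xn: "nonneg_proc X" and Zn: "nonneg_proc Z"
    using Xp Zp Xpos Zpos by (auto simp: nonneg_proc_def less_imp_le)
  obtain c where c: "0 < c" "\<And>t. 0 \<le> t \<Longrightarrow> AE \<omega> in M. c * X t \<omega> \<le> Z t \<omega>"
    using potential_lower_bound[OF a Xp Xpos Zp Zpos tb k Xint potZ intZ] by blast
  obtain d where d: "0 < d" "\<And>t. 0 \<le> t \<Longrightarrow> AE \<omega> in M. Z t \<omega> \<le> d * X t \<omega>"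
    using potential_upper_bound[OF a Xn Zn potZ intZ \<nu> tb'] by blast
  have "AE \<omega> in M. c * X t \<omega> \<le> W t \<omega> \<and> W t \<omega> \<le> d * X t \<omega>" if "0 \<le> t" for t
    using c(2)[OF that] d(2)[OF that] ZW[OF that] by eventually_elim simp
  then show ?thesis using c(1) d(1) by blast
qed

lemma EZ_potential_le_comparable:
  assumes a: "0 < a" "a < 1" and Xp: "prog_meas F X"
    and W: "nonneg_proc W" "potential (EZ_driver a X W) W" "integrable_proc (EZ_driver a X W)"
    and Z: "nonneg_proc Z" "potential (EZ_driver a X Z) Z"
    and c: "0 < c" "\<And>t. 0 \<le> t \<Longrightarrow> AE \<omega> in M. c * X t \<omega> \<le> Z t \<omega>"
    and d: "0 < d" "\<And>t. 0 \<le> t \<Longrightarrow> AE \<omega> in M. W t \<omega> \<le> d * X t \<omega>" and t: "0 \<le> t"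
  shows "AE \<omega> in M. W t \<omega> \<le> Z t \<omega>"
proof (rule EZ_potential_le[OF a Xp W Z _ _ t])
  show "0 < d / c" using c d by simp
  fix t :: real assume t: "0 \<le> t"
  show "AE \<omega> in M. W t \<omega> \<le> d / c * Z t \<omega>"
    using c(2)[OF t] d(2)[OF t]
  proof eventually_elim
    case (elim \<omega>)
    have "d * X t \<omega> = d / c * (c * X t \<omega>)" using c by simp
    also have "\<dots> \<le> d / c * Z t \<omega>" using elim c d by (intro mult_left_mono) auto
    finally show ?case using elim(2) by simp
  qed
qed

end

lemma usual_filtration_filtered_space:
  assumes "usual_filtration M F"
  shows "filtered_space M F"
proof -
  have P: "prob_space M" and sub: "\<forall>t\<ge>0. subalgebra M (F t)"
    and mono: "\<forall>s t. 0 \<le> s \<and> s \<le> t \<longrightarrow> sets (F s) \<subseteq> sets (F t)"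
    and null: "\<forall>A B. B \<in> null_sets M \<and> A \<subseteq> B \<longrightarrow> A \<in> sets (F 0)"
    and right: "\<forall>t\<ge>0. sets (F t) = (\<Inter>s\<in>{t<..}. sets (F s))"
    using assms unfolding usual_filtration_def by - (elim conjE, assumption)+
  interpret prob_space M by (rule P)
  show ?thesis
  proof
    show "subalgebra M (F t)" if "0 \<le> t" for t using sub that by simp
    show "sets (F s) \<subseteq> sets (F t)" if "0 \<le> s" "s \<le> t" for s t using mono that by simp
    show "A \<in> sets (F 0)" if "B \<in> null_sets M" "A \<subseteq> B" for A B using null that by blast
    show "sets (F t) = (\<Inter>s\<in>{t<..}. sets (F s))" if "0 \<le> t" for t
      by (rule right[rule_format, OF that])
  qed
qed

theorem theorem4p5:
  fixes M :: "'a measure" and F :: "real \<Rightarrow> 'a measure"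
    and R S :: real and C :: "real \<Rightarrow> 'a \<Rightarrow> real"
  assumes "usual_filtration M F"
    and "R \<in> {0<..<1} \<union> {1<..}" and "S \<in> {0<..<1} \<union> {1<..}"
    and "(1 - R) / (1 - S) > 1"
    and "prog_meas F C" and "\<forall>t\<ge>0. \<forall>\<omega>\<in>space M. C t \<omega> \<ge> 0"
    and "SO_plus M F (\<lambda>t \<omega>. C t \<omega> powr (1 - R))"
  shows "\<exists>V. is_proper_solution M F R S C V \<and>
           (\<forall>W. is_proper_solution M F R S C W \<longrightarrow> (AE \<omega> in M. \<forall>t\<ge>0. W t \<omega> = V t \<omega>))"
proof -
  interpret filtered_space M F by (rule usual_filtration_filtered_space[OF assms(1)])
  define a where "a = (1 - S) / (1 - R)"
  define X where "X t \<omega> = C t \<omega> powr (1 - R)" for t \<omega>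
  have RS: "R \<noteq> 1" "S \<noteq> 1" using assms(2,3) by auto
  define \<theta> where "\<theta> = (1 - R) / (1 - S)"
  have "1 < \<theta>" "a = 1 / \<theta>" using assms(4) by (simp_all add: a_def \<theta>_def)
  then have a: "0 < a" "a < 1" by simp_all
  obtain \<nu> where \<nu>: "0 < \<nu>" and SO: "SO M F X" and SO': "SO M F (\<lambda>t \<omega>. exp (\<nu> * t) * X t \<omega>)"
    using assms(7) unfolding SO_plus_def SO_nu_def X_def by blast
  obtain k K where Xp: "prog_meas F X" and Xpos: "\<And>t \<omega>. 0 \<le> t \<Longrightarrow> \<omega> \<in> space M \<Longrightarrow> 0 < X t \<omega>"
    and Xint: "integrable_proc X" and k: "0 < k" "k \<le> K" and tb: "tail_bounds k K X"
    and Jpos: "\<And>t. 0 \<le> t \<Longrightarrow> AE \<omega> in M. 0 < Jproc M F X t \<omega>"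
    by (rule SO_tail_bounds[OF SO]) (rule that; assumption)
  obtain k' K' where k': "0 < k'" and tb': "tail_bounds k' K' (\<lambda>t \<omega>. exp (\<nu> * t) * X t \<omega>)"
    by (rule SO_tail_bounds[OF SO']) (rule that; assumption)
  \<comment> \<open>\<open>0 powr (1 - R)\<close> is 0 for either sign of the exponent, so
    positivity of \<open>X\<close> excludes a vanishing \<open>C\<close>.\<close>
  have Cpos: "0 < C t \<omega>" if "0 \<le> t" "\<omega> \<in> space M" for t \<omega>
    using Xpos[OF that] assms(6) that by (cases "C t \<omega> = 0") (auto simp: X_def order_less_le)
  have sol_iff: "is_solution M F R S C V \<longleftrightarrow> nonneg_proc (\<lambda>t \<omega>. (1 - R) * V t \<omega>) \<and>
      (\<forall>\<omega>\<in>space M. cadlag_path (\<lambda>t. V t \<omega>)) \<and> integrable_proc (EZ_driver a X (\<lambda>t \<omega>. (1 - R) * V t \<omega>)) \<and>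
      potential (EZ_driver a X (\<lambda>t \<omega>. (1 - R) * V t \<omega>)) (\<lambda>t \<omega>. (1 - R) * V t \<omega>)" for V
    using a(1) Xp unfolding a_def X_def[abs_def] by (intro is_solution_iff[OF RS] Cpos)
  have proper_iff: "is_proper_solution M F R S C V \<longleftrightarrow> is_solution M F R S C V \<and> (\<forall>t\<ge>0. AE \<omega> in M. 0 < (1 - R) * V t \<omega>)" for V
  proof -
    have "(AE \<omega> in M. 0 < Jproc M F X t \<omega> \<longrightarrow> 0 < (1 - R) * V t \<omega>) \<longleftrightarrow> (AE \<omega> in M. 0 < (1 - R) * V t \<omega>)" if t: "0 \<le> t" for t
    proof
      assume "AE \<omega> in M. 0 < Jproc M F X t \<omega> \<longrightarrow> 0 < (1 - R) * V t \<omega>"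
      then show "AE \<omega> in M. 0 < (1 - R) * V t \<omega>" using Jpos[OF t] by eventually_elim simp
    qed (auto elim: eventually_mono)
    then show ?thesis unfolding is_proper_solution_def X_def[abs_def, symmetric] by blast
  qed
  obtain W0 c0 where W0: "nonneg_proc W0" "\<And>\<omega>. \<omega> \<in> space M \<Longrightarrow> cadlag_path (\<lambda>t. W0 t \<omega>)"
    "potential (EZ_driver a X W0) W0" "integrable_proc (EZ_driver a X W0)"
    and c0: "0 < c0" "\<And>t. 0 \<le> t \<Longrightarrow> AE \<omega> in M. c0 * X t \<omega> \<le> W0 t \<omega>"
    using EZ_potential_exists[OF a Xp Xpos tb k Xint] by blast
  have W0pos: "AE \<omega> in M. 0 < W0 t \<omega>" if t: "0 \<le> t" for t
    using c0(2)[OF t] AE_space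
  proof eventually_elim
    case (elim \<omega>)
    have "0 < c0 * X t \<omega>" using c0(1) Xpos[OF t elim(2)] by simp
    then show ?case using elim(1) by linarith
  qed
  define V where "V t \<omega> = W0 t \<omega> / (1 - R)" for t \<omega>
  have VW0: "(\<lambda>t \<omega>. (1 - R) * V t \<omega>) = W0" using RS by (simp add: V_def)
  have Vcad: "cadlag_path (\<lambda>t. V t \<omega>)" if w: "\<omega> \<in> space M" for \<omega>
    unfolding cadlag_path_def V_def
  proof (intro allI impI conjI)
    fix t :: real assume t: "0 \<le> t"
    show "continuous (at_right t) (\<lambda>t. W0 t \<omega> / (1 - R))"
      using W0(2)[OF w] t RS unfolding cadlag_path_def continuous_within by (intro tendsto_divide tendsto_const) auto
    assume "0 < t"
    then obtain l where "((\<lambda>t. W0 t \<omega>) \<longlongrightarrow> l) (at_left t)" using W0(2)[OF w] t unfolding cadlag_path_def by blast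
    then have "((\<lambda>t. W0 t \<omega> / (1 - R)) \<longlongrightarrow> l / (1 - R)) (at_left t)" using RS by (intro tendsto_divide tendsto_const) auto
    then show "\<exists>l. ((\<lambda>t. W0 t \<omega> / (1 - R)) \<longlongrightarrow> l) (at_left t)" by blast
  qed
  have eqV: "(1 - R) * V t \<omega> = W0 t \<omega>" for t \<omega> using fun_cong[OF fun_cong[OF VW0]] .
  have "\<forall>t\<ge>0. AE \<omega> in M. 0 < (1 - R) * V t \<omega>" unfolding eqV using W0pos by blast
  moreover have "is_solution M F R S C V" unfolding sol_iff VW0 using W0 Vcad by blast
  ultimately have "is_proper_solution M F R S C V" unfolding proper_iff by blast
  moreover have "AE \<omega> in M. \<forall>t\<ge>0. Y t \<omega> = V t \<omega>" if Y: "is_proper_solution M F R S C Y" for Y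
  proof -
    define W where "W t \<omega> = (1 - R) * Y t \<omega>" for t \<omega>
    have W: "nonneg_proc W" "potential (EZ_driver a X W) W" "integrable_proc (EZ_driver a X W)"
      and Ycad: "\<And>\<omega>. \<omega> \<in> space M \<Longrightarrow> cadlag_path (\<lambda>t. Y t \<omega>)"
      and Wpos: "\<And>t. 0 \<le> t \<Longrightarrow> AE \<omega> in M. 0 < W t \<omega>"
      using Y unfolding proper_iff sol_iff W_def[abs_def] by blast+
    have "\<exists>c>0. \<exists>d>0. \<forall>t\<ge>0. AE \<omega> in M. c * X t \<omega> \<le> W t \<omega> \<and> W t \<omega> \<le> d * X t \<omega>"
      by (rule EZ_potential_comparable[OF a Xp _ tb k Xint tb' \<nu> k' W]) (simp_all add: Xpos Wpos)
    then obtain c d where cd: "0 < c" "0 < d" "\<And>t. 0 \<le> t \<Longrightarrow> AE \<omega> in M. c * X t \<omega> \<le> W t \<omega>"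
      "\<And>t. 0 \<le> t \<Longrightarrow> AE \<omega> in M. W t \<omega> \<le> d * X t \<omega>" by auto
    \<comment> \<open>The constructed solution came with a lower bound only; being positive, it
      receives its upper bound from the same comparison.\<close>
    have "\<exists>c>0. \<exists>d>0. \<forall>t\<ge>0. AE \<omega> in M. c * X t \<omega> \<le> W0 t \<omega> \<and> W0 t \<omega> \<le> d * X t \<omega>"
      by (rule EZ_potential_comparable[OF a Xp _ tb k Xint tb' \<nu> k' W0(1,3,4)]) (simp_all add: Xpos W0pos)
    then obtain c' d' where cd': "0 < c'" "0 < d'" "\<And>t. 0 \<le> t \<Longrightarrow> AE \<omega> in M. c' * X t \<omega> \<le> W0 t \<omega>"
      "\<And>t. 0 \<le> t \<Longrightarrow> AE \<omega> in M. W0 t \<omega> \<le> d' * X t \<omega>" by auto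
    have "AE \<omega> in M. Y t \<omega> = V t \<omega>" if t: "0 \<le> t" for t
    proof -
      \<comment> \<open>Each direction sets the upper bound of one solution against the lower bound
        of the other.\<close>
      have "AE \<omega> in M. W t \<omega> \<le> W0 t \<omega>"
        by (rule EZ_potential_le_comparable[OF a Xp W W0(1,3) cd'(1) _ cd(2) _ t]) (fact cd'(3) cd(4))+
      moreover have "AE \<omega> in M. W0 t \<omega> \<le> W t \<omega>"
        by (rule EZ_potential_le_comparable[OF a Xp W0(1,3,4) W(1,2) cd(1) _ cd'(2) _ t]) (fact cd(3) cd'(4))+
      ultimately show ?thesis
      proof eventually_elim
        case (elim \<omega>)
        then have "(1 - R) * Y t \<omega> = (1 - R) * V t \<omega>" unfolding eqV by (simp add: W_def)
        then show ?case using RS by simp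
      qed
    qed
    then show ?thesis by (intro indistinguishable_if_cadlag Ycad Vcad)
  qed
  ultimately show ?thesis by blast
qed

end
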